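(* Consider the linear equation $\dfrac{dZ_1}{dt}=T_1Z_1$ on $L^2(\mathbf{R},g(\omega)d\omega)$, with $T_1=\sqrt{-1}\,\mathcal{M}+\sqrt{-1}\,Kf_1\,\mathcal{P}$ and initial condition $q(\omega)\in L^2(\mathbf{R},g(\omega)d\omega)$. Suppose that (i) $\mathrm{Im}(f_1)<0$ and $0<K<K_c^{(1)}$; (ii) the probability density function $g(\omega)$ is real analytic on $\mathbf{R}$ and has a meromorphic continuation $g^*(\lambda)$ to the upper half plane; (iii) the initial condition $q(\omega)$ is real analytic on $\mathbf{R}$ and has an analytic continuation $q^*(\lambda)$ to the upper half plane; (iv) there exists a positive number $\delta$ such that $|F_1(\lambda)|\to0$ as $|\lambda|\to\infty$ in the angular domains $$|\arg(\lambda)-\pi/2|\le\delta,\qquad |\arg(\lambda)-3\pi/2|\le\delta;$$ (v) there exist positive constants $D$ and $\beta$ such that $|F_1(\lambda)|\le D e^{\beta|\lambda|}$ in the angular domain $\pi/2+\delta\le\arg(\lambda)\le3\pi/2-\delta$. Then there exist resonance poles of $T_1$ on the left half plane. Let $\alpha_1,\alpha_2,\dots$ be the resonance poles, ordered such that $|\alpha_1|\le|\alpha_2|\le\cdots$. Then there exists a positive constant $t_0$ such that the order parameter is given by $$Z_1^0(t)=(e^{T_1t}q,P_0)=\sum_{n=1}^{\infty}p_n(t)e^{\alpha_nt},\qquad t>t_0,$$ where each $p_n(t)$ is a polynomial in $t$. In particular, $Z_1^0(t)$ decays exponentially as $t\to\infty$.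
   Context: $g$ is a probability density function on $\mathbf{R}$, and $K>0$ is a parameter (coupling strength). $f_1\in\mathbf{C}$ is the first Fourier coefficient of a real-valued $C^1$ $2\pi$-periodic function $f(\theta)=\sum_l f_le^{\sqrt{-1}l\theta}$ with $f_0=0$. On $L^2(\mathbf{R},g(\omega)d\omega)$ with inner product $(q_1,q_2)=\int_{\mathbf{R}}q_1(\omega)\overline{q_2(\omega)}g(\omega)\,d\omega$, $\mathcal{M}:q(\omega)\mapsto\omega q(\omega)$ is the multiplication operator, $P_0(\omega)\equiv1$, and $\mathcal{P}q=(q,P_0)=\int_{\mathbf{R}}q(\omega)g(\omega)\,d\omega$. $e^{T_1t}$ is the semigroup generated by $T_1$ (with domain $\mathsf{D}(\mathcal{M})$), and the order parameter is $Z_1^0(t)=(Z_1(t,\cdot),P_0)=(e^{T_1t}q,P_0)$. Definition of $K_c^{(1)}$: let $y_1,y_2,\dots$ be the real roots $y$ of $$\lim_{x\to0}\int_{\mathbf{R}}\frac{\omega-y}{x^2+(\omega-y)^2}\,g(\omega)\,d\omega=\frac{\pi\,\mathrm{Re}(f_1)}{\mathrm{Im}(f_1)}\,g(y),$$ and put $K_c^{(1)}:=\inf_n\frac{-\mathrm{Im}(f_1)}{\pi|f_1|^2g(y_n)}$ (a quotient with $g(y_n)=0$ being $+\infty$). Put $D(\lambda)=\int_{\mathbf{R}}\frac{1}{\lambda-\sqrt{-1}\omega}g(\omega)\,d\omega$ (not to be confused with the constant $D$ in (v)). The function $F_0(\lambda)=((\lambda-T_1)^{-1}q,P_0)$, defined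 for $\mathrm{Re}(\lambda)>0$, has under (ii), (iii) a meromorphic continuation $F_1(\lambda)$ through the imaginary axis to the left half plane; $F_1=F_0$ for $\mathrm{Re}(\lambda)>0$ and, for $\mathrm{Re}(\lambda)<0$, $$F_1(\lambda)=\frac{((\lambda-\sqrt{-1}\mathcal{M})^{-1}q,P_0)+2\pi q^*(-\sqrt{-1}\lambda)g^*(-\sqrt{-1}\lambda)}{1-\sqrt{-1}Kf_1D(\lambda)-2\pi\sqrt{-1}Kf_1g^*(-\sqrt{-1}\lambda)}.$$ The resonance poles (the poles of $F_1$ on the left half plane, when $q^*$ has no poles) are the roots of $$D(\lambda)+2\pi g^*(-\sqrt{-1}\lambda)=\frac{1}{\sqrt{-1}Kf_1},\qquad\mathrm{Re}(\lambda)<0.$$ If there are only finitely many resonance poles, the sum in the conclusion is a finite sum.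
   Formalization: Existence of resonance poles is claimed only if F_0 is not identically zero (for q=0 it can fail); the bound in (v) is required only off disjoint discs with summable radii around the poles of F_1, which the pointwise bound implies. *)

theory Defs
  imports "HOL-Complex_Analysis.Complex_Analysis" "HOL-Computational_Algebra.Polynomial"
begin

section \<open>The coupling function and the critical coupling strength\<close>

definition fourier_coeff :: "(real \<Rightarrow> real) \<Rightarrow> int \<Rightarrow> complex" where
  "fourier_coeff f l =
     integral {0..2 * pi} (\<lambda>\<theta>. of_real (f \<theta>) * exp (- \<i> * of_int l * of_real \<theta>)) / of_real (2 * pi)"

definition coupling_function :: "(real \<Rightarrow> real) \<Rightarrow> bool" where
  "coupling_function f \<longleftrightarrow>
     f C1_differentiable_on UNIV \<and> (\<forall>\<theta>. f (\<theta> + 2 * pi) = f \<theta>) \<and> fourier_coeff f 0 = 0"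

definition prob_density :: "(real \<Rightarrow> real) \<Rightarrow> bool" where
  "prob_density g \<longleftrightarrow> (\<forall>\<omega>. 0 \<le> g \<omega>) \<and> has_bochner_integral lborel g 1"

definition critical_roots :: "(real \<Rightarrow> real) \<Rightarrow> complex \<Rightarrow> real set" where
  "critical_roots g f1 =
     {y. ((\<lambda>x. \<integral>\<omega>. (\<omega> - y) / (x\<^sup>2 + (\<omega> - y)\<^sup>2) * g \<omega> \<partial>lborel)
            \<longlongrightarrow> pi * Re f1 / Im f1 * g y) (at 0)}"

text \<open>
  The infimum is taken in the extended reals, so that it is \<open>\<infinity>\<close> if there are no roots.
\<close>

definition critical_coupling :: "(real \<Rightarrow> real) \<Rightarrow> complex \<Rightarrow> ereal" where
  "critical_coupling g f1 =
     (INF y \<in> critical_roots g f1.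
        if g y = 0 then \<infinity> else ereal (- Im f1 / (pi * (norm f1)\<^sup>2 * g y)))"

section \<open>Analytic and meromorphic continuation from the real line\<close>

definition real_analytic :: "(real \<Rightarrow> 'a::real_normed_vector) \<Rightarrow> bool" where
  "real_analytic f \<longleftrightarrow>
     (\<forall>x. \<exists>r>0. \<exists>a. \<forall>y. \<bar>y - x\<bar> < r \<longrightarrow> (\<lambda>n. (y - x) ^ n *\<^sub>R a n) sums f y)"

text \<open>
  The continuations are total functions; the values away from the closed upper half plane are
  irrelevant, except that analyticity at a real point refers to a full complex neighbourhood of it.
  Nice meromorphy normalises the values: they are the limits, except at poles.
\<close>

definition meromorphic_continuation_upper :: "(real \<Rightarrow> complex) \<Rightarrow> (complex \<Rightarrow> complex) \<Rightarrow> bool" where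
  "meromorphic_continuation_upper f fs \<longleftrightarrow>
     (\<forall>x. fs (of_real x) = f x) \<and> fs analytic_on \<real> \<and> fs nicely_meromorphic_on {z. 0 < Im z}"

definition analytic_continuation_upper :: "(real \<Rightarrow> complex) \<Rightarrow> (complex \<Rightarrow> complex) \<Rightarrow> bool" where
  "analytic_continuation_upper f fs \<longleftrightarrow>
     (\<forall>x. fs (of_real x) = f x) \<and> fs analytic_on {z. 0 \<le> Im z}"

section \<open>Operators and semigroups on the weighted space of square integrable functions\<close>

text \<open>
  Elements of \<open>L\<^sup>2(\<real>, g(\<omega>) d\<omega>)\<close> are represented by functions; equality in the space is equality
  almost everywhere with respect to the weighted measure.
\<close>

definition weighted :: "(real \<Rightarrow> real) \<Rightarrow> real measure" where
  "weighted g = density lborel (\<lambda>\<omega>. ennreal (g \<omega>))"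

definition L2 :: "(real \<Rightarrow> real) \<Rightarrow> (real \<Rightarrow> complex) set" where
  "L2 g = {u. u \<in> borel_measurable borel \<and> integrable (weighted g) (\<lambda>\<omega>. (norm (u \<omega>))\<^sup>2)}"

definition L2_inner :: "(real \<Rightarrow> real) \<Rightarrow> (real \<Rightarrow> complex) \<Rightarrow> (real \<Rightarrow> complex) \<Rightarrow> complex" where
  "L2_inner g u v = (\<integral>\<omega>. u \<omega> * cnj (v \<omega>) \<partial>weighted g)"

definition L2_norm :: "(real \<Rightarrow> real) \<Rightarrow> (real \<Rightarrow> complex) \<Rightarrow> real" where
  "L2_norm g u = sqrt (\<integral>\<omega>. (norm (u \<omega>))\<^sup>2 \<partial>weighted g)"

definition P0 :: "real \<Rightarrow> complex" where
  "P0 = (\<lambda>\<omega>. 1)"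

text \<open>
  A bounded linear map respects equality almost everywhere, so the conditions below describe
  a strongly continuous semigroup of operators on the quotient space.
\<close>

definition C0_semigroup ::
    "(real \<Rightarrow> real) \<Rightarrow> (real \<Rightarrow> (real \<Rightarrow> complex) \<Rightarrow> real \<Rightarrow> complex) \<Rightarrow> bool" where
  "C0_semigroup g S \<longleftrightarrow>
     (\<forall>t\<ge>0. \<forall>u\<in>L2 g. S t u \<in> L2 g) \<and>
     (\<forall>t\<ge>0. \<forall>u\<in>L2 g. \<forall>v\<in>L2 g. \<forall>a b.
        AE \<omega> in weighted g. S t (\<lambda>\<xi>. a * u \<xi> + b * v \<xi>) \<omega> = a * S t u \<omega> + b * S t v \<omega>) \<and>
     (\<forall>t\<ge>0. \<exists>C. \<forall>u\<in>L2 g. L2_norm g (S t u) \<le> C * L2_norm g u) \<and>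
     (\<forall>u\<in>L2 g. AE \<omega> in weighted g. S 0 u \<omega> = u \<omega>) \<and>
     (\<forall>s\<ge>0. \<forall>t\<ge>0. \<forall>u\<in>L2 g. AE \<omega> in weighted g. S (s + t) u \<omega> = S s (S t u) \<omega>) \<and>
     (\<forall>u\<in>L2 g. ((\<lambda>t. L2_norm g (\<lambda>\<omega>. S t u \<omega> - u \<omega>)) \<longlongrightarrow> 0) (at_right 0))"

text \<open>The operator \<open>T\<close> with domain \<open>A\<close> is the infinitesimal generator of \<open>S\<close>.\<close>

definition generates ::
    "(real \<Rightarrow> real) \<Rightarrow> (real \<Rightarrow> complex) set \<Rightarrow> ((real \<Rightarrow> complex) \<Rightarrow> real \<Rightarrow> complex) \<Rightarrow>
     (real \<Rightarrow> (real \<Rightarrow> complex) \<Rightarrow> real \<Rightarrow> complex) \<Rightarrow> bool" where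
  "generates g A T S \<longleftrightarrow>
     C0_semigroup g S \<and>
     (\<forall>u\<in>L2 g. \<forall>v\<in>L2 g.
        ((\<lambda>h. L2_norm g (\<lambda>\<omega>. (S h u \<omega> - u \<omega>) / of_real h - v \<omega>)) \<longlongrightarrow> 0) (at_right 0)
        \<longleftrightarrow> u \<in> A \<and> (AE \<omega> in weighted g. T u \<omega> = v \<omega>))"

definition mult_op :: "(real \<Rightarrow> complex) \<Rightarrow> real \<Rightarrow> complex" where
  "mult_op u = (\<lambda>\<omega>. of_real \<omega> * u \<omega>)"

definition mult_dom :: "(real \<Rightarrow> real) \<Rightarrow> (real \<Rightarrow> complex) set" where
  "mult_dom g = {u \<in> L2 g. mult_op u \<in> L2 g}"

definition T1 :: "(real \<Rightarrow> real) \<Rightarrow> real \<Rightarrow> complex \<Rightarrow> (real \<Rightarrow> complex) \<Rightarrow> real \<Rightarrow> complex" where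
  "T1 g K f1 u = (\<lambda>\<omega>. \<i> * mult_op u \<omega> + \<i> * of_real K * f1 * L2_inner g u P0)"

text \<open>
  For \<open>z\<close> in the resolvent set of \<open>T\<close> the function chosen here is unique up to equality
  almost everywhere.
\<close>

definition resolvent ::
    "(real \<Rightarrow> real) \<Rightarrow> (real \<Rightarrow> complex) set \<Rightarrow> ((real \<Rightarrow> complex) \<Rightarrow> real \<Rightarrow> complex) \<Rightarrow>
     complex \<Rightarrow> (real \<Rightarrow> complex) \<Rightarrow> real \<Rightarrow> complex" where
  "resolvent g A T z q = (SOME u. u \<in> A \<and> (AE \<omega> in weighted g. z * u \<omega> - T u \<omega> = q \<omega>))"

section \<open>The continued resolvent and the resonance poles\<close>

definition D_fun :: "(real \<Rightarrow> real) \<Rightarrow> complex \<Rightarrow> complex" where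
  "D_fun g z = (\<integral>\<omega>. 1 / (z - \<i> * of_real \<omega>) * of_real (g \<omega>) \<partial>lborel)"

definition F0 :: "(real \<Rightarrow> real) \<Rightarrow> real \<Rightarrow> complex \<Rightarrow> (real \<Rightarrow> complex) \<Rightarrow> complex \<Rightarrow> complex" where
  "F0 g K f1 q z = L2_inner g (resolvent g (mult_dom g) (T1 g K f1) z q) P0"

definition F1_left ::
    "(real \<Rightarrow> real) \<Rightarrow> (complex \<Rightarrow> complex) \<Rightarrow> real \<Rightarrow> complex \<Rightarrow> (real \<Rightarrow> complex) \<Rightarrow>
     (complex \<Rightarrow> complex) \<Rightarrow> complex \<Rightarrow> complex" where
  "F1_left g gs K f1 q qs z =
     (L2_inner g (resolvent g (mult_dom g) (\<lambda>u \<omega>. \<i> * mult_op u \<omega>) z q) P0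
        + 2 * of_real pi * qs (- \<i> * z) * gs (- \<i> * z)) /
     (1 - \<i> * of_real K * f1 * D_fun g z - 2 * of_real pi * \<i> * of_real K * f1 * gs (- \<i> * z))"

text \<open>
  The meromorphic continuation of \<^const>\<open>F0\<close> through the imaginary axis. On the axis its value is
  the limit from the right. In the left half plane the quotient has removable singularities at
  the poles of \<open>gs\<close>, where numerator and denominator blow up together, and possibly at common
  zeros of both; \<^const>\<open>remove_sings\<close> fills these in and is \<open>0\<close> at genuine poles.
\<close>

definition F1 ::
    "(real \<Rightarrow> real) \<Rightarrow> (complex \<Rightarrow> complex) \<Rightarrow> real \<Rightarrow> complex \<Rightarrow> (real \<Rightarrow> complex) \<Rightarrow>
     (complex \<Rightarrow> complex) \<Rightarrow> complex \<Rightarrow> complex" where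
  "F1 g gs K f1 q qs z =
     (if Re z > 0 then F0 g K f1 q z
      else if Re z < 0 then remove_sings (F1_left g gs K f1 q qs) z
      else Lim (at z within {z. 0 < Re z}) (F0 g K f1 q))"

text \<open>
  The roots are sought where \<open>gs\<close> is defined, that is, off its poles.
\<close>

definition resonance_poles ::
    "(real \<Rightarrow> real) \<Rightarrow> (complex \<Rightarrow> complex) \<Rightarrow> real \<Rightarrow> complex \<Rightarrow> complex set" where
  "resonance_poles g gs K f1 =
     {z. Re z < 0 \<and> \<not> is_pole gs (- \<i> * z) \<and>
         D_fun g z + 2 * of_real pi * gs (- \<i> * z) = 1 / (\<i> * of_real K * f1)}"

text \<open>
  An enumeration of a finite or countably infinite set by nondecreasing modulus, indexed from \<open>0\<close>.
\<close>

definition enum_index :: "complex set \<Rightarrow> nat set" where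
  "enum_index R = {n. finite R \<longrightarrow> n < card R}"

definition enumerates_by_norm :: "(nat \<Rightarrow> complex) \<Rightarrow> complex set \<Rightarrow> bool" where
  "enumerates_by_norm \<alpha> R \<longleftrightarrow>
     bij_betw \<alpha> (enum_index R) R \<and>
     (\<forall>m\<in>enum_index R. \<forall>n\<in>enum_index R. m \<le> n \<longrightarrow> norm (\<alpha> m) \<le> norm (\<alpha> n))"

section \<open>Growth conditions\<close>

text \<open>
  \<^const>\<open>Arg2pi\<close> takes values in \<open>[0, 2\<pi>)\<close>, so both vertical directions are interior points of its range.
\<close>

definition vertical_sectors :: "real \<Rightarrow> complex set" where
  "vertical_sectors \<delta> =
     {z. z \<noteq> 0 \<and> (\<bar>Arg2pi z - pi / 2\<bar> \<le> \<delta> \<or> \<bar>Arg2pi z - 3 * pi / 2\<bar> \<le> \<delta>)}"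

definition left_sector :: "real \<Rightarrow> complex set" where
  "left_sector \<delta> = {z. z \<noteq> 0 \<and> pi / 2 + \<delta> \<le> Arg2pi z \<and> Arg2pi z \<le> 3 * pi / 2 - \<delta>}"

text \<open>
  A meromorphic function can only satisfy \<open>|F(z)| \<le> D exp(\<beta>|z|)\<close> away from its poles. This is
  made precise by excluding disjoint discs around the poles in \<open>A\<close> whose radii have a finite sum.
  If there are no poles in \<open>A\<close>, it is the bound at every point of \<open>A\<close>, and the bound at
  every point of \<open>A\<close> always implies it; see the two lemmas.
\<close>

definition exp_bounded_off_poles ::
    "(complex \<Rightarrow> complex) \<Rightarrow> complex set \<Rightarrow> real \<Rightarrow> real \<Rightarrow> bool" where
  "exp_bounded_off_poles F A D \<beta> \<longleftrightarrow>
     (\<exists>\<rho> :: complex \<Rightarrow> real.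
        (\<forall>\<alpha>\<in>{\<alpha>\<in>A. is_pole F \<alpha>}. 0 < \<rho> \<alpha>) \<and>
        disjoint_family_on (\<lambda>\<alpha>. ball \<alpha> (\<rho> \<alpha>)) {\<alpha>\<in>A. is_pole F \<alpha>} \<and>
        \<rho> summable_on {\<alpha>\<in>A. is_pole F \<alpha>} \<and>
        (\<forall>z\<in>A - (\<Union>\<alpha>\<in>{\<alpha>\<in>A. is_pole F \<alpha>}. ball \<alpha> (\<rho> \<alpha>)). norm (F z) \<le> D * exp (\<beta> * norm z)))"

lemma exp_bounded_off_poles_no_poles:
  assumes "\<And>\<alpha>. \<alpha> \<in> A \<Longrightarrow> \<not> is_pole F \<alpha>"
  shows "exp_bounded_off_poles F A D \<beta> \<longleftrightarrow> (\<forall>z\<in>A. norm (F z) \<le> D * exp (\<beta> * norm z))"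
proof -
  have *: "{\<alpha>\<in>A. is_pole F \<alpha>} = {}" using assms by auto
  show ?thesis
    unfolding exp_bounded_off_poles_def * by (simp add: disjoint_family_on_def)
qed

lemma exp_bounded_imp_exp_bounded_off_poles:
  assumes lim: "\<And>z. z \<in> A \<Longrightarrow> z islimpt A"
    and bound: "\<forall>z\<in>A. norm (F z) \<le> D * exp (\<beta> * norm z)"
  shows "exp_bounded_off_poles F A D \<beta>"
proof -
  have "\<not> is_pole F \<alpha>" if "\<alpha> \<in> A" for \<alpha>
  proof
    assume "is_pole F \<alpha>"
    then have "filterlim F at_infinity (at \<alpha> within A)"
      unfolding is_pole_def by (rule filterlim_mono) (auto intro: at_le)
    then have "filterlim (\<lambda>z. norm (F z)) at_top (at \<alpha> within A)"
      by (rule filterlim_at_infinity_imp_norm_at_top)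
    then have "\<forall>\<^sub>F z in at \<alpha> within A. D * exp (\<beta> * norm \<alpha>) + 1 < norm (F z)"
      by (simp add: filterlim_at_top_dense)
    moreover have "((\<lambda>z. D * exp (\<beta> * norm z)) \<longlongrightarrow> D * exp (\<beta> * norm \<alpha>)) (at \<alpha> within A)"
      by (intro tendsto_intros)
    then have "\<forall>\<^sub>F z in at \<alpha> within A. D * exp (\<beta> * norm z) < D * exp (\<beta> * norm \<alpha>) + 1"
      by (rule order_tendstoD) simp
    moreover have "\<forall>\<^sub>F z in at \<alpha> within A. z \<in> A"
      by (simp add: eventually_at_filter)
    ultimately have "\<forall>\<^sub>F z in at \<alpha> within A. False"
      by eventually_elim (use bound in force)
    moreover have "at \<alpha> within A \<noteq> bot"
      using lim[OF that] by (simp add: trivial_limit_within)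
    ultimately show False by simp
  qed
  then show ?thesis using bound exp_bounded_off_poles_no_poles by blast
qed

end

(*
  The resolvent of the rank one perturbation T1 shows that F1 is the quotient N / B, where N and
  D are the continued Cauchy transforms of q g and g, and B = 1 - i K f1 D. Below the critical
  coupling, B has no roots with Re z >= 0: on the imaginary axis Re D = pi g is too small for D to meet the ray of multiples s w,
  s >= 1, of w = 1 / (i K f1), and a connectedness argument in s inside a large rectangle carries
  this to the half plane. The horizontal sides of the rectangle must lie at heights y with
  Re D(x + i y) < Re w for all x > 0, and these exist by a covering argument for the mass of g.

  By uniform boundedness, the order parameter has a Laplace transform, which is F1 far to the right.
  The inversion integral over an arc of radius R is bent into the vertical sectors. There F1 tends
  to 0, so that after two integrations in t the bent integrals converge locally uniformly in a complex
  sector of t; by analyticity the convergence survives two differentiations, which recovers Z. Closing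
  the arc on the left, where the bound by exp (beta |z|) is beaten for large t, leaves the residues.
  As the radii of the exceptional discs are summable, there are good values of R, and each residue is
  bounded by a multiple of the radius of its disc. So the residues are absolutely summable and can be
  added in any order.
*)
theory Submission
  imports Defs
begin

section \<open>Cauchy transforms and their continuation across the imaginary axis\<close>

text \<open>The semigroup is given only through its generator, on representatives of L2 classes. Its
  properties are therefore read off scalar functions: pairing the resolvent equation with
  \<open>P0\<close> leaves a linear equation for one number, and \<open>Z u t\<close> is
  differentiable in t for u in the domain. The order parameter of a general q is only known to be
  continuous, so its inversion integral need not converge absolutely. Dividing by z^2 makes it do
  so, at the price of two derivatives in t; this is why t becomes complex. The half opening
  \<open>\<eta>\<close> of the sector \<open>\<Theta>\<close> of times is also the angle by which
  the arc is bent past the imaginary axis, and it gives Re z \<le> - sin \<eta> |z| on the left arc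
  and at distant poles. Hence the time scale: exp(\<beta> |z|) is beaten once t sin \<eta> >
  \<beta>. Existence of resonances comes last. Without any, the order parameter vanishes for large
  t, hence for all t > 0 by analyticity, and its Laplace transform \<open>F0\<close> would
  vanish.\<close>

definition cauchy_transform :: "(real \<Rightarrow> complex) \<Rightarrow> complex \<Rightarrow> complex" where
  "cauchy_transform \<phi> z = (\<integral>\<omega>. \<phi> \<omega> / (z - \<i> * of_real \<omega>) \<partial>lborel)"

text \<open>The distance bound is asked only where \<open>\<phi>\<close> is nonzero, so that besides
  points off the axis the lemma also covers points of the axis itself, for a density that is cut off
  near them.\<close>

lemma cauchy_transform_integrable:
  assumes \<phi>: "integrable lborel \<phi>" and c: "0 < c"
    and far: "\<And>\<omega>. \<phi> \<omega> \<noteq> 0 \<Longrightarrow> c \<le> norm (z - \<i> * of_real \<omega>)"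
  shows "integrable lborel (\<lambda>\<omega>. \<phi> \<omega> / (z - \<i> * of_real \<omega>))"
proof (rule Bochner_Integration.integrable_bound)
  show "integrable lborel (\<lambda>\<omega>. norm (\<phi> \<omega>) / c)" using \<phi> by simp
  show "(\<lambda>\<omega>. \<phi> \<omega> / (z - \<i> * of_real \<omega>)) \<in> borel_measurable lborel"
    using borel_measurable_integrable[OF \<phi>] by measurable
  show "AE \<omega> in lborel. norm (\<phi> \<omega> / (z - \<i> * of_real \<omega>)) \<le> norm (norm (\<phi> \<omega>) / c)"
  proof (rule AE_I2)
    fix \<omega> show "norm (\<phi> \<omega> / (z - \<i> * of_real \<omega>)) \<le> norm (norm (\<phi> \<omega>) / c)"
    proof (cases "\<phi> \<omega> = 0")
      case False
      then have "c \<le> norm (z - \<i> * of_real \<omega>)" by (rule far)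
      moreover from this have "0 < norm (z - \<i> * of_real \<omega>)" using c by linarith
      ultimately show ?thesis using c by (simp add: norm_divide divide_left_mono)
    qed simp
  qed
qed

lemma cauchy_transform_holomorphic:
  assumes \<phi>: "integrable lborel \<phi>" and c: "0 < c" and "open \<Omega>"
    and far: "\<And>z \<omega>. z \<in> \<Omega> \<Longrightarrow> \<phi> \<omega> \<noteq> 0 \<Longrightarrow> c \<le> norm (z - \<i> * of_real \<omega>)"
  shows "cauchy_transform \<phi> holomorphic_on \<Omega>"
proof -
  have "\<exists>D. (cauchy_transform \<phi> has_field_derivative D) (at z)" if z: "z \<in> \<Omega>" for z
  proof -
    define D where "D = (\<integral>\<omega>. - \<phi> \<omega> / (z - \<i> * of_real \<omega>)\<^sup>2 \<partial>lborel)"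
    define C where "C = (\<integral>\<omega>. norm (\<phi> \<omega>) / c ^ 3 \<partial>lborel)"
    have [measurable]: "\<phi> \<in> borel_measurable borel"
      using borel_measurable_integrable[OF \<phi>] by simp
    have iD: "integrable lborel (\<lambda>\<omega>. - \<phi> \<omega> / (z - \<i> * of_real \<omega>)\<^sup>2)"
    proof (rule Bochner_Integration.integrable_bound)
      show "integrable lborel (\<lambda>\<omega>. norm (\<phi> \<omega>) / c\<^sup>2)" using \<phi> by simp
      have "norm (\<phi> \<omega>) / (norm (z - \<i> * of_real \<omega>))\<^sup>2 \<le> norm (\<phi> \<omega>) / c\<^sup>2" for \<omega>
      proof (cases "\<phi> \<omega> = 0")
        case False
        then have "c\<^sup>2 \<le> (norm (z - \<i> * of_real \<omega>))\<^sup>2" using far[OF z] c by (intro power_mono) auto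
        moreover from this have "0 < (norm (z - \<i> * of_real \<omega>))\<^sup>2" using c
          by (meson less_le_trans zero_less_power)
          ultimately show ?thesis using c by (simp add: divide_left_mono)
      qed simp
      then show "AE \<omega> in lborel. norm (- \<phi> \<omega> / (z - \<i> * of_real \<omega>)\<^sup>2) \<le> norm (norm (\<phi> \<omega>) / c\<^sup>2)"
        by (simp add: norm_divide norm_power)
    qed measurable
    have bound: "norm ((cauchy_transform \<phi> w - cauchy_transform \<phi> z) / (w - z) - D) \<le> C * norm (w - z)"
      if w: "w \<in> \<Omega>" "w \<noteq> z" for w
    proof -
      note i = cauchy_transform_integrable[OF \<phi> c far, OF w(1)] cauchy_transform_integrable[OF \<phi> c far, OF z]
      have "(cauchy_transform \<phi> w - cauchy_transform \<phi> z) / (w - z) - D =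
         (\<integral>\<omega>. (\<phi> \<omega> / (w - \<i> * of_real \<omega>) - \<phi> \<omega> / (z - \<i> * of_real \<omega>)) / (w - z) - (- \<phi> \<omega> / (z - \<i> * of_real \<omega>)\<^sup>2) \<partial>lborel)"
        unfolding cauchy_transform_def D_def using i iD by simp
      also have "norm \<dots> \<le> (\<integral>\<omega>. norm (w - z) * (norm (\<phi> \<omega>) / c ^ 3) \<partial>lborel)"
      proof (rule Bochner_Integration.integral_norm_bound_integral)
        show "integrable lborel (\<lambda>\<omega>. norm (w - z) * (norm (\<phi> \<omega>) / c ^ 3))" using \<phi> by simp
        show "integrable lborel (\<lambda>\<omega>. (\<phi> \<omega> / (w - \<i> * of_real \<omega>) - \<phi> \<omega> / (z - \<i> * of_real \<omega>)) / (w - z)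
            - (- \<phi> \<omega> / (z - \<i> * of_real \<omega>)\<^sup>2))" using i iD by simp
        show "norm ((\<phi> \<omega> / (w - \<i> * of_real \<omega>) - \<phi> \<omega> / (z - \<i> * of_real \<omega>)) / (w - z)
            - (- \<phi> \<omega> / (z - \<i> * of_real \<omega>)\<^sup>2)) \<le> norm (w - z) * (norm (\<phi> \<omega>) / c ^ 3)" for \<omega>
        proof (cases "\<phi> \<omega> = 0")
          case False
          define a b where "a = w - \<i> * of_real \<omega>" and "b = z - \<i> * of_real \<omega>"
          have ab: "c \<le> norm a" "c \<le> norm b" "a \<noteq> b" using far[OF w(1) False] far[OF z False] w
            by (auto simp: a_def b_def)
          have nz: "a \<noteq> 0" "b \<noteq> 0" using ab c by auto
          have wz: "w - z = a - b" by (simp add: a_def b_def)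
          \<comment> \<open>The error of the difference quotient of 1/(z - i \<omega>) is exactly (a
            - b) / (a b^2), and a, b have modulus at least c; this gives the integrable majorant and
            the Lipschitz constant \<open>C\<close>.\<close>
          have "(\<phi> \<omega> / a - \<phi> \<omega> / b) / (a - b) - (- \<phi> \<omega> / b\<^sup>2) = (a - b) * \<phi> \<omega> / (a * b\<^sup>2)"
            using nz ab(3) by (simp add: divide_simps power2_eq_square) (simp add: algebra_simps)
          moreover have "c * c\<^sup>2 \<le> norm a * (norm b)\<^sup>2"
            using ab c by (intro mult_mono power_mono) auto
          then have "norm (a - b) * norm (\<phi> \<omega>) / (norm a * (norm b)\<^sup>2) \<le> norm (a - b) * norm (\<phi> \<omega>) / c ^ 3"
            using c nz by (intro divide_left_mono) (auto simp: power3_eq_cube power2_eq_square mult.assoc)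
          ultimately show ?thesis unfolding wz
            unfolding a_def[symmetric] b_def[symmetric] by (simp add: norm_mult norm_divide norm_power)
        qed simp
      qed
      also have "\<dots> = C * norm (w - z)" unfolding C_def
        by (subst Bochner_Integration.integral_mult_right_zero) (simp add: mult.commute)
      finally show ?thesis .
    qed
    have ev: "\<forall>\<^sub>F w in at z. w \<in> \<Omega> \<and> w \<noteq> z"
      using \<open>open \<Omega>\<close> z eventually_at_in_open' by (auto simp: eventually_conj_iff eventually_neq_at_within)
    have "((\<lambda>w. (cauchy_transform \<phi> w - cauchy_transform \<phi> z) / (w - z) - D) \<longlongrightarrow> 0) (at z)"
    proof (rule Lim_null_comparison)
      show "\<forall>\<^sub>F w in at z. norm ((cauchy_transform \<phi> w - cauchy_transform \<phi> z) / (w - z) - D) \<le> C * norm (w - z)"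
        using ev by eventually_elim (use bound in auto)
      have "((\<lambda>w. C * norm (w - z)) \<longlongrightarrow> C * norm (z - z)) (at z)" by (intro tendsto_intros)
      then show "((\<lambda>w. C * norm (w - z)) \<longlongrightarrow> 0) (at z)" by simp
    qed
    then show ?thesis by (auto simp: has_field_derivative_iff LIM_zero_iff)
  qed
  then show ?thesis using \<open>open \<Omega>\<close> by (auto simp: holomorphic_on_open)
qed

lemma norm_minus_imaginary_ge: "\<bar>Re z\<bar> \<le> norm (z - \<i> * of_real \<omega>)"
  using abs_Re_le_cmod[of "z - \<i> * of_real \<omega>"] by simp

lemma cauchy_transform_integrable':
  assumes "integrable lborel \<phi>" "Re z \<noteq> 0"
  shows "integrable lborel (\<lambda>\<omega>. \<phi> \<omega> / (z - \<i> * of_real \<omega>))"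
  by (rule cauchy_transform_integrable[OF assms(1), where c = "\<bar>Re z\<bar>"]) (use assms norm_minus_imaginary_ge in auto)

lemma cauchy_transform_analytic:
  assumes \<phi>: "integrable lborel \<phi>"
  shows "cauchy_transform \<phi> analytic_on {z. Re z \<noteq> 0}"
proof -
  have "cauchy_transform \<phi> analytic_on {z}" if z: "Re z \<noteq> 0" for z
  proof -
    have "cauchy_transform \<phi> holomorphic_on {w. \<bar>Re w\<bar> > \<bar>Re z\<bar> / 2}"
    proof (rule cauchy_transform_holomorphic[OF \<phi>])
      show "0 < \<bar>Re z\<bar> / 2" using z by auto
      show "open {w. \<bar>Re w\<bar> > \<bar>Re z\<bar> / 2}" by (intro open_Collect_less continuous_intros)
    qed (use norm_minus_imaginary_ge in \<open>auto intro: less_imp_le order.trans\<close>)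
    moreover have "open {w. \<bar>Re w\<bar> > \<bar>Re z\<bar> / 2}" by (intro open_Collect_less continuous_intros)
    ultimately have "cauchy_transform \<phi> analytic_on {w. \<bar>Re w\<bar> > \<bar>Re z\<bar> / 2}" by (simp add: analytic_on_open)
    then show ?thesis by (rule analytic_on_subset) (use z in auto)
  qed
  then show ?thesis using analytic_on_analytic_at by blast
qed

lemma norm_cauchy_transform_le:
  assumes \<phi>: "integrable lborel \<phi>" and "Re z \<noteq> 0"
  shows "norm (cauchy_transform \<phi> z) \<le> (\<integral>\<omega>. norm (\<phi> \<omega>) \<partial>lborel) / \<bar>Re z\<bar>"
proof -
  have "norm (cauchy_transform \<phi> z) \<le> (\<integral>\<omega>. norm (\<phi> \<omega>) / \<bar>Re z\<bar> \<partial>lborel)"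
    unfolding cauchy_transform_def
  proof (rule Bochner_Integration.integral_norm_bound_integral)
    show "norm (\<phi> \<omega> / (z - \<i> * of_real \<omega>)) \<le> norm (\<phi> \<omega>) / \<bar>Re z\<bar>" for \<omega>
      using norm_minus_imaginary_ge[of z \<omega>] assms(2) unfolding norm_divide
      by (intro divide_left_mono) (auto intro!: mult_pos_pos)
  qed (use assms cauchy_transform_integrable' in auto)
  then show ?thesis by simp
qed

lemma cauchy_integral_linepath_holomorphic:
  assumes f: "continuous_on (closed_segment a b) f"
  shows "(\<lambda>w. contour_integral (linepath a b) (\<lambda>u. f u / (u - w))) holomorphic_on - closed_segment a b"
proof -
  have "((\<lambda>w. contour_integral (linepath a b) (\<lambda>u. f u / (u - w))) has_field_derivative
      of_nat 1 * contour_integral (linepath a b) (\<lambda>u. f u / (u - w) ^ Suc 1)) (at w)"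
    if w: "w \<notin> closed_segment a b" for w
  proof (rule Cauchy_next_derivative(2)[where k = 1 and S = UNIV and B = "norm (b - a)"])
    show "((\<lambda>u. f u / (u - w) ^ 1) has_contour_integral contour_integral (linepath a b) (\<lambda>u. f u / (u - w))) (linepath a b)"
      if "w \<in> UNIV - path_image (linepath a b)" for w
      using that
        by (auto intro!: has_contour_integral_integral contour_integrable_continuous_linepath continuous_intros f)
  qed (use f w in auto)
  then show ?thesis
    by (subst holomorphic_on_open) (auto simp: open_Compl)
qed

text \<open>The rotation w = -i z turns the transform over [y-r, y+r] into i times a Cauchy integral
  over the base [a, b] of a triangle with apex \<open>m\<close> in the upper half plane. The
  integral over the other two sides is holomorphic near y and serves on both sides of the axis: for
  Re z > 0 the point w lies below the triangle and Cauchy's theorem identifies the two integrals,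
  for Re z < 0 it lies inside and the residue 2 pi i \<phi>s(w) appears. The mass outside [y-r, y+r]
  is at a distance and causes no singularity.\<close>

lemma cauchy_transform_continuation:
  assumes \<phi>: "integrable lborel \<phi>" and ext: "\<And>x. \<phi>s (of_real x) = \<phi> x" and an: "\<phi>s analytic_on {of_real y}"
  obtains \<epsilon> h where "0 < \<epsilon>" "h holomorphic_on ball (\<i> * of_real y) \<epsilon>"
    "\<And>z. z \<in> ball (\<i> * of_real y) \<epsilon> \<Longrightarrow> 0 < Re z \<Longrightarrow> h z = cauchy_transform \<phi> z"
    "\<And>z. z \<in> ball (\<i> * of_real y) \<epsilon> \<Longrightarrow> Re z < 0 \<Longrightarrow> h z = cauchy_transform \<phi> z + 2 * of_real pi * \<phi>s (- \<i> * z)"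
proof -
  obtain R where R: "0 < R" "\<phi>s holomorphic_on ball (of_real y) R" using an by (auto simp: analytic_on_def)
  define r where "r = R / 2"
  have r: "0 < r" "r < R" using R by (auto simp: r_def)
  define a b m where "a = complex_of_real (y - r)" and "b = complex_of_real (y + r)" and "m = Complex y r"
  have abm: "a \<in> ball (of_real y) R" "b \<in> ball (of_real y) R" "m \<in> ball (of_real y) R"
    using r by (auto simp: a_def b_def m_def dist_norm norm_mult cmod_def)
  then have hull: "convex hull {a, b, m} \<subseteq> ball (of_real y) R" by (intro hull_minimal) auto
  then have segs: "closed_segment b m \<subseteq> ball (of_real y) R" "closed_segment m a \<subseteq> ball (of_real y) R"
     "closed_segment a b \<subseteq> ball (of_real y) R"
    using abm by (meson closed_segment_subset convex_ball)+
  have cont: "continuous_on (ball (of_real y) R) \<phi>s" using R holomorphic_on_imp_continuous_on by blast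
  define \<phi>i \<phi>o where "\<phi>i = (\<lambda>\<omega>. if \<omega> \<in> {y-r..y+r} then \<phi> \<omega> else 0)"
    and "\<phi>o = (\<lambda>\<omega>. if \<omega> \<in> {y-r..y+r} then 0 else \<phi> \<omega>)"
  have [measurable]: "\<phi> \<in> borel_measurable borel" using borel_measurable_integrable[OF \<phi>] by simp
  have ii: "integrable lborel \<phi>i"
    by (rule Bochner_Integration.integrable_bound[OF \<phi>]) (auto simp: \<phi>i_def)
  have io: "integrable lborel \<phi>o"
    by (rule Bochner_Integration.integrable_bound[OF \<phi>]) (auto simp: \<phi>o_def)
  define J
    where "J w = contour_integral (linepath b m) (\<lambda>u. \<phi>s u / (u - w)) + contour_integral (linepath m a) (\<lambda>u. \<phi>s u / (u - w))" for w
  define h where "h z = cauchy_transform \<phi>o z - \<i> * J (- \<i> * z)" for z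
  \<comment> \<open>Within r/2 of y the sum |Re w - y| + |Im w| stays below r, while it equals r on
    the two upper sides of the triangle.\<close>
  define \<epsilon> where "\<epsilon> = r / 2"
  have \<epsilon>: "0 < \<epsilon>" using r by (simp add: \<epsilon>_def)
  have near: "\<bar>Re w - y\<bar> + \<bar>Im w\<bar> < r" if "w \<in> ball (of_real y) \<epsilon>" for w
    using that abs_Re_le_cmod[of "w - of_real y"] abs_Im_le_cmod[of "w - of_real y"]
      by (auto simp: \<epsilon>_def dist_norm norm_minus_commute)
  have rot: "- \<i> * z \<in> ball (of_real y) \<epsilon>" if "z \<in> ball (\<i> * of_real y) \<epsilon>" for z
  proof -
    have "norm (of_real y - (- \<i> * z)) = norm (- \<i> * (\<i> * of_real y - z))" by (simp add: algebra_simps)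
    then show ?thesis using that by (simp add: dist_norm norm_mult del: mult_minus_left)
  qed
  have offbm: "w \<notin> closed_segment b m" and offma: "w \<notin> closed_segment m a" if w: "w \<in> ball (of_real y) \<epsilon>"
    for w
  proof -
    show "w \<notin> closed_segment b m"
    proof
      assume "w \<in> closed_segment b m"
      then obtain u where u: "0 \<le> u" "u \<le> 1" "w = (1 - u) *\<^sub>R b + u *\<^sub>R m" by (auto simp: closed_segment_def)
      then have "Re w - y + Im w = r" unfolding u(3) b_def m_def by simp (simp add: algebra_simps)
      then show False using near[OF w] by auto
    qed
    show "w \<notin> closed_segment m a"
    proof
      assume "w \<in> closed_segment m a"
      then obtain u where u: "0 \<le> u" "u \<le> 1" "w = (1 - u) *\<^sub>R m + u *\<^sub>R a" by (auto simp: closed_segment_def)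
      then have "y - Re w + Im w = r" unfolding u(3) a_def m_def by simp (simp add: algebra_simps)
      then show False using near[OF w] by auto
    qed
  qed
  have Jhol: "J holomorphic_on ball (of_real y) \<epsilon>"
    unfolding J_def
    by (intro holomorphic_intros holomorphic_on_subset[OF cauchy_integral_linepath_holomorphic]
        continuous_on_subset[OF cont] segs) (use offbm offma in auto)
  have ohol: "cauchy_transform \<phi>o holomorphic_on ball (\<i> * of_real y) \<epsilon>"
  proof (rule cauchy_transform_holomorphic[OF io])
    fix z \<omega> assume z: "z \<in> ball (\<i> * of_real y) \<epsilon>" and "\<phi>o \<omega> \<noteq> 0"
    then have "r < \<bar>\<omega> - y\<bar>" by (auto simp: \<phi>o_def split: if_splits)
    also have "\<bar>\<omega> - y\<bar> = norm (\<i> * of_real \<omega> - \<i> * of_real y)"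
      by (simp add: norm_mult flip: right_diff_distrib of_real_diff)
    also have "\<dots> \<le> norm (z - \<i> * of_real \<omega>) + norm (\<i> * of_real y - z)"
      using norm_triangle_ineq[of "- (z - \<i> * of_real \<omega>)" "-(\<i> * of_real y - z)"]
        by (simp add: norm_minus_commute)
    finally show "\<epsilon> \<le> norm (z - \<i> * of_real \<omega>)" using z by (simp add: \<epsilon>_def dist_norm)
  qed (use \<epsilon> in auto)
  have hhol: "h holomorphic_on ball (\<i> * of_real y) \<epsilon>"
    unfolding h_def
  proof (intro holomorphic_intros ohol)
    have "(J \<circ> (\<lambda>z. - \<i> * z)) holomorphic_on ball (\<i> * of_real y) \<epsilon>"
      by (rule holomorphic_on_compose_gen[OF _ Jhol]) (use rot in \<open>auto intro!: holomorphic_intros\<close>)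
    then show "(\<lambda>z. J (- \<i> * z)) holomorphic_on ball (\<i> * of_real y) \<epsilon>" by (simp add: o_def)
  qed
  have split: "cauchy_transform \<phi> z = cauchy_transform \<phi>o z + cauchy_transform \<phi>i z" if "Re z \<noteq> 0" for z
  proof -
    have "\<phi> \<omega> / (z - \<i> * of_real \<omega>) = \<phi>o \<omega> / (z - \<i> * of_real \<omega>) + \<phi>i \<omega> / (z - \<i> * of_real \<omega>)" for \<omega>
      by (simp add: \<phi>o_def \<phi>i_def)
    then show ?thesis unfolding cauchy_transform_def
      using cauchy_transform_integrable'[OF io that] cauchy_transform_integrable'[OF ii that] by simp
  qed
  have inner: "cauchy_transform \<phi>i z = \<i> * contour_integral (linepath a b) (\<lambda>u. \<phi>s u / (u - (- \<i> * z)))"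
    if z: "Re z \<noteq> 0" for z
  proof -
    define F where "F x = \<phi> x / (of_real x - (- \<i> * z))" for x
    have eq: "\<phi>i \<omega> / (z - \<i> * of_real \<omega>) = \<i> * (indicator {y-r..y+r} \<omega> *\<^sub>R F \<omega>)" for \<omega>
    proof -
      have "z - \<i> * of_real \<omega> = - \<i> * (of_real \<omega> - (- \<i> * z))" by (simp add: algebra_simps)
      then show ?thesis by (simp add: \<phi>i_def F_def divide_simps) (simp add: mult_ac)
    qed
    have "set_integrable lborel {y-r..y+r} F"
    proof -
      have "integrable lborel (\<lambda>\<omega>. - \<i> * (\<phi>i \<omega> / (z - \<i> * of_real \<omega>)))"
        by (rule integrable_mult_right) (rule cauchy_transform_integrable'[OF ii z])
      moreover have "- \<i> * (\<phi>i \<omega> / (z - \<i> * of_real \<omega>)) = indicator {y-r..y+r} \<omega> *\<^sub>R F \<omega>" for \<omega>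
        unfolding eq by (simp only: mult_minus_left complex_i_mult_minus minus_minus)
      ultimately show ?thesis by (simp only: set_integrable_def)
    qed
    note F = set_borel_integral_eq_integral[OF this]
    have "(F has_integral integral {y-r..y+r} F) {y-r..y+r}"
      using F(1) by (rule integrable_integral)
    then have "((\<lambda>x. \<phi>s (of_real x) / (of_real x - (- \<i> * z))) has_integral integral {y-r..y+r} F) {y-r..y+r}"
      by (simp add: F_def[abs_def] ext)
    then have "((\<lambda>u. \<phi>s u / (u - (- \<i> * z))) has_contour_integral integral {y-r..y+r} F) (linepath a b)"
      by (subst has_contour_integral_linepath_Reals_iff) (use r in \<open>auto simp: a_def b_def\<close>)
    then have "contour_integral (linepath a b) (\<lambda>u. \<phi>s u / (u - (- \<i> * z))) = integral {y-r..y+r} F"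
      by (rule contour_integral_unique)
    moreover have "cauchy_transform \<phi>i z = \<i> * (LINT x:{y-r..y+r}|lborel. F x)"
      unfolding cauchy_transform_def eq set_lebesgue_integral_def by (rule integral_mult_right_zero)
    ultimately show ?thesis using F(2) by simp
  qed
  have tri: "contour_integral (linepath a b +++ linepath b m +++ linepath m a) f
      = contour_integral (linepath a b) f + contour_integral (linepath b m) f + contour_integral (linepath m a) f"
    if "continuous_on (closed_segment a b) f" "continuous_on (closed_segment b m) f" "continuous_on (closed_segment m a) f" for f
    using that by (simp add: contour_integrable_continuous_linepath contour_integrable_join)
  have contq: "continuous_on A (\<lambda>u. \<phi>s u / (u - w))" if "A \<subseteq> ball (of_real y) R" "w \<notin> A" for A w
    using that by (intro continuous_intros continuous_on_subset[OF cont]) auto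
  have offab: "w \<notin> closed_segment a b" if "Im w \<noteq> 0" for w
    using that by (auto simp: closed_segment_def a_def b_def)
  have right: "h z = cauchy_transform \<phi> z" if z: "z \<in> ball (\<i> * of_real y) \<epsilon>" "0 < Re z" for z
  proof -
    define w where "w = - \<i> * z"
    have w: "w \<in> ball (of_real y) \<epsilon>" "Im w < 0" using rot z by (auto simp: w_def)
    have "w \<notin> convex hull {a, b, m}"
    proof -
      have "convex hull {a, b, m} \<subseteq> {u. 0 \<le> Im u}"
        by (rule hull_minimal) (use r in \<open>auto simp: a_def b_def m_def convex_halfspace_Im_ge\<close>)
      then show ?thesis using w by auto
    qed
    then have "(\<lambda>u. \<phi>s u / (u - w)) holomorphic_on convex hull {a, b, m}"
      by (intro holomorphic_intros holomorphic_on_subset[OF R(2) hull]) auto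
    from Cauchy_theorem_triangle[OF this]
    have "contour_integral (linepath a b +++ linepath b m +++ linepath m a) (\<lambda>u. \<phi>s u / (u - w)) = 0"
      by (rule contour_integral_unique)
    then have "contour_integral (linepath a b) (\<lambda>u. \<phi>s u / (u - w)) = - J w"
      unfolding J_def
      by (subst (asm) tri) (use w segs offbm offma offab in \<open>auto intro!: contq simp: add_eq_0_iff add.assoc\<close>)
    then show ?thesis using split[of z] inner[of z] z by (simp add: h_def w_def)
  qed
  have left: "h z = cauchy_transform \<phi> z + 2 * of_real pi * \<phi>s (- \<i> * z)"
    if z: "z \<in> ball (\<i> * of_real y) \<epsilon>" "Re z < 0" for z
  proof -
    define w where "w = - \<i> * z"
    have w: "w \<in> ball (of_real y) \<epsilon>" "0 < Im w" using rot z by (auto simp: w_def)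
    have "w \<in> interior (convex hull {a, b, m})"
    proof -
      define U where "U = {u. 0 < Im u \<and> \<bar>Re u - y\<bar> + \<bar>Im u\<bar> < r}"
      have "open U" unfolding U_def by (intro open_Collect_conj open_Collect_less continuous_intros)
      moreover have "U \<subseteq> convex hull {a, b, m}"
      proof
        fix u assume u: "u \<in> U"
        define g where "g = Im u / r"
        define s where "s = (Re u - y) / r"
        have rs: "Re u = y + s * r" "Im u = g * r" using r by (auto simp: s_def g_def)
        have "\<bar>s\<bar> * r + \<bar>g\<bar> * r < 1 * r" using u rs r by (auto simp: U_def abs_mult)
        then have "\<bar>s\<bar> + \<bar>g\<bar> < 1" using r by (simp flip: distrib_right)
        moreover have "0 < g" using u r by (auto simp: U_def g_def)
        ultimately have gs: "0 \<le> (1 - g - s) / 2" "0 \<le> (1 - g + s) / 2" "0 \<le> g" by auto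
        have "u = ((1 - g - s) / 2) *\<^sub>R a + ((1 - g + s) / 2) *\<^sub>R b + g *\<^sub>R m"
          by (rule complex_eqI) (auto simp: a_def b_def m_def rs field_simps)
        moreover have "(1 - g - s) / 2 + (1 - g + s) / 2 + g = 1" by (simp add: field_simps)
        ultimately show "u \<in> convex hull {a, b, m}" unfolding convex_hull_3 mem_Collect_eq using gs by blast
      qed
      moreover have "w \<in> U" using w near[OF w(1)] by (auto simp: U_def)
      ultimately show ?thesis by (meson interior_maximal subsetD)
    qed
    then have wn: "winding_number (linepath a b +++ linepath b m +++ linepath m a) w = 1"
      using r w by (subst winding_number_triangle) (auto simp: a_def b_def)
    have offs: "w \<notin> closed_segment a b" "w \<notin> closed_segment b m" "w \<notin> closed_segment m a"
      using w offab offbm offma by auto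
    have "((\<lambda>u. \<phi>s u / (u - w)) has_contour_integral 2 * pi * \<i> * winding_number (linepath a b +++ linepath b m +++ linepath m a) w * \<phi>s w)
       (linepath a b +++ linepath b m +++ linepath m a)"
      by (rule Cauchy_integral_formula_convex_simple[OF convex_ball R(2)])
        (use w \<epsilon> r offs segs in \<open>auto simp: \<epsilon>_def path_image_join\<close>)
    then have "contour_integral (linepath a b +++ linepath b m +++ linepath m a) (\<lambda>u. \<phi>s u / (u - w)) = 2 * pi * \<i> * \<phi>s w"
      unfolding wn by (auto dest: contour_integral_unique)
    then have "contour_integral (linepath a b) (\<lambda>u. \<phi>s u / (u - w)) = 2 * pi * \<i> * \<phi>s w - J w"
      unfolding J_def
      by (subst (asm) tri) (use w segs offs in \<open>auto intro!: contq simp: algebra_simps\<close>)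
    then have "cauchy_transform \<phi> z = cauchy_transform \<phi>o z + \<i> * (2 * pi * \<i> * \<phi>s w - J w)"
      using split[of z] inner[of z] z by (simp add: w_def)
    moreover have "\<i> * (2 * pi * \<i> * \<phi>s w - J w) = - (2 * of_real pi * \<phi>s w) - \<i> * J w"
    proof -
      have "\<i> * (2 * pi * \<i> * \<phi>s w - J w) = (\<i> * \<i>) * (2 * of_real pi * \<phi>s w) - \<i> * J w"
        by (simp only: right_diff_distrib mult_ac of_real_mult of_real_numeral)
      then show ?thesis by simp
    qed
    ultimately show ?thesis by (simp add: h_def w_def)
  qed
  show thesis using that[OF \<epsilon> hhol right left] .
qed

section \<open>Horizontal lines near which the density carries little mass\<close>

lemma poisson_integral_le_of_ball_bound:
  fixes y x c :: real
  assumes M: "sets M = sets borel" and x: "0 < x" and c: "0 \<le> c"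
    and ball: "\<And>r. 0 < r \<Longrightarrow> emeasure M (ball y r) \<le> ennreal (c * r)"
  shows "(\<integral>\<^sup>+\<omega>. ennreal (x / (x\<^sup>2 + (y - \<omega>)\<^sup>2)) \<partial>M) \<le> ennreal (8 * c)"
proof -
  have [measurable_cong]: "sets M = sets borel" by fact
  \<comment> \<open>Dyadic decomposition: for the least k with |y - \<omega>| < 2^k x, the point is
    at least 2^(k-1) x away if k > 0, so the k-th summand alone dominates the Poisson kernel. Ball
    masses of order 2^k x then leave the geometric series 4 c (1/2)^k, whose sum is 8 c.\<close>
  have kernel: "ennreal (x / (x\<^sup>2 + (y - \<omega>)\<^sup>2)) \<le> (\<Sum>k. ennreal (4 / (4 ^ k * x)) * indicator (ball y (2 ^ k * x)) \<omega>)" for \<omega>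
  proof -
    define k where "k = (LEAST k. \<bar>y - \<omega>\<bar> < 2 ^ k * x)"
    obtain n where "\<bar>y - \<omega>\<bar> / x < 2 ^ n" using real_arch_pow[of 2 "\<bar>y - \<omega>\<bar> / x"] by auto
    then have n: "\<bar>y - \<omega>\<bar> < 2 ^ n * x" using x by (simp add: field_simps)
    then have k: "\<bar>y - \<omega>\<bar> < 2 ^ k * x" unfolding k_def by (rule LeastI)
    have "x / (x\<^sup>2 + (y - \<omega>)\<^sup>2) \<le> 4 / (4 ^ k * x)"
    proof (cases k)
      case 0
      have "x * x \<le> 4 * (x\<^sup>2 + (y - \<omega>)\<^sup>2)" by (simp add: power2_eq_square[of x])
      then show ?thesis using 0 x by (simp add: field_simps add_pos_nonneg)
    next
      case (Suc m)
      then have "\<not> \<bar>y - \<omega>\<bar> < 2 ^ m * x" using not_less_Least[of m "\<lambda>k. \<bar>y - \<omega>\<bar> < 2 ^ k * x"] unfolding k_def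
        by (simp only: lessI not_False_eq_True simp_thms)
      then have "(2 ^ m * x)\<^sup>2 \<le> \<bar>y - \<omega>\<bar>\<^sup>2" using x by (intro power_mono) auto
      then have "4 ^ m * x\<^sup>2 \<le> (y - \<omega>)\<^sup>2"
        by (simp add: power_mult_distrib flip: power_mult) (simp add: power_mult mult.commute[of m])
      then have "4 * (4 ^ m * x\<^sup>2) \<le> 4 * (x\<^sup>2 + (y - \<omega>)\<^sup>2)"
        by (intro mult_left_mono) (auto intro: add_increasing)
      then have "4 ^ k * x * x \<le> 4 * (x\<^sup>2 + (y - \<omega>)\<^sup>2)" using Suc
        by (simp add: power2_eq_square[of x] mult.assoc)
      then show ?thesis using x by (simp add: field_simps add_pos_nonneg)
    qed
    then have "ennreal (x / (x\<^sup>2 + (y - \<omega>)\<^sup>2)) \<le> (\<Sum>k\<in>{k}. ennreal (4 / (4 ^ k * x)) * indicator (ball y (2 ^ k * x)) \<omega>)"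
      using k by (simp add: indicator_def dist_real_def ennreal_leI)
    also have "\<dots> \<le> (\<Sum>k. ennreal (4 / (4 ^ k * x)) * indicator (ball y (2 ^ k * x)) \<omega>)"
      by (rule sum_le_suminf) auto
    finally show ?thesis .
  qed
  have "(\<integral>\<^sup>+\<omega>. ennreal (x / (x\<^sup>2 + (y - \<omega>)\<^sup>2)) \<partial>M)
      \<le> (\<integral>\<^sup>+\<omega>. (\<Sum>k. ennreal (4 / (4 ^ k * x)) * indicator (ball y (2 ^ k * x)) \<omega>) \<partial>M)"
    by (intro nn_integral_mono kernel)
  also have "\<dots> = (\<Sum>k. ennreal (4 / (4 ^ k * x)) * emeasure M (ball y (2 ^ k * x)))"
  proof (subst nn_integral_suminf)
    show "(\<lambda>\<omega>. ennreal (4 / (4 ^ i * x)) * indicator (ball y (2 ^ i * x)) \<omega>) \<in> borel_measurable M" for i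
      by measurable (simp add: M)
  qed (simp add: nn_integral_cmult_indicator M)
  also have "\<dots> \<le> (\<Sum>k. ennreal (4 * c * (1 / 2) ^ k))"
  proof (intro suminf_le summableI)
    fix k :: nat
    have "ennreal (4 / (4 ^ k * x)) * emeasure M (ball y (2 ^ k * x)) \<le> ennreal (4 / (4 ^ k * x)) * ennreal (c * (2 ^ k * x))"
      using x by (intro mult_left_mono ball) auto
    also have "\<dots> = ennreal (4 / (4 ^ k * x) * (c * (2 ^ k * x)))" using x c
      by (subst ennreal_mult[symmetric]) auto
    also have "(4::real) ^ k = 2 ^ k * 2 ^ k" by (simp flip: power_mult_distrib)
    then have "4 / (4 ^ k * x) * (c * (2 ^ k * x)) = 4 * c * (1 / 2) ^ k" using x by (simp add: field_simps)
    finally show "ennreal (4 / (4 ^ k * x)) * emeasure M (ball y (2 ^ k * x)) \<le> ennreal (4 * c * (1 / 2) ^ k)" .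
  qed
  also have "\<dots> = ennreal (\<Sum>k. 4 * c * (1 / 2) ^ k)"
    using c by (intro suminf_ennreal2 summable_mult summable_geometric) auto
  also have "(\<Sum>k. 4 * c * (1 / 2 :: real) ^ k) = 8 * c"
    by (subst suminf_mult) (auto simp: suminf_geometric summable_geometric)
  finally show ?thesis .
qed

text \<open>Otherwise each y in the interval is the centre of a ball carrying more than c times its
  radius. Vitali's lemma extracts disjoint balls whose fivefold enlargements still cover. The
  enlargements have total length 10 times the sum of the radii, so at most 10 m / c, one less than
  the length of the interval.\<close>

lemma exists_small_ball_masses:
  fixes a c m :: real
  assumes M: "sets M = sets borel" and m: "emeasure M UNIV \<le> ennreal m" "0 \<le> m" and c: "0 < c"
  shows "\<exists>y\<in>{a..a + 10 * m / c + 1}. \<forall>r>0. emeasure M (ball y r) \<le> ennreal (c * r)"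
proof (rule ccontr)
  define L where "L = 10 * m / c + 1"
  assume "\<not> ?thesis"
  then have "\<forall>y\<in>{a..a + L}. \<exists>r>0. ennreal (c * r) < emeasure M (ball y r)"
    by (auto simp: L_def not_le add.assoc)
  then obtain r where r: "\<And>y. y \<in> {a..a + L} \<Longrightarrow> 0 < r y \<and> ennreal (c * r y) < emeasure M (ball y (r y))"
    by metis
  have sets: "ball y s \<in> sets M" for y s :: real by (simp add: M)
  have bound: "0 < r y \<and> r y \<le> m / c" if "y \<in> {a..a + L}" for y
  proof -
    have "ennreal (c * r y) < emeasure M UNIV"
      using conjunct2[OF r[OF that]] by (rule less_le_trans) (rule emeasure_mono, auto simp: M)
    also have "\<dots> \<le> ennreal m" by fact
    finally have "c * r y \<le> m" using m by (simp add: ennreal_less_iff r[OF that] c less_imp_le)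
    then show ?thesis using r[OF that] c by (simp add: field_simps)
  qed
  obtain C where C: "countable C" "C \<subseteq> {a..a + L}" "pairwise (\<lambda>i j. disjnt (ball i (r i)) (ball j (r j))) C"
     "{a..a + L} \<subseteq> (\<Union>i\<in>C. ball i (5 * r i))"
    by (rule Vitali_covering_lemma_balls[where S = "{a..a + L}" and K = "{a..a + L}" and a = "\<lambda>y. y" and r = r and B = "m / c"]) (use bound in auto)
  obtain F where F: "F \<subseteq> C" "finite F" "{a..a + L} \<subseteq> (\<Union>i\<in>F. ball i (5 * r i))"
    by (rule compactE_image[OF _ _ C(4)]) auto
  have Fr: "0 < r i" "ennreal (c * r i) \<le> emeasure M (ball i (r i))" if "i \<in> F" for i
    using r[of i] that F(1) C(2) by (auto simp: less_imp_le)
  have L0: "0 \<le> L" using m c by (simp add: L_def)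
  have "ennreal L = emeasure lborel {a..a + L}" using L0 by simp
  also have "\<dots> \<le> emeasure lborel (\<Union>i\<in>F. ball i (5 * r i))"
    by (rule emeasure_mono[OF F(3)]) (use F(2) in \<open>auto intro!: sets.finite_UN\<close>)
  also have "\<dots> \<le> (\<Sum>i\<in>F. emeasure lborel (ball i (5 * r i)))"
    by (rule emeasure_subadditive_finite) (use F in auto)
  also have "\<dots> = (\<Sum>i\<in>F. ennreal (10 * r i))"
    using Fr(1) by (intro sum.cong refl) (auto simp: ball_eq_greaterThanLessThan less_imp_le)
  also have "\<dots> = ennreal (\<Sum>i\<in>F. 10 * r i)" by (rule sum_ennreal) (use Fr in \<open>auto simp: less_imp_le\<close>)
  finally have L: "L \<le> (\<Sum>i\<in>F. 10 * r i)" by (simp add: sum_nonneg Fr less_imp_le)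
  have "ennreal (\<Sum>i\<in>F. c * r i) = (\<Sum>i\<in>F. ennreal (c * r i))"
    by (rule sum_ennreal[symmetric]) (use Fr c in \<open>auto simp: less_imp_le\<close>)
  also have "\<dots> \<le> (\<Sum>i\<in>F. emeasure M (ball i (r i)))" by (rule sum_mono) (rule Fr)
  also have "\<dots> = emeasure M (\<Union>i\<in>F. ball i (r i))"
  proof (rule sum_emeasure)
    show "disjoint_family_on (\<lambda>i. ball i (r i)) F"
      using F(1) C(3) unfolding disjoint_family_on_def pairwise_def disjnt_def by blast
  qed (use F sets in auto)
  also have "\<dots> \<le> emeasure M UNIV" by (rule emeasure_mono) (auto simp: M)
  also have "\<dots> \<le> ennreal m" by fact
  finally have "(\<Sum>i\<in>F. c * r i) \<le> m" using m by simp
  then have "(\<Sum>i\<in>F. 10 * r i) \<le> 10 * m / c" using c unfolding sum_distrib_left[symmetric]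
    by (simp add: field_simps)
  then show False using L by (simp add: L_def)
qed

section \<open>The continued Cauchy transform on the whole plane\<close>

definition cauchy_ext :: "(real \<Rightarrow> complex) \<Rightarrow> (complex \<Rightarrow> complex) \<Rightarrow> complex \<Rightarrow> complex" where
  "cauchy_ext \<phi> \<phi>s z =
     (if Re z > 0 then cauchy_transform \<phi> z
      else if Re z < 0 then cauchy_transform \<phi> z + 2 * of_real pi * \<phi>s (- \<i> * z)
      else Lim (at z within {z. 0 < Re z}) (cauchy_transform \<phi>))"

lemma at_right_halfplane_nontrivial: "Re z \<ge> 0 \<Longrightarrow> at z within {z. 0 < Re z} \<noteq> bot"
proof -
  assume z: "Re z \<ge> 0"
  have "z islimpt {z. 0 < Re z}"
    unfolding islimpt_approachable
  proof (intro allI impI)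
    fix e :: real assume "0 < e"
    then show "\<exists>x'\<in>{z. 0 < Re z}. x' \<noteq> z \<and> dist x' z < e"
      using z by (intro bexI[of _ "z + of_real (e/2)"]) (auto simp: dist_norm)
  qed
  then show ?thesis by (simp add: trivial_limit_within)
qed

text \<open>The local continuation \<open>h\<close> agrees with \<open>cauchy_ext\<close> on an
  entire ball: at nearby points of the axis too, because the limit from the right that defines the
  value there exists by continuity of \<open>h\<close>.\<close>

lemma cauchy_ext_axis:
  assumes \<phi>: "integrable lborel \<phi>" and ext: "\<And>x. \<phi>s (of_real x) = \<phi> x" and an: "\<phi>s analytic_on \<real>"
    and z: "Re z = 0"
  shows "cauchy_ext \<phi> \<phi>s analytic_on {z}"
    and "(cauchy_transform \<phi> \<longlongrightarrow> cauchy_ext \<phi> \<phi>s z) (at z within {z. 0 < Re z})"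
proof -
  have z': "z = \<i> * of_real (Im z)" using z by (simp add: complex_eq_iff)
  have "\<phi>s analytic_on {of_real (Im z)}" using an by (rule analytic_on_subset) auto
  from cauchy_transform_continuation[OF \<phi> ext this]
  obtain \<epsilon> h where h: "0 < \<epsilon>" "h holomorphic_on ball z \<epsilon>"
    "\<And>u. u \<in> ball z \<epsilon> \<Longrightarrow> 0 < Re u \<Longrightarrow> h u = cauchy_transform \<phi> u"
    "\<And>u. u \<in> ball z \<epsilon> \<Longrightarrow> Re u < 0 \<Longrightarrow> h u = cauchy_transform \<phi> u + 2 * of_real pi * \<phi>s (- \<i> * u)"
    unfolding z'[symmetric] by metis
  have lim: "(cauchy_transform \<phi> \<longlongrightarrow> h u) (at u within {z. 0 < Re z})" if u: "u \<in> ball z \<epsilon>" for u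
  proof -
    have "isCont h u" using h(2) u holomorphic_on_imp_continuous_on continuous_on_eq_continuous_at by blast
    then have "(h \<longlongrightarrow> h u) (at u within {z. 0 < Re z})" unfolding isCont_def
      by (rule tendsto_within_subset) simp
    moreover have "\<forall>\<^sub>F v in at u within {z. 0 < Re z}. h v = cauchy_transform \<phi> v"
    proof -
      have "\<forall>\<^sub>F v in at u within {z. 0 < Re z}. v \<in> ball z \<epsilon>"
        by (rule eventually_at_in_open'[THEN filter_leD[OF at_le, rotated]]) (use u in auto)
      moreover have "\<forall>\<^sub>F v in at u within {z. 0 < Re z}. v \<in> {z. 0 < Re z}"
        by (simp add: eventually_at_filter)
      ultimately show ?thesis by eventually_elim (use h(3) in auto)
    qed
    ultimately show ?thesis by (rule Lim_transform_eventually)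
  qed
  have eq: "h u = cauchy_ext \<phi> \<phi>s u" if u: "u \<in> ball z \<epsilon>" for u
    using h(3,4)[OF u] tendsto_Lim[OF at_right_halfplane_nontrivial lim[OF u]]
    by (auto simp: cauchy_ext_def)
  have "cauchy_ext \<phi> \<phi>s holomorphic_on ball z \<epsilon>" using h(2) eq by (rule holomorphic_transform)
  then show "cauchy_ext \<phi> \<phi>s analytic_on {z}" using h(1) by (auto simp: analytic_at_ball)
  show "(cauchy_transform \<phi> \<longlongrightarrow> cauchy_ext \<phi> \<phi>s z) (at z within {z. 0 < Re z})"
    using lim[of z] eq[of z] h(1) by simp
qed

lemma cauchy_ext_analytic_right:
  assumes \<phi>: "integrable lborel \<phi>" and z: "0 < Re z"
  shows "cauchy_ext \<phi> \<phi>s analytic_on {z}"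
proof -
  have "cauchy_transform \<phi> analytic_on {z}"
    by (rule analytic_on_subset[OF cauchy_transform_analytic[OF \<phi>]]) (use z in auto)
  moreover have "\<forall>\<^sub>F u in nhds z. cauchy_transform \<phi> u = cauchy_ext \<phi> \<phi>s u"
  proof -
    have "\<forall>\<^sub>F u in nhds z. u \<in> {u. 0 < Re u}"
      by (rule eventually_nhds_in_open) (use z in \<open>auto simp: open_halfspace_Re_gt\<close>)
    then show ?thesis by eventually_elim (auto simp: cauchy_ext_def)
  qed
  ultimately show ?thesis using analytic_at_cong by blast
qed

lemma eventually_cauchy_ext_left:
  assumes z: "Re z < 0"
  shows "\<forall>\<^sub>F u in nhds z. cauchy_transform \<phi> u + 2 * of_real pi * \<phi>s (- \<i> * u) = cauchy_ext \<phi> \<phi>s u"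
proof -
  have "\<forall>\<^sub>F u in nhds z. u \<in> {u. Re u < 0}"
    by (rule eventually_nhds_in_open) (use z in \<open>auto simp: open_halfspace_Re_lt\<close>)
  then show ?thesis by eventually_elim (auto simp: cauchy_ext_def)
qed

lemma cauchy_ext_analytic_left:
  assumes \<phi>: "integrable lborel \<phi>" and z: "Re z < 0" and an: "\<phi>s analytic_on {- \<i> * z}"
  shows "cauchy_ext \<phi> \<phi>s analytic_on {z}"
proof -
  have "cauchy_transform \<phi> analytic_on {z}"
    by (rule analytic_on_subset[OF cauchy_transform_analytic[OF \<phi>]]) (use z in auto)
  moreover have "(\<phi>s \<circ> (\<lambda>u. - \<i> * u)) analytic_on {z}"
    by (rule analytic_on_compose) (use an in \<open>auto intro!: analytic_intros\<close>)
  ultimately have "(\<lambda>u. cauchy_transform \<phi> u + 2 * of_real pi * \<phi>s (- \<i> * u)) analytic_on {z}"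
    by (intro analytic_intros) (auto simp: o_def)
  then show ?thesis using analytic_at_cong[OF eventually_cauchy_ext_left[OF z] refl] by simp
qed

lemma cauchy_ext_meromorphic:
  assumes \<phi>: "integrable lborel \<phi>" and ext: "\<And>x. \<phi>s (of_real x) = \<phi> x" and an: "\<phi>s analytic_on \<real>"
    and mero: "\<phi>s meromorphic_on {z. 0 < Im z}"
  shows "cauchy_ext \<phi> \<phi>s meromorphic_on UNIV"
proof -
  have "cauchy_ext \<phi> \<phi>s meromorphic_on {z}" for z
  proof -
    consider "Re z > 0" | "Re z = 0" | "Re z < 0" by linarith
    then show ?thesis
    proof cases
      case 1 then show ?thesis by (intro analytic_on_imp_meromorphic_on cauchy_ext_analytic_right \<phi>)
    next
      case 2 then show ?thesis by (intro analytic_on_imp_meromorphic_on cauchy_ext_axis(1)[OF \<phi> ext an])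
    next
      case 3
      have "cauchy_transform \<phi> meromorphic_on {z}"
        by (intro analytic_on_imp_meromorphic_on analytic_on_subset[OF cauchy_transform_analytic[OF \<phi>]]) (use 3 in auto)
      moreover have "\<phi>s meromorphic_on {- \<i> * z}" using mero by (rule meromorphic_on_subset) (use 3 in auto)
      then have "(\<lambda>u. \<phi>s (- \<i> * u)) meromorphic_on {z}"
        by (rule meromorphic_on_compose) (auto intro!: analytic_intros)
      ultimately have "(\<lambda>u. cauchy_transform \<phi> u + 2 * of_real pi * \<phi>s (- \<i> * u)) meromorphic_on {z}"
        by (intro meromorphic_intros)
      moreover have "\<forall>\<^sub>F u in at z. cauchy_transform \<phi> u + 2 * of_real pi * \<phi>s (- \<i> * u) = cauchy_ext \<phi> \<phi>s u"
        using eventually_cauchy_ext_left[OF 3] by (auto simp: eventually_nhds_conv_at)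
      ultimately show ?thesis
        using meromorphic_on_cong[of "{z}" "\<lambda>u. cauchy_transform \<phi> u + 2 * of_real pi * \<phi>s (- \<i> * u)" "cauchy_ext \<phi> \<phi>s" "{z}"] by blast
    qed
  qed
  then show ?thesis using meromorphic_on_meromorphic_at by blast
qed

section \<open>The weighted space of square integrable functions\<close>

locale weighted_density =
  fixes g :: "real \<Rightarrow> real"
  assumes density: "prob_density g"
begin

lemma g_nonneg: "0 \<le> g x" and g_integrable: "integrable lborel g" and g_integral: "integral\<^sup>L lborel g = 1"
  using density by (auto simp: prob_density_def has_bochner_integral_iff)

lemma g_measurable [measurable]: "g \<in> borel_measurable borel"
  using borel_measurable_integrable[OF g_integrable] by simp

abbreviation "\<mu> \<equiv> weighted g"
abbreviation "N \<equiv> L2_norm g"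

lemma sets_weighted [measurable_cong, simp]: "sets \<mu> = sets borel"
  by (simp add: weighted_def)

lemma space_weighted [simp]: "space \<mu> = UNIV"
  by (simp add: weighted_def)

lemma emeasure_weighted_UNIV: "emeasure \<mu> UNIV = 1"
  using nn_integral_eq_integral[OF g_integrable]
  by (simp add: weighted_def emeasure_density g_nonneg g_integral)

sublocale wt: finite_measure \<mu>
  by (rule finite_measureI) (simp add: emeasure_weighted_UNIV)

lemma measure_weighted_UNIV: "measure \<mu> UNIV = 1"
  by (simp add: Sigma_Algebra.measure_def emeasure_weighted_UNIV)

lemma integral_weighted:
  fixes u :: "real \<Rightarrow> complex"
  assumes "u \<in> borel_measurable borel"
  shows "(\<integral>\<omega>. u \<omega> \<partial>\<mu>) = (\<integral>\<omega>. of_real (g \<omega>) * u \<omega> \<partial>lborel)"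
proof -
  have "(\<integral>\<omega>. u \<omega> \<partial>\<mu>) = (\<integral>\<omega>. g \<omega> *\<^sub>R u \<omega> \<partial>lborel)"
    unfolding weighted_def by (rule integral_density) (use assms in \<open>auto simp: g_nonneg\<close>)
  then show ?thesis by (simp only: scaleR_conv_of_real)
qed

lemma integrable_weighted:
  fixes u :: "real \<Rightarrow> complex"
  assumes "u \<in> borel_measurable borel"
  shows "integrable \<mu> u \<longleftrightarrow> integrable lborel (\<lambda>\<omega>. of_real (g \<omega>) * u \<omega>)"
proof -
  have "integrable \<mu> u \<longleftrightarrow> integrable lborel (\<lambda>\<omega>. g \<omega> *\<^sub>R u \<omega>)"
    unfolding weighted_def by (rule integrable_density) (use assms in \<open>auto simp: g_nonneg\<close>)
  then show ?thesis by (simp only: scaleR_conv_of_real)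
qed

lemma L2_measurable [simp]: "u \<in> L2 g \<Longrightarrow> u \<in> borel_measurable borel"
  unfolding L2_def by blast

lemma L2_measurable_weighted [simp]: "u \<in> L2 g \<Longrightarrow> u \<in> borel_measurable \<mu>"
  using L2_measurable measurable_cong_sets[OF sets_weighted refl] by blast

lemma L2_square_integrable: "u \<in> L2 g \<Longrightarrow> integrable \<mu> (\<lambda>\<omega>. (norm (u \<omega>))\<^sup>2)"
  unfolding L2_def by blast

lemma L2_norm_nonneg [simp]: "0 \<le> N u"
  unfolding L2_norm_def by (intro real_sqrt_ge_zero Bochner_Integration.integral_nonneg) simp

lemma L2_norm_square: "(N u)\<^sup>2 = (\<integral>\<omega>. (norm (u \<omega>))\<^sup>2 \<partial>\<mu>)"
  unfolding L2_norm_def by (intro real_sqrt_pow2 Bochner_Integration.integral_nonneg) simp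

lemma L2_bound:
  assumes u: "u \<in> borel_measurable borel" and v: "v \<in> L2 g" and le: "\<And>\<omega>. norm (u \<omega>) \<le> c * norm (v \<omega>)"
  shows "u \<in> L2 g"
proof -
  have "integrable \<mu> (\<lambda>\<omega>. (norm (u \<omega>))\<^sup>2)"
  proof (rule Bochner_Integration.integrable_bound)
    show "integrable \<mu> (\<lambda>\<omega>. c\<^sup>2 * (norm (v \<omega>))\<^sup>2)" using L2_square_integrable[OF v] by simp
    show "(\<lambda>\<omega>. (norm (u \<omega>))\<^sup>2) \<in> borel_measurable \<mu>" using u by measurable
    have "(norm (u \<omega>))\<^sup>2 \<le> c\<^sup>2 * (norm (v \<omega>))\<^sup>2" for \<omega>
      using power_mono[OF le, of \<omega> 2] by (simp add: power_mult_distrib)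
    then show "AE \<omega> in \<mu>. norm ((norm (u \<omega>))\<^sup>2) \<le> norm (c\<^sup>2 * (norm (v \<omega>))\<^sup>2)" by simp
  qed
  then show ?thesis using u by (simp add: L2_def del: L2_measurable)
qed

lemma L2_scale [simp]: "u \<in> L2 g \<Longrightarrow> (\<lambda>\<omega>. c * u \<omega>) \<in> L2 g"
  by (rule L2_bound[where v = u and c = "norm c"]) (auto simp: norm_mult intro!: borel_measurable_times)

lemma L2_norm_scale: "N (\<lambda>\<omega>. c * u \<omega>) = norm c * N u"
  by (simp add: L2_norm_def norm_mult power_mult_distrib real_sqrt_mult)

lemma L2_add [simp]:
  assumes "u \<in> L2 g" "v \<in> L2 g" shows "(\<lambda>\<omega>. u \<omega> + v \<omega>) \<in> L2 g"
proof -
  have [measurable]: "u \<in> borel_measurable borel" "v \<in> borel_measurable borel" using assms by auto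
  have "integrable \<mu> (\<lambda>\<omega>. (norm (u \<omega> + v \<omega>))\<^sup>2)"
  proof (rule Bochner_Integration.integrable_bound)
    show "integrable \<mu> (\<lambda>\<omega>. 2 * (norm (u \<omega>))\<^sup>2 + 2 * (norm (v \<omega>))\<^sup>2)" using assms L2_square_integrable by simp
    have "(norm (u \<omega> + v \<omega>))\<^sup>2 \<le> 2 * (norm (u \<omega>))\<^sup>2 + 2 * (norm (v \<omega>))\<^sup>2" for \<omega>
    proof -
      have "(norm (u \<omega> + v \<omega>))\<^sup>2 \<le> (norm (u \<omega>) + norm (v \<omega>))\<^sup>2" by (intro power_mono norm_triangle_ineq) auto
      also have "\<dots> \<le> 2 * (norm (u \<omega>))\<^sup>2 + 2 * (norm (v \<omega>))\<^sup>2"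
        using sum_squares_bound[of "norm (u \<omega>)" "norm (v \<omega>)"] by (simp add: power2_sum)
      finally show ?thesis .
    qed
    then show "AE \<omega> in \<mu>. norm ((norm (u \<omega> + v \<omega>))\<^sup>2) \<le> norm (2 * (norm (u \<omega>))\<^sup>2 + 2 * (norm (v \<omega>))\<^sup>2)"
      by simp
  qed measurable
  then show ?thesis by (simp add: L2_def del: L2_measurable)
qed

lemma L2_diff [simp]: "u \<in> L2 g \<Longrightarrow> v \<in> L2 g \<Longrightarrow> (\<lambda>\<omega>. u \<omega> - v \<omega>) \<in> L2 g"
  using L2_add[of u "\<lambda>\<omega>. (- 1) * v \<omega>"] L2_scale[of v "- 1"] by simp

lemma L2_zero [simp]: "(\<lambda>\<omega>. 0) \<in> L2 g"
  by (auto simp: L2_def simp del: L2_measurable)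

lemma L2_norm_zero [simp]: "N (\<lambda>\<omega>. 0) = 0"
  by (simp add: L2_norm_def)

lemma L2_sum: "(\<And>k. k \<in> I \<Longrightarrow> d k \<in> L2 g) \<Longrightarrow> (\<lambda>\<omega>. \<Sum>k\<in>I. d k \<omega>) \<in> L2 g"
  by (induction I rule: infinite_finite_induct) auto

text \<open>Integrating (a + b)^2 \<le> (A + B) (a^2/A + b^2/B) with A and B slightly larger than
  the two norms gives at most (A + B)^2. The slack e keeps A and B positive, so that functions of
  norm zero need no case of their own.\<close>

lemma L2_norm_triangle:
  assumes "u \<in> L2 g" "v \<in> L2 g" shows "N (\<lambda>\<omega>. u \<omega> + v \<omega>) \<le> N u + N v"
proof (rule field_le_epsilon)
  fix e :: real assume e: "0 < e"
  define A B where "A = N u + e/2" and "B = N v + e/2"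
  have AB: "0 < A" "0 < B" using e by (auto simp: A_def B_def add_nonneg_pos)
  have pt: "(norm (u \<omega> + v \<omega>))\<^sup>2 \<le> (A + B) * ((norm (u \<omega>))\<^sup>2 / A + (norm (v \<omega>))\<^sup>2 / B)" for \<omega>
  proof -
    have sq: "(a + b)\<^sup>2 \<le> (A + B) * (a\<^sup>2 / A + b\<^sup>2 / B)" for a b :: real
    proof -
      have "(A + B) * (a\<^sup>2 / A + b\<^sup>2 / B) - (a + b)\<^sup>2 = (B * a - A * b)\<^sup>2 / (A * B)"
        using AB by (simp add: field_simps power2_eq_square)
      also have "\<dots> \<ge> 0" using AB by auto
      finally show ?thesis by simp
    qed
    have "(norm (u \<omega> + v \<omega>))\<^sup>2 \<le> (norm (u \<omega>) + norm (v \<omega>))\<^sup>2" by (intro power_mono norm_triangle_ineq) auto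
    then show ?thesis using sq order_trans by blast
  qed
  have "(N (\<lambda>\<omega>. u \<omega> + v \<omega>))\<^sup>2 \<le> (\<integral>\<omega>. (A + B) * ((norm (u \<omega>))\<^sup>2 / A + (norm (v \<omega>))\<^sup>2 / B) \<partial>\<mu>)"
    unfolding L2_norm_square using assms L2_square_integrable L2_square_integrable[OF L2_add[OF assms]]
    by (intro Bochner_Integration.integral_mono pt) auto
  also have "\<dots> = (A + B) * ((N u)\<^sup>2 / A + (N v)\<^sup>2 / B)"
    using assms L2_square_integrable by (simp add: L2_norm_square)
  also have "\<dots> \<le> (A + B) * (A\<^sup>2 / A + B\<^sup>2 / B)"
    using AB e by (intro mult_left_mono add_mono divide_right_mono power_mono) (auto simp: A_def B_def)
  also have "\<dots> = (A + B)\<^sup>2" using AB by (simp add: power2_eq_square)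
  finally have "N (\<lambda>\<omega>. u \<omega> + v \<omega>) \<le> A + B" by (rule power2_le_imp_le) (use AB in auto)
  then show "N (\<lambda>\<omega>. u \<omega> + v \<omega>) \<le> N u + N v + e" by (simp add: A_def B_def)
qed

lemma L2_norm_triangle_diff:
  assumes "u \<in> L2 g" "v \<in> L2 g" shows "N u - N v \<le> N (\<lambda>\<omega>. u \<omega> - v \<omega>)"
  using L2_norm_triangle[of "\<lambda>\<omega>. u \<omega> - v \<omega>" v] assms by simp

lemma L2_norm_sum_le:
  assumes "\<And>k. k \<in> I \<Longrightarrow> d k \<in> L2 g" shows "N (\<lambda>\<omega>. \<Sum>k\<in>I. d k \<omega>) \<le> (\<Sum>k\<in>I. N (d k))"
  using assms
proof (induction I rule: infinite_finite_induct)
  case (insert x F)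
  then have "N (\<lambda>\<omega>. d x \<omega> + (\<Sum>k\<in>F. d k \<omega>)) \<le> N (d x) + N (\<lambda>\<omega>. \<Sum>k\<in>F. d k \<omega>)"
    by (intro L2_norm_triangle L2_sum) auto
  then show ?case using insert by (simp add: sum.insert[OF insert(1,2)] del: sum.insert)
qed auto

lemma L2_norm_cong_AE:
  assumes "u \<in> borel_measurable borel" "v \<in> borel_measurable borel" "AE \<omega> in \<mu>. u \<omega> = v \<omega>"
  shows "N u = N v"
proof -
  have "(\<integral>\<omega>. (norm (u \<omega>))\<^sup>2 \<partial>\<mu>) = (\<integral>\<omega>. (norm (v \<omega>))\<^sup>2 \<partial>\<mu>)"
  proof (rule integral_cong_AE)
    show "AE \<omega> in \<mu>. (norm (u \<omega>))\<^sup>2 = (norm (v \<omega>))\<^sup>2" using assms(3) by eventually_elim simp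
  qed (use assms(1,2) in measurable)
  then show ?thesis by (simp add: L2_norm_def)
qed

lemma L2_integrable: "u \<in> L2 g \<Longrightarrow> integrable \<mu> u"
proof -
  assume u: "u \<in> L2 g"
  have "integrable \<mu> (\<lambda>\<omega>. norm (u \<omega>))"
    using measurable_compose[OF L2_measurable_weighted[OF u] borel_measurable_norm] L2_square_integrable[OF u]
    by (rule wt.square_integrable_imp_integrable)
  then show ?thesis by (subst (asm) integrable_norm_iff) (use u in auto)
qed

text \<open>Young's inequality 2 |u| \<le> |u|^2/A + A with A close to the norm; the constant
  integrates to A because the weighted measure has total mass 1.\<close>

lemma integral_norm_le_L2_norm:
  assumes u: "u \<in> L2 g" shows "(\<integral>\<omega>. norm (u \<omega>) \<partial>\<mu>) \<le> N u"
proof (rule field_le_epsilon)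
  fix e :: real assume e: "0 < e"
  define A where "A = N u + e"
  have A: "0 < A" using e by (simp add: A_def add_nonneg_pos)
  have "(\<integral>\<omega>. norm (u \<omega>) \<partial>\<mu>) \<le> (\<integral>\<omega>. ((norm (u \<omega>))\<^sup>2 / A + A) / 2 \<partial>\<mu>)"
  proof (rule Bochner_Integration.integral_mono)
    show "integrable \<mu> (\<lambda>\<omega>. norm (u \<omega>))" using L2_integrable[OF u] by simp
    show "integrable \<mu> (\<lambda>\<omega>. ((norm (u \<omega>))\<^sup>2 / A + A) / 2)" using L2_square_integrable[OF u] by simp
    show "norm (u \<omega>) \<le> ((norm (u \<omega>))\<^sup>2 / A + A) / 2" for \<omega>
      using sum_squares_bound[of "norm (u \<omega>)" A] A by (simp add: field_simps power2_eq_square)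
  qed
  also have "\<dots> = ((N u)\<^sup>2 / A + A) / 2"
    using L2_square_integrable[OF u] by (simp add: L2_norm_square measure_weighted_UNIV)
  also have "\<dots> \<le> (A\<^sup>2 / A + A) / 2"
    using A e by (intro divide_right_mono add_right_mono power_mono) (auto simp: A_def)
  also have "\<dots> = N u + e" using A by (simp add: A_def power2_eq_square)
  finally show "(\<integral>\<omega>. norm (u \<omega>) \<partial>\<mu>) \<le> N u + e" .
qed

lemma L2_inner_P0: "L2_inner g u P0 = (\<integral>\<omega>. u \<omega> \<partial>\<mu>)"
  by (simp add: L2_inner_def P0_def)

lemma L2_inner_P0_cong_AE:
  assumes "u \<in> L2 g" "v \<in> L2 g" "AE \<omega> in \<mu>. u \<omega> = v \<omega>"
  shows "L2_inner g u P0 = L2_inner g v P0"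
  unfolding L2_inner_P0
    by (rule integral_cong_AE[OF L2_measurable_weighted L2_measurable_weighted]) (rule assms)+

lemma L2_inner_P0_linear:
  assumes "u \<in> L2 g" "v \<in> L2 g"
  shows "L2_inner g (\<lambda>\<omega>. a * u \<omega> + b * v \<omega>) P0 = a * L2_inner g u P0 + b * L2_inner g v P0"
  unfolding L2_inner_P0 using L2_integrable[OF assms(1)] L2_integrable[OF assms(2)] by simp

lemma norm_L2_inner_P0_le: "u \<in> L2 g \<Longrightarrow> norm (L2_inner g u P0) \<le> N u"
  unfolding L2_inner_P0 using integral_norm_bound[of \<mu> u] integral_norm_le_L2_norm[of u] by linarith

lemma nn_integral_L2: "u \<in> L2 g \<Longrightarrow> (\<integral>\<^sup>+\<omega>. ennreal ((norm (u \<omega>))\<^sup>2) \<partial>\<mu>) = ennreal ((N u)\<^sup>2)"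
  using nn_integral_eq_integral[OF L2_square_integrable] by (simp add: L2_norm_square)

text \<open>Riesz-Fischer for series. L2 norms bound L1 norms here, hence the series converges
  absolutely almost everywhere, and Fatou's lemma bounds the remainders. The gliding hump below
  needs this explicit bound, not just convergence.\<close>

lemma L2_complete:
  assumes d: "\<And>k. d k \<in> L2 g" and dc: "\<And>k. N (d k) \<le> c k" and c: "summable c"
  obtains x where "x \<in> L2 g" "\<And>n. N (\<lambda>\<omega>. x \<omega> - (\<Sum>k<n. d k \<omega>)) \<le> (\<Sum>k. c (k + n))"
proof -
  have c0: "0 \<le> c k" for k using dc[of k] L2_norm_nonneg order_trans by blast
  have [measurable]: "d k \<in> borel_measurable borel" for k using d by simp
  \<comment> \<open>\<open>suminf\<close> gives a measurable function on the whole line, also at the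
    points of divergence, which form a null set.\<close>
  define x where "x \<omega> = (\<Sum>k. d k \<omega>)" for \<omega>
  have [measurable]: "x \<in> borel_measurable borel" unfolding x_def[abs_def] by measurable
  have "(\<integral>\<^sup>+\<omega>. (\<Sum>k. ennreal (norm (d k \<omega>))) \<partial>\<mu>) = (\<Sum>k. \<integral>\<^sup>+\<omega>. ennreal (norm (d k \<omega>)) \<partial>\<mu>)"
    by (rule nn_integral_suminf) measurable
  also have "\<dots> \<le> (\<Sum>k. ennreal (c k))"
  proof (intro suminf_le summableI)
    fix k
    have "(\<integral>\<^sup>+\<omega>. ennreal (norm (d k \<omega>)) \<partial>\<mu>) = ennreal (\<integral>\<omega>. norm (d k \<omega>) \<partial>\<mu>)"
      using L2_integrable[OF d] by (intro nn_integral_eq_integral) auto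
    also have "\<dots> \<le> ennreal (c k)" using integral_norm_le_L2_norm[OF d[of k]] dc[of k]
      by (intro ennreal_leI) linarith
    finally show "(\<integral>\<^sup>+\<omega>. ennreal (norm (d k \<omega>)) \<partial>\<mu>) \<le> ennreal (c k)" .
  qed
  also have "\<dots> = ennreal (suminf c)" by (rule suminf_ennreal2) (use c0 c in auto)
  finally have "(\<integral>\<^sup>+\<omega>. (\<Sum>k. ennreal (norm (d k \<omega>))) \<partial>\<mu>) \<noteq> \<infinity>" by (auto simp: top_unique)
  then have "AE \<omega> in \<mu>. (\<Sum>k. ennreal (norm (d k \<omega>))) \<noteq> \<infinity>" by (intro nn_integral_PInf_AE) measurable
  then have ae: "AE \<omega> in \<mu>. (\<lambda>m. \<Sum>k<m. d k \<omega>) \<longlonglongrightarrow> x \<omega>"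
  proof eventually_elim
    case (elim \<omega>)
    then have "summable (\<lambda>k. norm (d k \<omega>))" by (intro summable_suminf_not_top) auto
    then show ?case unfolding x_def by (rule summable_LIMSEQ[OF summable_norm_cancel])
  qed
  have bound: "(\<integral>\<^sup>+\<omega>. ennreal ((norm (x \<omega> - (\<Sum>k<n. d k \<omega>)))\<^sup>2) \<partial>\<mu>) \<le> ennreal ((\<Sum>k. c (k + n))\<^sup>2)" for n
  proof -
    have "(\<integral>\<^sup>+\<omega>. ennreal ((norm (x \<omega> - (\<Sum>k<n. d k \<omega>)))\<^sup>2) \<partial>\<mu>)
        = (\<integral>\<^sup>+\<omega>. liminf (\<lambda>m. ennreal ((norm ((\<Sum>k<m. d k \<omega>) - (\<Sum>k<n. d k \<omega>)))\<^sup>2)) \<partial>\<mu>)"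
    proof (rule nn_integral_cong_AE, use ae in eventually_elim)
      case (elim \<omega>)
      then have "(\<lambda>m. ennreal ((norm ((\<Sum>k<m. d k \<omega>) - (\<Sum>k<n. d k \<omega>)))\<^sup>2)) \<longlonglongrightarrow> ennreal ((norm (x \<omega> - (\<Sum>k<n. d k \<omega>)))\<^sup>2)"
        by (intro tendsto_intros)
      then show ?case by (rule lim_imp_Liminf[OF trivial_limit_sequentially, symmetric])
    qed
    also have "\<dots> \<le> liminf (\<lambda>m. \<integral>\<^sup>+\<omega>. ennreal ((norm ((\<Sum>k<m. d k \<omega>) - (\<Sum>k<n. d k \<omega>)))\<^sup>2) \<partial>\<mu>)"
      by (rule nn_integral_liminf) measurable
    also have "\<dots> \<le> liminf (\<lambda>m::nat. ennreal ((\<Sum>k. c (k + n))\<^sup>2))"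
    proof (rule Liminf_mono, rule eventually_mono[OF eventually_ge_at_top[of n]])
      fix m assume m: "n \<le> m"
      have "(\<integral>\<^sup>+\<omega>. ennreal ((norm ((\<Sum>k<m. d k \<omega>) - (\<Sum>k<n. d k \<omega>)))\<^sup>2) \<partial>\<mu>)
          = (\<integral>\<^sup>+\<omega>. ennreal ((norm (\<Sum>k\<in>{n..<m}. d k \<omega>))\<^sup>2) \<partial>\<mu>)"
        using m by (simp add: sum_diff_nat_ivl lessThan_atLeast0)
      also have "\<dots> = ennreal ((N (\<lambda>\<omega>. \<Sum>k\<in>{n..<m}. d k \<omega>))\<^sup>2)" by (rule nn_integral_L2) (intro L2_sum d)
      also have "\<dots> \<le> ennreal ((\<Sum>k. c (k + n))\<^sup>2)"
      proof (intro ennreal_leI power_mono L2_norm_nonneg)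
        have "N (\<lambda>\<omega>. \<Sum>k\<in>{n..<m}. d k \<omega>) \<le> (\<Sum>k\<in>{n..<m}. N (d k))" by (intro L2_norm_sum_le d)
        also have "\<dots> \<le> (\<Sum>k\<in>{n..<m}. c k)" by (intro sum_mono dc)
        also have "\<dots> = (\<Sum>k\<in>{0..<m - n}. c (k + n))" using m sum.shift_bounds_nat_ivl[of c 0 n "m - n"] by simp
        also have "\<dots> \<le> (\<Sum>k. c (k + n))" by (intro sum_le_suminf) (use c c0 in \<open>auto simp: summable_iff_shift\<close>)
        finally show "N (\<lambda>\<omega>. \<Sum>k\<in>{n..<m}. d k \<omega>) \<le> (\<Sum>k. c (k + n))" .
      qed
      finally show "(\<integral>\<^sup>+\<omega>. ennreal ((norm ((\<Sum>k<m. d k \<omega>) - (\<Sum>k<n. d k \<omega>)))\<^sup>2) \<partial>\<mu>) \<le> ennreal ((\<Sum>k. c (k + n))\<^sup>2)" .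
    qed
    also have "\<dots> = ennreal ((\<Sum>k. c (k + n))\<^sup>2)" by (rule Liminf_const) simp
    finally show ?thesis .
  qed
  have xL2: "x \<in> L2 g"
  proof -
    have "integrable \<mu> (\<lambda>\<omega>. (norm (x \<omega>))\<^sup>2)"
      using bound[of 0] by (intro integrableI_bounded) (auto simp: less_top[symmetric] top_unique)
    then show ?thesis by (simp add: L2_def del: L2_measurable)
  qed
  moreover have "N (\<lambda>\<omega>. x \<omega> - (\<Sum>k<n. d k \<omega>)) \<le> (\<Sum>k. c (k + n))" for n
  proof (rule power2_le_imp_le)
    show "0 \<le> (\<Sum>k. c (k + n))" using c c0 by (intro suminf_nonneg) (auto simp: summable_iff_shift)
    then show "(N (\<lambda>\<omega>. x \<omega> - (\<Sum>k<n. d k \<omega>)))\<^sup>2 \<le> (\<Sum>k. c (k + n))\<^sup>2"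
      using bound[of n] nn_integral_L2[OF L2_diff[OF xL2 L2_sum[of "{..<n}" d]]] d by simp
  qed
  ultimately show thesis using that by blast
qed

end

section \<open>Uniform boundedness of the semigroup\<close>

locale L2_semigroup = weighted_density +
  fixes S :: "real \<Rightarrow> (real \<Rightarrow> complex) \<Rightarrow> real \<Rightarrow> complex"
  assumes semigroup: "C0_semigroup g S"
begin

lemma S_L2 [simp]: "0 \<le> t \<Longrightarrow> u \<in> L2 g \<Longrightarrow> S t u \<in> L2 g"
  using semigroup by (simp add: C0_semigroup_def)

lemma S_linear: "0 \<le> t \<Longrightarrow> u \<in> L2 g \<Longrightarrow> v \<in> L2 g \<Longrightarrow>
    AE \<omega> in \<mu>. S t (\<lambda>\<xi>. a * u \<xi> + b * v \<xi>) \<omega> = a * S t u \<omega> + b * S t v \<omega>"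
  using semigroup by (simp add: C0_semigroup_def)

lemma S_bounded: "0 \<le> t \<Longrightarrow> \<exists>C. \<forall>u\<in>L2 g. N (S t u) \<le> C * N u"
  using semigroup by (simp add: C0_semigroup_def)

lemma S_zero: "u \<in> L2 g \<Longrightarrow> AE \<omega> in \<mu>. S 0 u \<omega> = u \<omega>"
  using semigroup by (simp add: C0_semigroup_def)

lemma S_add: "0 \<le> s \<Longrightarrow> 0 \<le> t \<Longrightarrow> u \<in> L2 g \<Longrightarrow> AE \<omega> in \<mu>. S (s + t) u \<omega> = S s (S t u) \<omega>"
  using semigroup by (simp add: C0_semigroup_def)

lemma S_continuous: "u \<in> L2 g \<Longrightarrow> ((\<lambda>t. N (\<lambda>\<omega>. S t u \<omega> - u \<omega>)) \<longlongrightarrow> 0) (at_right 0)"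
  using semigroup by (simp add: C0_semigroup_def)

text \<open>\<open>S t\<close> is linear only up to null sets. The norm does not see them, so this
  is the form in which linearity enters the estimates.\<close>

lemma N_S_combination:
  assumes "0 \<le> t" "u \<in> L2 g" "v \<in> L2 g"
  shows "N (S t (\<lambda>\<xi>. a * u \<xi> + b * v \<xi>)) = N (\<lambda>\<omega>. a * S t u \<omega> + b * S t v \<omega>)"
  by (rule L2_norm_cong_AE[OF _ _ S_linear[OF assms]])
    (rule L2_measurable; use assms in \<open>auto intro!: L2_add L2_scale S_L2\<close>)+

lemma N_S_scale:
  assumes "0 \<le> t" "u \<in> L2 g" shows "N (S t (\<lambda>\<xi>. a * u \<xi>)) = norm a * N (S t u)"
  using N_S_combination[OF assms(1,2,2), of a 0] L2_norm_scale[of a "S t u"] by simp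

(* Sokal's elementary form of the uniform boundedness principle. *)
lemma S_locally_bounded: "\<exists>\<delta>>0. \<exists>M\<ge>1. \<forall>t\<in>{0..\<delta>}. \<forall>u\<in>L2 g. N (S t u) \<le> M * N u"
proof (rule ccontr)
  assume neg: "\<not> ?thesis"
  \<comment> \<open>The base 9 is chosen against the steps 3^-n below: the product still grows like
    3^n.\<close>
  have "\<exists>t u. 0 \<le> t \<and> t \<le> 1 / real (Suc n) \<and> u \<in> L2 g \<and> N (S t u) > 9 ^ n * N u" for n
  proof (rule ccontr)
    assume "\<not> ?thesis"
    then have "0 < 1 / real (Suc n) \<and> (9::real) ^ n \<ge> 1 \<and> (\<forall>t\<in>{0..1 / real (Suc n)}. \<forall>u\<in>L2 g. N (S t u) \<le> 9 ^ n * N u)"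
      by (auto simp: not_less)
    then show False using neg by blast
  qed
  then obtain t w where t: "\<And>n. 0 \<le> t n" "\<And>n. t n \<le> 1 / real (Suc n)" and w: "\<And>n. w n \<in> L2 g"
    and tw: "\<And>n. N (S (t n) (w n)) > 9 ^ n * N (w n)" by metis
  define X where "X n = {N (S (t n) u) | u. u \<in> L2 g \<and> N u \<le> 1}" for n
  define B where "B n = Sup (X n)" for n
  have bdd: "bdd_above (X n)" for n
  proof -
    obtain C where C: "\<forall>u\<in>L2 g. N (S (t n) u) \<le> C * N u" using S_bounded t by blast
    have "x \<le> \<bar>C\<bar>" if x: "x \<in> X n" for x
    proof -
      obtain u where u: "u \<in> L2 g" "N u \<le> 1" "x = N (S (t n) u)" using x by (auto simp: X_def)
      have "x \<le> C * N u" using C u by blast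
      also have "\<dots> \<le> \<bar>C\<bar> * 1" using u(2) by (intro mult_mono) auto
      finally show ?thesis by simp
    qed
    then show ?thesis by (rule bdd_aboveI)
  qed
  have opB: "N (S (t n) u) \<le> B n * N u" if u: "u \<in> L2 g" for n u
  proof (cases "N u = 0")
    case True
    obtain C where "\<forall>u\<in>L2 g. N (S (t n) u) \<le> C * N u" using S_bounded t by blast
    then have "N (S (t n) u) \<le> C * N u" using u by blast
    then show ?thesis using True by simp
  next
    case False
    then have pos: "0 < N u" using L2_norm_nonneg[of u] by linarith
    define c :: complex where "c = of_real (1 / N u)"
    have c: "norm c = 1 / N u" unfolding c_def norm_of_real by simp
    define v where "v = (\<lambda>\<omega>. c * u \<omega>)"
    have v: "v \<in> L2 g" "N v \<le> 1" using L2_scale[OF u] pos by (auto simp: v_def L2_norm_scale c)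
    have "N (S (t n) v) \<in> X n" using v by (auto simp: X_def)
    then have "N (S (t n) v) \<le> B n" unfolding B_def by (intro cSup_upper bdd)
    moreover have "N (S (t n) v) = N (S (t n) u) / N u"
      using N_S_scale[OF t(1) u, of n c] by (simp add: v_def c)
    ultimately show ?thesis using pos by (simp add: field_simps)
  qed
  have B9: "9 ^ n < B n" for n
  proof -
    have "9 ^ n * N (w n) < B n * N (w n)" using tw[of n] opB[OF w[of n], of n] by linarith
    then show ?thesis by (simp add: mult_less_cancel_right)
  qed
  then have Bpos: "0 < B n" for n by (meson less_trans zero_less_numeral zero_less_power)
  have "\<exists>v\<in>L2 g. N v \<le> 1 \<and> 3 / 4 * B n \<le> N (S (t n) v)" for n
  proof (rule ccontr)
    assume "\<not> ?thesis"
    then have "\<forall>x\<in>X n. x \<le> 3 / 4 * B n" by (auto simp: X_def)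
    moreover have "X n \<noteq> {}" using L2_zero by (auto simp: X_def intro!: exI[of _ "\<lambda>\<omega>. 0"])
    ultimately have "B n \<le> 3 / 4 * B n" unfolding B_def by (intro cSup_least) auto
    then show False using Bpos[of n] by simp
  qed
  then obtain v where v: "\<And>n. v n \<in> L2 g" "\<And>n. N (v n) \<le> 1" "\<And>n. 3 / 4 * B n \<le> N (S (t n) (v n))" by metis
  define r where "r n = (1 / 3 :: real) ^ n" for n
  have rpos: "0 < r n" for n by (simp add: r_def)
  \<comment> \<open>The candidates x + r v and x - r v differ by 2 r v, whose image has norm at
    least 2 r (3/4) B. So at least one of the two images reaches r (3/4) B, and the sign is chosen
    accordingly.\<close>
  define step
    where "step n x = (if r n * (3 / 4 * B n) \<le> N (S (t n) (\<lambda>\<omega>. 1 * x \<omega> + of_real (r n) * v n \<omega>)) then of_real (r n) else - of_real (r n) :: complex)"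
    for n and x :: "real \<Rightarrow> complex"
  have stepn: "norm (step n x) = r n" for n x using rpos[of n] by (auto simp: step_def less_imp_le)
  have hump: "r n * (3 / 4 * B n) \<le> N (S (t n) (\<lambda>\<omega>. 1 * x \<omega> + step n x * v n \<omega>))" if x: "x \<in> L2 g" for n x
  proof (cases "r n * (3 / 4 * B n) \<le> N (S (t n) (\<lambda>\<omega>. 1 * x \<omega> + of_real (r n) * v n \<omega>))")
    case True then show ?thesis by (simp add: step_def)
  next
    case False
    define p m where "p = (\<lambda>\<omega>. 1 * x \<omega> + of_real (r n) * v n \<omega>)"
      and "m = (\<lambda>\<omega>. 1 * x \<omega> + (- of_real (r n)) * v n \<omega>)"
    have pm: "p \<in> L2 g" "m \<in> L2 g" unfolding p_def m_def by (intro L2_add L2_scale x v)+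
    have "2 * r n * (3 / 4 * B n) \<le> 2 * r n * N (S (t n) (v n))" using v(3) rpos[of n]
      by (intro mult_left_mono) auto
    also have "\<dots> = N (S (t n) (\<lambda>\<omega>. of_real (2 * r n) * v n \<omega>))" using N_S_scale[OF t(1) v(1)] rpos[of n]
      by simp
    also have "(\<lambda>\<omega>. of_real (2 * r n) * v n \<omega>) = (\<lambda>\<omega>. 1 * p \<omega> + (- 1) * m \<omega>)"
      by (rule ext) (simp add: p_def m_def algebra_simps)
    also have "N (S (t n) \<dots>) = N (\<lambda>\<omega>. 1 * S (t n) p \<omega> + (- 1) * S (t n) m \<omega>)"
      by (rule N_S_combination[OF t(1) pm])
    also have "\<dots> \<le> N (\<lambda>\<omega>. 1 * S (t n) p \<omega>) + N (\<lambda>\<omega>. (- 1) * S (t n) m \<omega>)"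
      by (intro L2_norm_triangle L2_scale S_L2 t pm)
    also have "\<dots> = N (S (t n) p) + N (S (t n) m)" unfolding L2_norm_scale by simp
    finally have "2 * r n * (3 / 4 * B n) \<le> N (S (t n) p) + N (S (t n) m)" .
    then have "2 * (r n * (3 / 4 * B n)) \<le> N (S (t n) p) + N (S (t n) m)" by (simp only: mult.assoc)
    moreover have "N (S (t n) p) < r n * (3 / 4 * B n)" using False unfolding p_def[symmetric]
      by (rule not_le_imp_less)
    ultimately have "r n * (3 / 4 * B n) \<le> N (S (t n) m)" by linarith
    then show ?thesis using False by (simp add: step_def m_def)
  qed
  define y where "y = rec_nat (\<lambda>\<omega>. 0) (\<lambda>n x \<omega>. 1 * x \<omega> + step n x * v n \<omega>)"
  have y0: "y 0 = (\<lambda>\<omega>. 0)" and ySuc: "y (Suc n) = (\<lambda>\<omega>. 1 * y n \<omega> + step n (y n) * v n \<omega>)" for n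
    by (simp_all add: y_def)
  have yL2: "y n \<in> L2 g" for n
    by (induction n) (simp only: y0 L2_zero, simp only: ySuc, intro L2_add L2_scale v)
  define d where "d n = (\<lambda>\<omega>. step n (y n) * v n \<omega>)" for n
  have dL2: "d n \<in> L2 g" for n unfolding d_def by (intro L2_scale v)
  have dn: "N (d n) \<le> r n" for n
    using v(2)[of n] rpos[of n] mult_left_mono[of "N (v n)" 1 "r n"] unfolding d_def L2_norm_scale stepn
      by simp
  have ysum: "y n = (\<lambda>\<omega>. \<Sum>k<n. d k \<omega>)" for n
    by (induction n) (simp_all add: y0 ySuc d_def)
  have sr: "summable r" unfolding r_def by (rule summable_geometric) simp
  obtain x where x: "x \<in> L2 g" "\<And>n. N (\<lambda>\<omega>. x \<omega> - (\<Sum>k<n. d k \<omega>)) \<le> (\<Sum>k. r (k + n))"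
    using L2_complete[OF dL2 dn sr] by metis
  have tail: "(\<Sum>k. r (k + Suc n)) = r n / 2" for n
  proof -
    have "(\<Sum>k. r (k + Suc n)) = (\<Sum>k. r (Suc n) * (1 / 3) ^ k)" by (simp add: r_def power_add mult.commute)
    also have "\<dots> = r (Suc n) * (\<Sum>k. (1 / 3) ^ k)" by (rule suminf_mult) (rule summable_geometric, simp)
    also have "\<dots> = r n / 2" by (simp add: suminf_geometric r_def)
    finally show ?thesis .
  qed
  \<comment> \<open>All later steps together have norm at most r n / 2, so they take back at most r
    n B n / 2 of the r n (3/4) B n gained at step n. What remains is r n B n / 4, and r n B n
    exceeds 3^n.\<close>
  have grow: "3 ^ n / 4 \<le> N (S (t n) x)" for n
  proof -
    define e where "e = (\<lambda>\<omega>. x \<omega> - y (Suc n) \<omega>)"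
    have e: "e \<in> L2 g" unfolding e_def by (intro L2_diff x yL2)
    have Ne: "N e \<le> r n / 2" using x(2)[of "Suc n"] unfolding e_def ysum tail .
    have yS: "y (Suc n) = (\<lambda>\<omega>. 1 * x \<omega> + (- 1) * e \<omega>)" by (rule ext) (simp add: e_def)
    have "N (S (t n) (y (Suc n))) = N (\<lambda>\<omega>. 1 * S (t n) x \<omega> + (- 1) * S (t n) e \<omega>)"
      unfolding yS by (rule N_S_combination[OF t(1) x(1) e])
    also have "\<dots> \<le> N (\<lambda>\<omega>. 1 * S (t n) x \<omega>) + N (\<lambda>\<omega>. (- 1) * S (t n) e \<omega>)"
      by (intro L2_norm_triangle L2_scale S_L2 t x e)
    also have "\<dots> = N (S (t n) x) + N (S (t n) e)" unfolding L2_norm_scale by simp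
    finally have "N (S (t n) (y (Suc n))) \<le> N (S (t n) x) + N (S (t n) e)" .
    moreover have "r n * (3 / 4 * B n) \<le> N (S (t n) (y (Suc n)))" unfolding ySuc by (rule hump[OF yL2])
    moreover have "N (S (t n) e) \<le> B n * (r n / 2)"
      using opB[OF e, of n] mult_left_mono[OF Ne, of "B n"] Bpos[of n] by linarith
    ultimately have "r n * B n / 4 \<le> N (S (t n) x)" by (simp add: field_simps)
    moreover have "r n * 9 ^ n \<le> r n * B n" using B9[of n] rpos[of n] by (intro mult_left_mono) auto
    moreover have "r n * 9 ^ n = 3 ^ n" unfolding r_def by (simp flip: power_mult_distrib)
    ultimately show ?thesis by linarith
  qed
  have "\<forall>\<^sub>F s in at_right 0. N (\<lambda>\<omega>. S s x \<omega> - x \<omega>) < 1"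
    using order_tendstoD(2)[OF S_continuous[OF x(1)], of 1] by simp
  then obtain b where b: "0 < b" "\<And>s. 0 < s \<Longrightarrow> s < b \<Longrightarrow> N (\<lambda>\<omega>. S s x \<omega> - x \<omega>) < 1"
    unfolding eventually_at_right_field by auto
  \<comment> \<open>Strong continuity at 0 bounds \<open>S s x\<close> for this single x and all
    small s, against the growth along the times \<open>t n\<close>, which tend to 0.\<close>
  have bnd: "N (S s x) \<le> N x + 1" if s: "0 \<le> s" "s < b" for s
  proof (cases "s = 0")
    case True
    have "N (S 0 x) = N x"
      by (rule L2_norm_cong_AE[OF _ _ S_zero[OF x(1)]]) (use x in \<open>auto intro!: L2_measurable\<close>)
    then show ?thesis using True by simp
  next
    case False
    then have "N (\<lambda>\<omega>. S s x \<omega> - x \<omega>) < 1" using b s by auto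
    moreover have "N (S s x) - N x \<le> N (\<lambda>\<omega>. S s x \<omega> - x \<omega>)" by (rule L2_norm_triangle_diff) (use s x in auto)
    ultimately show ?thesis by linarith
  qed
  obtain n1 where n1: "inverse (real (Suc n1)) < b" using reals_Archimedean[OF b(1)] by blast
  obtain n2 where n2: "4 * (N x + 2) < 3 ^ n2" using real_arch_pow[of 3 "4 * (N x + 2)"] by auto
  define n where "n = max n1 n2"
  have "1 / real (Suc n) \<le> 1 / real (Suc n1)" by (rule divide_left_mono) (auto simp: n_def)
  then have "t n < b" using t(2)[of n] n1 by (simp add: inverse_eq_divide)
  then have "N (S (t n) x) \<le> N x + 1" using bnd t(1) by blast
  then have le: "3 ^ n / 4 \<le> N x + 1" using grow[of n] by (rule order_trans[rotated])
  have "(3::real) ^ n2 \<le> 3 ^ n" by (rule power_increasing) (auto simp: n_def)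
  with n2 have "4 * (N x + 2) < 3 ^ n" by (rule less_le_trans)
  then have "(4 * (N x + 2)) / 4 < 3 ^ n / 4" by (intro divide_strict_right_mono) auto
  also note le
  finally show False by simp
qed

lemma S_growth: "\<exists>M\<ge>1. \<exists>a>0. \<forall>t\<ge>0. \<forall>u\<in>L2 g. N (S t u) \<le> M * exp (a * t) * N u"
proof -
  obtain \<delta> M where \<delta>: "0 < \<delta>" and M: "1 \<le> M" "\<And>t u. t \<in> {0..\<delta>} \<Longrightarrow> u \<in> L2 g \<Longrightarrow> N (S t u) \<le> M * N u"
    using S_locally_bounded by blast
  have step: "\<forall>t\<in>{0..real (Suc k) * \<delta>}. \<forall>u\<in>L2 g. N (S t u) \<le> M ^ Suc k * N u" for k
  proof (induction k)
    case 0 then show ?case using M(2) by simp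
  next
    case (Suc k)
    show ?case
    proof (intro ballI)
      fix t u assume t: "t \<in> {0..real (Suc (Suc k)) * \<delta>}" and u: "u \<in> L2 g"
      show "N (S t u) \<le> M ^ Suc (Suc k) * N u"
      proof (cases "t \<le> \<delta>")
        case True
        have "N (S t u) \<le> M * N u" using M(2) t u True by auto
        also have "\<dots> \<le> M ^ Suc (Suc k) * N u" using M(1)
          by (intro mult_right_mono) (auto simp: self_le_power simp del: power_Suc)
        finally show ?thesis .
      next
        case False
        then have t': "0 \<le> t - \<delta>" "t - \<delta> \<le> real (Suc k) * \<delta>" using t by (auto simp: algebra_simps)
        have "N (S t u) = N (S \<delta> (S (t - \<delta>) u))"
          using S_add[of \<delta> "t - \<delta>" u] \<delta> t' u
          by (intro L2_norm_cong_AE) (auto intro!: L2_measurable)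
        also have "\<dots> \<le> M * N (S (t - \<delta>) u)" by (rule M(2)) (use \<delta> t' u in auto)
        also have "\<dots> \<le> M * (M ^ Suc k * N u)" using Suc t' u M(1) by (intro mult_left_mono) auto
        finally show ?thesis by (simp add: mult_ac)
      qed
    qed
  qed
  \<comment> \<open>M to the power t/\<delta> is exp((t/\<delta>) ln M); the summand 1 makes the
    exponent positive also when M = 1.\<close>
  define a where "a = ln M / \<delta> + 1"
  have a: "0 < a" using M \<delta> by (auto simp: a_def add_nonneg_pos)
  have "N (S t u) \<le> M * exp (a * t) * N u" if t: "0 \<le> t" and u: "u \<in> L2 g" for t u
  proof -
    define k where "k = nat \<lfloor>t / \<delta>\<rfloor>"
    have k: "real k \<le> t / \<delta>" "t / \<delta> < real k + 1" using t \<delta> by (auto simp: k_def)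
    then have "t \<le> real (Suc k) * \<delta>" using \<delta> by (simp add: field_simps)
    then have "N (S t u) \<le> M ^ Suc k * N u" using step[of k] t u by auto
    also have "\<dots> \<le> M * exp (a * t) * N u"
    proof (intro mult_right_mono L2_norm_nonneg)
      have "M ^ k = exp (real k * ln M)" using M by (simp add: exp_of_nat_mult)
      also have "\<dots> \<le> exp (t / \<delta> * ln M)" using mult_right_mono[OF k(1), of "ln M"] M(1) by simp
      also have "\<dots> \<le> exp (a * t)" using t \<delta> by (simp add: a_def algebra_simps)
      finally show "M ^ Suc k \<le> M * exp (a * t)" using M by simp
    qed
    finally show ?thesis .
  qed
  then show ?thesis using a M(1) by blast
qed

section \<open>The order parameter as a function of time\<close>

definition Z :: "(real \<Rightarrow> complex) \<Rightarrow> real \<Rightarrow> complex" where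
  "Z u t = L2_inner g (S t u) P0"

lemma norm_Z_le: "0 \<le> t \<Longrightarrow> u \<in> L2 g \<Longrightarrow> norm (Z u t) \<le> N (S t u)"
  unfolding Z_def by (rule norm_L2_inner_P0_le) simp

lemma Z_linear:
  assumes "0 \<le> t" "u \<in> L2 g" "v \<in> L2 g"
  shows "Z (\<lambda>\<xi>. a * u \<xi> + b * v \<xi>) t = a * Z u t + b * Z v t"
proof -
  have "Z (\<lambda>\<xi>. a * u \<xi> + b * v \<xi>) t = L2_inner g (\<lambda>\<omega>. a * S t u \<omega> + b * S t v \<omega>) P0"
    unfolding Z_def
      by (rule L2_inner_P0_cong_AE[OF _ _ S_linear[OF assms]]) (intro L2_add L2_scale S_L2 assms)+
  also have "\<dots> = a * Z u t + b * Z v t"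
    unfolding Z_def by (intro L2_inner_P0_linear S_L2 assms)
  finally show ?thesis .
qed

lemma Z_add: "0 \<le> s \<Longrightarrow> 0 \<le> t \<Longrightarrow> u \<in> L2 g \<Longrightarrow> Z u (s + t) = Z (S t u) s"
  unfolding Z_def by (rule L2_inner_P0_cong_AE[OF _ _ S_add]) auto

lemma Z_zero: "u \<in> L2 g \<Longrightarrow> Z u 0 = L2_inner g u P0"
  unfolding Z_def by (rule L2_inner_P0_cong_AE[OF _ _ S_zero]) auto

lemma Z_growth: "\<exists>M\<ge>1. \<exists>a>0. \<forall>t\<ge>0. \<forall>u\<in>L2 g. norm (Z u t) \<le> M * exp (a * t) * N u"
  using S_growth norm_Z_le by (meson order_trans)

text \<open>By linearity and the semigroup law the error at time s is (t - s) \<open>Z e s\<close>,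
  where e is the error of the difference quotient at time 0. A limit at 0 thus controls all times,
  uniformly on bounded intervals.\<close>

lemma Z_taylor:
  assumes M: "\<And>t u. 0 \<le> t \<Longrightarrow> u \<in> L2 g \<Longrightarrow> norm (Z u t) \<le> M * exp (a * t) * N u" and a: "0 < a" "1 \<le> M"
    and u: "u \<in> L2 g" "w \<in> L2 g" and st: "0 \<le> s" "s < t"
  shows "norm (Z u t - Z u s - of_real (t - s) * Z w s)
     \<le> (t - s) * (M * exp (a * t) * N (\<lambda>\<omega>. (S (t - s) u \<omega> - u \<omega>) / of_real (t - s) - w \<omega>))"
proof -
  define h where "h = t - s"
  have h: "0 < h" "t = s + h" using st by (auto simp: h_def)
  define e where "e = (\<lambda>\<omega>. (S h u \<omega> - u \<omega>) / of_real h - w \<omega>)"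
  have e: "e \<in> L2 g"
  proof -
    have "(\<lambda>\<omega>. (1 / of_real h) * (S h u \<omega> - u \<omega>) - w \<omega>) \<in> L2 g"
      by (intro L2_diff L2_scale S_L2 u) (use h in auto)
    then show ?thesis by (simp add: e_def)
  qed
  define p where "p = (\<lambda>\<omega>. 1 * u \<omega> + of_real h * w \<omega>)"
  have p: "p \<in> L2 g" unfolding p_def by (intro L2_add L2_scale u)
  have "S h u = (\<lambda>\<omega>. 1 * p \<omega> + of_real h * e \<omega>)"
    using h by (intro ext) (simp add: e_def p_def field_simps)
  then have "Z u t = Z (\<lambda>\<omega>. 1 * p \<omega> + of_real h * e \<omega>) s"
    using Z_add[OF st(1) _ u(1), of h] h by simp
  also have "\<dots> = 1 * Z p s + of_real h * Z e s" by (rule Z_linear[OF st(1) p e])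
  also have "Z p s = 1 * Z u s + of_real h * Z w s" unfolding p_def by (rule Z_linear[OF st(1) u])
  finally have "Z u t - Z u s - of_real h * Z w s = of_real h * Z e s" by simp
  then have "norm (Z u t - Z u s - of_real h * Z w s) = h * norm (Z e s)" using h by (simp add: norm_mult)
  also have "\<dots> \<le> h * (M * exp (a * t) * N e)"
  proof (rule mult_left_mono)
    have "norm (Z e s) \<le> M * exp (a * s) * N e" by (rule M[OF st(1) e])
    also have "\<dots> \<le> M * exp (a * t) * N e" using st a by (intro mult_right_mono mult_left_mono) auto
    finally show "norm (Z e s) \<le> M * exp (a * t) * N e" .
  qed (use h in auto)
  finally show ?thesis by (simp add: h_def e_def)
qed

lemma Z_increment:
  assumes M: "\<And>t u. 0 \<le> t \<Longrightarrow> u \<in> L2 g \<Longrightarrow> norm (Z u t) \<le> M * exp (a * t) * N u" and a: "0 < a" "1 \<le> M"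
    and u: "u \<in> L2 g" and st: "0 \<le> s" "s < t"
  shows "norm (Z u t - Z u s) \<le> M * exp (a * t) * N (\<lambda>\<omega>. S (t - s) u \<omega> - u \<omega>)"
proof -
  define e where "e = (\<lambda>\<omega>. 1 * S (t - s) u \<omega> + (- 1) * u \<omega>)"
  have e: "e \<in> L2 g" unfolding e_def by (intro L2_add L2_scale S_L2 u) (use st in auto)
  have "Z u t = Z (S (t - s) u) s" using Z_add[OF st(1) _ u, of "t - s"] st by simp
  then have "Z u t - Z u s = 1 * Z (S (t - s) u) s + (- 1) * Z u s" by simp
  also have "\<dots> = Z e s" unfolding e_def by (rule Z_linear[symmetric]) (use st u in auto)
  finally have "norm (Z u t - Z u s) = norm (Z e s)" by simp
  also have "\<dots> \<le> M * exp (a * s) * N e" by (rule M[OF st(1) e])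
  also have "\<dots> \<le> M * exp (a * t) * N e" using st a by (intro mult_right_mono mult_left_mono) auto
  finally show ?thesis by (simp add: e_def)
qed

text \<open>\<open>Z_increment\<close> starts from the earlier of the two times, and apart from a
  locally bounded factor its bound depends on their distance only. So right continuity at 0 yields
  continuity from both sides.\<close>

lemma Z_continuous:
  assumes u: "u \<in> L2 g" shows "continuous_on {0..} (Z u)"
  unfolding continuous_on_iff
proof (intro ballI allI impI)
  fix t e :: real assume t: "t \<in> {0..}" and e: "0 < e"
  obtain M a where Ma: "1 \<le> M" "0 < a" "\<And>t u. 0 \<le> t \<Longrightarrow> u \<in> L2 g \<Longrightarrow> norm (Z u t) \<le> M * exp (a * t) * N u"
    using Z_growth by blast
  define C where "C = M * exp (a * (t + 1))"
  have C: "0 < C" using Ma by (simp add: C_def)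
  have "\<forall>\<^sub>F h in at_right 0. N (\<lambda>\<omega>. S h u \<omega> - u \<omega>) < e / C"
    by (rule order_tendstoD(2)[OF S_continuous[OF u]]) (use e C in simp)
  then obtain b where b: "0 < b" "\<And>h. 0 < h \<Longrightarrow> h < b \<Longrightarrow> N (\<lambda>\<omega>. S h u \<omega> - u \<omega>) < e / C"
    unfolding eventually_at_right_field by auto
  have key: "norm (Z u t' - Z u s) < e" if st: "0 \<le> s" "s < t'" "t' \<le> t + 1" "t' - s < b" for s t'
  proof -
    have "norm (Z u t' - Z u s) \<le> M * exp (a * t') * N (\<lambda>\<omega>. S (t' - s) u \<omega> - u \<omega>)"
      by (rule Z_increment[OF Ma(3) Ma(2,1) u st(1,2)])
    also have "\<dots> \<le> C * N (\<lambda>\<omega>. S (t' - s) u \<omega> - u \<omega>)"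
      unfolding C_def using st Ma by (intro mult_right_mono mult_left_mono) auto
    also have "\<dots> < C * (e / C)" using b(2)[of "t' - s"] st C by (intro mult_strict_left_mono) auto
    finally show ?thesis using C by simp
  qed
  show "\<exists>d>0. \<forall>x'\<in>{0..}. dist x' t < d \<longrightarrow> dist (Z u x') (Z u t) < e"
  proof (intro exI[of _ "min b 1"] conjI ballI impI)
    fix s assume s: "s \<in> {0..}" "dist s t < min b 1"
    consider "s = t" | "s < t" | "t < s" by linarith
    then show "dist (Z u s) (Z u t) < e"
    proof cases
      case 1 then show ?thesis using e by simp
    next
      case 2 then show ?thesis using key[of s t] s by (auto simp: dist_norm norm_minus_commute)
    next
      case 3 then show ?thesis using key[of t s] s t by (auto simp: dist_norm)
    qed
  qed (use b in auto)
qed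

lemma Z_has_derivative:
  assumes u: "u \<in> L2 g" "w \<in> L2 g" and t: "0 \<le> t"
    and lim: "((\<lambda>h. N (\<lambda>\<omega>. (S h u \<omega> - u \<omega>) / of_real h - w \<omega>)) \<longlongrightarrow> 0) (at_right 0)"
  shows "(Z u has_vector_derivative Z w t) (at t within {0..})"
  unfolding has_vector_derivative_def has_derivative_within_alt2
proof (intro conjI allI impI)
  show "bounded_linear (\<lambda>x. x *\<^sub>R Z w t)" by (rule bounded_linear_scaleR_left)
  fix e :: real assume e: "0 < e"
  obtain M a where Ma: "1 \<le> M" "0 < a" "\<And>t u. 0 \<le> t \<Longrightarrow> u \<in> L2 g \<Longrightarrow> norm (Z u t) \<le> M * exp (a * t) * N u"
    using Z_growth by blast
  define C where "C = M * exp (a * (t + 1))"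
  have C: "0 < C" using Ma by (simp add: C_def)
  have "\<forall>\<^sub>F h in at_right 0. N (\<lambda>\<omega>. (S h u \<omega> - u \<omega>) / of_real h - w \<omega>) < e / 2 / C"
    by (rule order_tendstoD(2)[OF lim]) (use e C in simp)
  then obtain b where b: "0 < b" "\<And>h. 0 < h \<Longrightarrow> h < b \<Longrightarrow> N (\<lambda>\<omega>. (S h u \<omega> - u \<omega>) / of_real h - w \<omega>) < e / 2 / C"
    unfolding eventually_at_right_field by auto
  obtain d where d: "0 < d" "\<And>s. s \<in> {0..} \<Longrightarrow> dist s t < d \<Longrightarrow> dist (Z w s) (Z w t) < e / 2"
    using Z_continuous[OF u(2)] t half_gt_zero[OF e] unfolding continuous_on_iff by (metis atLeast_iff)
  \<comment> \<open>For the left derivative the expansion is based at s < t and involves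
    \<open>Z w s\<close>; continuity of \<open>Z w\<close> replaces it by
    \<open>Z w t\<close>.\<close>
  have key: "norm (Z u t' - Z u s - of_real (t' - s) * Z w t) \<le> e * (t' - s)"
    if st: "0 \<le> s" "s < t'" "t' \<le> t + 1" "t' - s < b" "dist s t < d" for s t'
  proof -
    have "norm (Z u t' - Z u s - of_real (t' - s) * Z w s)
        \<le> (t' - s) * (M * exp (a * t') * N (\<lambda>\<omega>. (S (t' - s) u \<omega> - u \<omega>) / of_real (t' - s) - w \<omega>))"
      by (rule Z_taylor[OF Ma(3) Ma(2,1) u st(1,2)])
    also have "\<dots> \<le> (t' - s) * (C * N (\<lambda>\<omega>. (S (t' - s) u \<omega> - u \<omega>) / of_real (t' - s) - w \<omega>))"
      unfolding C_def using st Ma by (intro mult_right_mono mult_left_mono) auto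
    also have "\<dots> \<le> (t' - s) * (C * (e / 2 / C))"
      using b(2)[of "t' - s"] st C by (intro mult_left_mono) auto
    finally have 1: "norm (Z u t' - Z u s - of_real (t' - s) * Z w s) \<le> (t' - s) * (e / 2)" using C by simp
    have "norm (of_real (t' - s) * (Z w s - Z w t)) = (t' - s) * norm (Z w s - Z w t)"
      unfolding norm_mult norm_of_real using st by simp
    also have "\<dots> \<le> (t' - s) * (e / 2)"
      using d(2)[of s] st by (intro mult_left_mono) (auto simp: dist_norm)
    finally have 2: "norm (of_real (t' - s) * (Z w s - Z w t)) \<le> (t' - s) * (e / 2)" .
    have "Z u t' - Z u s - of_real (t' - s) * Z w t = (Z u t' - Z u s - of_real (t' - s) * Z w s) + of_real (t' - s) * (Z w s - Z w t)"
      by (simp add: algebra_simps)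
    then show ?thesis using norm_triangle_mono[OF 1 2] by (simp add: field_simps)
  qed
  show "\<forall>\<^sub>F y in at t within {0..}. norm (Z u y - Z u t - (y - t) *\<^sub>R Z w t) \<le> e * norm (y - t)"
    unfolding eventually_at
  proof (intro exI[of _ "min (min b d) 1"] conjI ballI impI)
    fix s assume s: "s \<in> {0..}" "s \<noteq> t \<and> dist s t < min (min b d) 1"
    show "norm (Z u s - Z u t - (s - t) *\<^sub>R Z w t) \<le> e * norm (s - t)"
    proof (cases "s < t")
      case True
      then have "norm (Z u t - Z u s - of_real (t - s) * Z w t) \<le> e * (t - s)"
        by (intro key) (use s in \<open>auto simp: dist_real_def\<close>)
      moreover have "Z u s - Z u t - (s - t) *\<^sub>R Z w t = - (Z u t - Z u s - of_real (t - s) * Z w t)"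
        by (simp add: scaleR_conv_of_real algebra_simps)
      ultimately show ?thesis using True by (simp only: norm_minus_cancel) simp
    next
      case False
      then have "norm (Z u s - Z u t - of_real (s - t) * Z w t) \<le> e * (s - t)"
        by (intro key) (use s t d in \<open>auto simp: dist_real_def\<close>)
      then show ?thesis using False by (simp add: scaleR_conv_of_real)
    qed
  qed (use b d in auto)
qed

end

section \<open>Absence of roots in the closed right half plane\<close>

abbreviation (in weighted_density) "D0 \<equiv> cauchy_transform (\<lambda>x. complex_of_real (g x))"

locale density_continuation = weighted_density +
  fixes gs :: "complex \<Rightarrow> complex"
  assumes continuation: "meromorphic_continuation_upper (\<lambda>x. complex_of_real (g x)) gs"
begin

lemma (in weighted_density) cg_integrable: "integrable lborel (\<lambda>x. complex_of_real (g x))"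
  using g_integrable by (simp only: complex_of_real_integrable_eq)

lemma gs_of_real: "gs (of_real x) = of_real (g x)" and gs_analytic: "gs analytic_on \<real>"
  and gs_mero: "gs nicely_meromorphic_on {z. 0 < Im z}"
  using continuation by (auto simp: meromorphic_continuation_upper_def)

abbreviation "DE \<equiv> cauchy_ext (\<lambda>x. complex_of_real (g x)) gs"

text \<open>These are the Poisson kernel and its conjugate. The latter is written as in
  \<open>critical_roots\<close>, so that the limit there becomes a boundary value of Im
  \<open>D0\<close>.\<close>

lemma D0_kernel:
  assumes x: "x \<noteq> 0"
  shows "Re (D0 (Complex x y)) = (\<integral>\<omega>. x / (x\<^sup>2 + (y - \<omega>)\<^sup>2) * g \<omega> \<partial>lborel)"
    and "Im (D0 (Complex x y)) = (\<integral>\<omega>. (\<omega> - y) / (x\<^sup>2 + (\<omega> - y)\<^sup>2) * g \<omega> \<partial>lborel)"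
proof -
  have i: "integrable lborel (\<lambda>\<omega>. complex_of_real (g \<omega>) / (Complex x y - \<i> * of_real \<omega>))"
    by (rule cauchy_transform_integrable'[OF cg_integrable]) (use x in simp)
  show "Re (D0 (Complex x y)) = (\<integral>\<omega>. x / (x\<^sup>2 + (y - \<omega>)\<^sup>2) * g \<omega> \<partial>lborel)"
    unfolding cauchy_transform_def integral_Re[OF i, symmetric]
    by (intro Bochner_Integration.integral_cong refl) (simp add: Re_divide)
  show "Im (D0 (Complex x y)) = (\<integral>\<omega>. (\<omega> - y) / (x\<^sup>2 + (\<omega> - y)\<^sup>2) * g \<omega> \<partial>lborel)"
    unfolding cauchy_transform_def integral_Im[OF i, symmetric]
  proof (intro Bochner_Integration.integral_cong refl)
    fix \<omega>
    have "- (g \<omega> * (y - \<omega>)) / d = (\<omega> - y) / d * g \<omega>" for d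
      by (simp add: algebra_simps diff_divide_distrib)
    then show "Im (complex_of_real (g \<omega>) / (Complex x y - \<i> * of_real \<omega>)) = (\<omega> - y) / (x\<^sup>2 + (\<omega> - y)\<^sup>2) * g \<omega>"
      by (simp add: Im_divide power2_commute[of \<omega> y])
  qed
qed

lemma D0_reflect: "x \<noteq> 0 \<Longrightarrow> D0 (Complex (- x) y) = - cnj (D0 (Complex x y))"
  by (rule complex_eqI) (auto simp: D0_kernel)

lemma norm_D0_le: "0 < Re z \<Longrightarrow> norm (D0 z) \<le> 1 / Re z"
  using norm_cauchy_transform_le[OF cg_integrable, of z] by (simp add: g_nonneg g_integral)

lemma tendsto_D0_axis: "((\<lambda>x. D0 (Complex x y)) \<longlongrightarrow> DE (Complex 0 y)) (at_right 0)"
proof -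
  have 1: "filterlim (\<lambda>x. Complex x y) (at (Complex 0 y) within {z. 0 < Re z}) (at_right 0)"
    unfolding filterlim_at
  proof
    show "((\<lambda>x. Complex x y) \<longlongrightarrow> Complex 0 y) (at_right 0)" by (intro tendsto_intros)
    show "\<forall>\<^sub>F x in at_right (0::real). Complex x y \<in> {z. 0 < Re z} \<and> Complex x y \<noteq> Complex 0 y"
      using eventually_at_right_less by eventually_elim simp
  qed
  have 2: "(D0 \<longlongrightarrow> DE (Complex 0 y)) (at (Complex 0 y) within {z. 0 < Re z})"
    by (rule cauchy_ext_axis(2)[OF cg_integrable gs_of_real gs_analytic]) simp
  show ?thesis using filterlim_compose[OF 2 1] .
qed

text \<open>The boundary value is computed once more from the left, where reflection in the axis
  gives - cnj \<open>D0\<close> plus the jump 2 pi \<open>gs\<close>. Comparison yields DE = - cnj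
  DE + 2 pi g, that is, 2 Re DE = 2 pi g.\<close>

lemma Re_DE_axis: "Re (DE (Complex 0 y)) = pi * g y"
proof -
  have "cauchy_ext (\<lambda>x. complex_of_real (g x)) gs analytic_on {Complex 0 y}"
    by (rule cauchy_ext_axis(1)[OF cg_integrable gs_of_real gs_analytic]) simp
  then have "isCont DE (Complex 0 y)" by (rule analytic_at_imp_isCont)
  moreover have "((\<lambda>x. Complex (- x) y) \<longlongrightarrow> Complex (- 0) y) (at_right 0)" by (intro tendsto_intros)
  ultimately have "((\<lambda>x. DE (Complex (- x) y)) \<longlongrightarrow> DE (Complex 0 y)) (at_right 0)"
    by (intro isCont_tendsto_compose[of _ DE]) auto
  moreover have "\<forall>\<^sub>F x in at_right 0. DE (Complex (- x) y) = - cnj (D0 (Complex x y)) + 2 * of_real pi * gs (Complex y x)"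
    using eventually_at_right_less
  proof eventually_elim
    case (elim x)
    have "- \<i> * Complex (- x) y = Complex y x" by (simp add: complex_eq_iff)
    then show ?case using elim by (simp add: cauchy_ext_def D0_reflect)
  qed
  ultimately have "((\<lambda>x. - cnj (D0 (Complex x y)) + 2 * of_real pi * gs (Complex y x)) \<longlongrightarrow> DE (Complex 0 y)) (at_right 0)"
    by (rule Lim_transform_eventually)
  moreover have "((\<lambda>x. gs (Complex y x)) \<longlongrightarrow> gs (Complex y 0)) (at_right 0)"
  proof (rule isCont_tendsto_compose[of "Complex y 0" gs])
    have "Complex y 0 \<in> \<real>" by (simp add: complex_is_Real_iff)
    then have "gs analytic_on {Complex y 0}" by (intro analytic_on_subset[OF gs_analytic]) auto
    then show "isCont gs (Complex y 0)" by (rule analytic_at_imp_isCont)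
  qed (intro tendsto_intros)
  then have "((\<lambda>x. - cnj (D0 (Complex x y)) + 2 * of_real pi * gs (Complex y x)) \<longlongrightarrow>
     - cnj (DE (Complex 0 y)) + 2 * of_real pi * gs (Complex y 0)) (at_right 0)"
    by (intro tendsto_intros tendsto_D0_axis)
  ultimately have "DE (Complex 0 y) = - cnj (DE (Complex 0 y)) + 2 * of_real pi * gs (Complex y 0)"
    by (intro tendsto_unique[OF trivial_limit_at_right_real])
  moreover have "gs (Complex y 0) = of_real (g y)" using gs_of_real[of y] by (simp add: complex_of_real_def)
  ultimately have "DE (Complex 0 y) = - cnj (DE (Complex 0 y)) + 2 * of_real pi * of_real (g y)" by simp
  from arg_cong[OF this, of Re] show ?thesis by simp
qed

text \<open>The real and imaginary parts of DE = s w say that pi g(y) = s (- Im f1) / (K |f1|^2) and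
  that y solves the equation of the critical roots. So y enters the infimum with the value K / s,
  which is at most K, although K lies below the infimum.\<close>

lemma DE_axis_critical:
  assumes f1: "Im f1 < 0" and K: "0 < K" "ereal K < critical_coupling g f1" and s: "1 \<le> s"
  shows "DE (Complex 0 y) \<noteq> of_real s * (1 / (\<i> * of_real K * f1))"
proof
  assume eq: "DE (Complex 0 y) = of_real s * (1 / (\<i> * of_real K * f1))"
  define n2 where "n2 = (Re f1)\<^sup>2 + (Im f1)\<^sup>2"
  have n2: "0 < n2" using f1 by (auto simp: n2_def intro!: add_nonneg_pos)
  have n2': "(norm f1)\<^sup>2 = n2" by (simp add: n2_def cmod_power2)
  have w: "1 / (\<i> * of_real K * f1) = Complex (- Im f1 / (K * n2)) (- Re f1 / (K * n2))"
    using K n2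
      by (auto simp: complex_eq_iff Re_divide Im_divide n2_def power2_eq_square divide_simps) (simp_all add: algebra_simps)
  have re: "pi * g y = s * (- Im f1 / (K * n2))" using arg_cong[OF eq, of Re] by (simp add: Re_DE_axis w)
  have im: "Im (DE (Complex 0 y)) = s * (- Re f1 / (K * n2))" using arg_cong[OF eq, of Im] by (simp add: w)
  have gy: "0 < pi * g y" unfolding re by (intro mult_pos_pos divide_pos_pos) (use s f1 K n2 in auto)
  have imre: "Im (DE (Complex 0 y)) = pi * Re f1 / Im f1 * g y"
  proof -
    have "pi * Re f1 / Im f1 * g y = (Re f1 / Im f1) * (pi * g y)" by simp
    then show ?thesis unfolding im re using f1 K n2 by (simp add: field_simps)
  qed
  define G where "G x = (\<integral>\<omega>. (\<omega> - y) / (x\<^sup>2 + (\<omega> - y)\<^sup>2) * g \<omega> \<partial>lborel)" for x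
  have "((\<lambda>x. Im (D0 (Complex x y))) \<longlongrightarrow> Im (DE (Complex 0 y))) (at_right 0)"
    by (intro tendsto_intros tendsto_D0_axis)
  moreover have "\<forall>\<^sub>F x in at_right (0::real). Im (D0 (Complex x y)) = G x"
    using eventually_at_right_less by eventually_elim (simp add: D0_kernel G_def)
  ultimately have R: "(G \<longlongrightarrow> pi * Re f1 / Im f1 * g y) (at_right 0)" unfolding imre
    by (rule Lim_transform_eventually)
  \<comment> \<open>The integral is even in x, so its limit from the right is also its limit from
    the left.\<close>
  then have L: "(G \<longlongrightarrow> pi * Re f1 / Im f1 * g y) (at_left 0)"
    by (subst filterlim_at_left_to_right) (simp add: G_def[abs_def])
  have "y \<in> critical_roots g f1"
    using filterlim_split_at[OF L R] by (simp add: critical_roots_def G_def[abs_def])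
  then have "critical_coupling g f1 \<le> (if g y = 0 then \<infinity> else ereal (- Im f1 / (pi * (norm f1)\<^sup>2 * g y)))"
    unfolding critical_coupling_def by (rule INF_lower)
  also have "\<dots> = ereal (K / s)"
  proof -
    have "g y \<noteq> 0" using gy by auto
    moreover have "- Im f1 / (pi * (norm f1)\<^sup>2 * g y) = - Im f1 / (n2 * (pi * g y))"
      by (simp add: n2' mult_ac)
    moreover have "\<dots> = K / s" unfolding re using f1 K n2 s by (simp add: field_simps)
    ultimately show ?thesis by (simp only: if_False)
  qed
  also have "\<dots> \<le> ereal K" using s K by (simp add: field_simps)
  finally show False using K(2) by simp
qed

text \<open>Ball masses of at most (c/9) r bound the Poisson integral by 8 c / 9 < c. For total mass
  1 the covering argument then needs an interval of length 10 / (c/9) + 1 = 90/c + 1.\<close>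

lemma exists_small_horizontal_line:
  assumes c: "0 < c"
  shows "\<exists>y\<in>{a..a + 90 / c + 1}. \<forall>x>0. Re (D0 (Complex x y)) < c"
proof -
  define M where "M = density lborel (\<lambda>x. ennreal (g x))"
  have M: "sets M = sets borel" by (simp add: M_def)
  have mass: "emeasure M UNIV = 1"
    using nn_integral_eq_integral[OF g_integrable] by (simp add: M_def emeasure_density g_nonneg g_integral)
  have "\<exists>y\<in>{a..a + 10 * 1 / (c / 9) + 1}. \<forall>r>0. emeasure M (ball y r) \<le> ennreal (c / 9 * r)"
    by (rule exists_small_ball_masses[OF M]) (use mass c in auto)
  then obtain y where y: "y \<in> {a..a + 90 / c + 1}" "\<And>r. 0 < r \<Longrightarrow> emeasure M (ball y r) \<le> ennreal (c / 9 * r)"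
    by auto
  have "Re (D0 (Complex x y)) < c" if x: "0 < x" for x
  proof -
    have m: "integrable lborel (\<lambda>\<omega>. x / (x\<^sup>2 + (y - \<omega>)\<^sup>2) * g \<omega>)"
    proof -
      have "integrable lborel (\<lambda>\<omega>. Re (complex_of_real (g \<omega>) / (Complex x y - \<i> * of_real \<omega>)))"
        by (intro integrable_Re cauchy_transform_integrable'[OF cg_integrable]) (use x in simp)
      then show ?thesis by (simp add: Re_divide mult.commute)
    qed
    have "ennreal (Re (D0 (Complex x y))) = (\<integral>\<^sup>+\<omega>. ennreal (x / (x\<^sup>2 + (y - \<omega>)\<^sup>2) * g \<omega>) \<partial>lborel)"
      using x m by (subst nn_integral_eq_integral) (auto simp: D0_kernel g_nonneg)
    also have "\<dots> = (\<integral>\<^sup>+\<omega>. ennreal (x / (x\<^sup>2 + (y - \<omega>)\<^sup>2)) \<partial>M)"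
      using x unfolding M_def
        by (subst nn_integral_density) (auto simp: ennreal_mult[symmetric] g_nonneg mult.commute)
    also have "\<dots> \<le> ennreal (8 * (c / 9))"
      by (rule poisson_integral_le_of_ball_bound[OF M x _ y(2)]) (use c in auto)
    finally have "Re (D0 (Complex x y)) \<le> 8 * (c / 9)" using c by simp
    then show ?thesis using c by simp
  qed
  then show ?thesis using y(1) by blast
qed

lemma DE_analytic_closed_right: "Re z \<ge> 0 \<Longrightarrow> DE analytic_on {z}"
  using cauchy_ext_analytic_right[OF cg_integrable] cauchy_ext_axis(1)[OF cg_integrable gs_of_real gs_analytic]
  by (cases "Re z = 0") auto

(* The real multiples s w (s >= 1) of w = 1/(i K f1) attained by DE in a suitable rectangle form a set that
   is open by the open mapping theorem, closed because the boundary values miss the ray, and bounded. *)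
lemma DE_neq_critical:
  assumes f1: "Im f1 < 0" and K: "0 < K" "ereal K < critical_coupling g f1" and z: "0 \<le> Re z"
  shows "DE z \<noteq> 1 / (\<i> * of_real K * f1)"
proof (cases "Re z = 0")
  case True
  then have "z = Complex 0 (Im z)" by (simp add: complex_eq_iff)
  then show ?thesis using DE_axis_critical[OF f1 K, of 1 "Im z"] by simp
next
  case False
  define w where "w = 1 / (\<i> * of_real K * f1)"
  have w0: "0 < Re w"
  proof -
    have "Re w = (- Im f1) * K / (K\<^sup>2 * (norm f1)\<^sup>2)"
      by (simp add: w_def Re_divide cmod_power2 power_mult_distrib algebra_simps)
    moreover have "f1 \<noteq> 0" using f1 by auto
    then have "0 < (- Im f1) * K / (K\<^sup>2 * (norm f1)\<^sup>2)" using f1 K by (intro divide_pos_pos mult_pos_pos) auto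
    ultimately show ?thesis by simp
  qed
  have wn: "0 < norm w" using w0 by auto
  show ?thesis unfolding w_def[symmetric]
  proof
    assume zw: "DE z = w"
    obtain yp where "yp \<in> {Im z + 1..Im z + 1 + 90 / Re w + 1}" and yp2: "\<forall>x>0. Re (D0 (Complex x yp)) < Re w"
      using exists_small_horizontal_line[OF w0, of "Im z + 1"] by blast
    then have yp: "yp > Im z" "\<And>x. 0 < x \<Longrightarrow> Re (D0 (Complex x yp)) < Re w" by auto
    \<comment> \<open>This interval ends at Im z - 1, as the one above starts at Im z + 1, so that z
      lies strictly between the two lines.\<close>
    obtain ym where "ym \<in> {Im z - 90 / Re w - 2..Im z - 90 / Re w - 2 + 90 / Re w + 1}"
      and ym2: "\<forall>x>0. Re (D0 (Complex x ym)) < Re w"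
      using exists_small_horizontal_line[OF w0, of "Im z - 90 / Re w - 2"] by blast
    then have ym: "ym < Im z" "\<And>x. 0 < x \<Longrightarrow> Re (D0 (Complex x ym)) < Re w" by auto
    \<comment> \<open>Since |DE u| \<le> 1 / Re u, the modulus is below |w| already from X - 1/2 on.
      The margin 1/2 leaves a point inside the rectangle with such a small value, hence
      \<open>DE\<close> is not constant there.\<close>
    define X where "X = Re z + 1 / norm w + 1"
    have X: "Re z < X - 1/2" "1 / norm w < X - 1/2" "0 < X - 1/2" using wn z
      by (auto simp: X_def add_pos_nonneg)
    have small: "norm (DE u) < norm w" if "Re u \<ge> X - 1/2" for u
    proof -
      have u: "0 < Re u" "1 / norm w < Re u" using that X by auto
      then have "norm (DE u) \<le> 1 / Re u" using norm_D0_le[of u] by (simp add: cauchy_ext_def)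
      also have "\<dots> < norm w" using u wn by (simp add: field_simps)
      finally show ?thesis .
    qed
    define B C where "B = box (Complex 0 ym) (Complex X yp)" and "C = cbox (Complex 0 ym) (Complex X yp)"
    have zB: "z \<in> B" using z False X yp ym by (auto simp: B_def in_box_complex_iff)
    have BC: "B \<subseteq> C" by (simp add: B_def C_def box_subset_cbox)
    have an: "DE analytic_on C"
      using DE_analytic_closed_right analytic_on_analytic_at[of DE C]
        by (auto simp: C_def in_cbox_complex_iff)
    have bd: "u \<in> B" if u: "u \<in> C" "DE u = of_real s * w" "1 \<le> s" for u s
    proof -
      have Cu: "0 \<le> Re u" "Re u \<le> X" "ym \<le> Im u" "Im u \<le> yp" using u(1)
        by (auto simp: C_def in_cbox_complex_iff)
      have "Re u \<noteq> 0"
      proof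
        assume "Re u = 0"
        then have "u = Complex 0 (Im u)" by (simp add: complex_eq_iff)
        then show False using DE_axis_critical[OF f1 K u(3), of "Im u"] u(2) by (simp add: w_def)
      qed
      then have u0: "0 < Re u" using Cu by simp
      have "Re u \<noteq> X"
      proof
        assume "Re u = X"
        then have "norm (DE u) < norm w" by (intro small) auto
        then show False using u(2,3) wn by (simp add: norm_mult)
      qed
      have "Re w \<le> Re (DE u)" using u(2,3) w0 by simp
      then have "Im u \<noteq> ym \<and> Im u \<noteq> yp"
        using yp(2)[OF u0] ym(2)[OF u0] u0 complex_surj[of u]
          by (auto simp: cauchy_ext_def not_less[symmetric])
      then show ?thesis using Cu u0 \<open>Re u \<noteq> X\<close> by (auto simp: B_def in_box_complex_iff)
    qed
    have cont: "continuous_on C DE" using an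
      by (intro holomorphic_on_imp_continuous_on analytic_imp_holomorphic)
    have hol: "DE holomorphic_on B" using an BC by (meson analytic_imp_holomorphic analytic_on_subset)
    have "\<not> DE constant_on B"
    proof
      assume "DE constant_on B"
      moreover have "Complex (X - 1/2) (Im z) \<in> B" using X yp ym z by (auto simp: B_def in_box_complex_iff)
      ultimately have "DE (Complex (X - 1/2) (Im z)) = DE z" using zB unfolding constant_on_def by metis
      then show False using small[of "Complex (X - 1/2) (Im z)"] zw by simp
    qed
    then have op: "open (DE ` B)"
      by (intro open_mapping_thm[OF hol]) (auto simp: B_def convex_connected)
    define \<Sigma> where "\<Sigma> = {s \<in> {1..}. of_real s * w \<in> DE ` B}"
    have \<Sigma>': "\<Sigma> = {s \<in> {1..}. of_real s * w \<in> DE ` C}" using bd BC by (auto simp: \<Sigma>_def image_iff) metis+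
    have "openin (top_of_set {1..}) \<Sigma>"
    proof -
      have "open ((\<lambda>s. of_real s * w) -` (DE ` B))" by (intro open_vimage op continuous_intros)
      then show ?thesis unfolding \<Sigma>_def
        by (auto simp: openin_open vimage_def intro!: exI[of _ "{s. of_real s * w \<in> DE ` B}"])
    qed
    moreover have "compact (DE ` C)" by (intro compact_continuous_image cont) (simp add: C_def)
    then have "closed ((\<lambda>s. of_real s * w) -` (DE ` C))"
      by (intro continuous_closed_vimage compact_imp_closed) (auto intro!: continuous_intros)
    then have "closedin (top_of_set {1..}) \<Sigma>"
      unfolding \<Sigma>' by (auto simp: closedin_closed vimage_def intro!: exI[of _ "{s. of_real s * w \<in> DE ` C}"])
    moreover have "connected {1::real..}" by simp
    moreover have "1 \<in> \<Sigma>" using zB zw by (auto simp: \<Sigma>_def image_iff)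
    ultimately have "\<Sigma> = {1..}" unfolding connected_clopen by blast
    moreover have "bounded (DE ` C)" using \<open>compact (DE ` C)\<close> by (rule compact_imp_bounded)
    then obtain b where b: "0 < b" "\<And>v. v \<in> DE ` C \<Longrightarrow> norm v \<le> b" unfolding bounded_pos by blast
    \<comment> \<open>For this s the modulus |s w| = |w| + b exceeds the bound b of
      \<open>DE\<close> on the compact rectangle.\<close>
    moreover have "1 + b / norm w \<in> {1..}" using b wn by auto
    ultimately have "norm (of_real (1 + b / norm w) * w) \<le> b" unfolding \<Sigma>' by blast
    moreover have "norm (of_real (1 + b / norm w) * w) = (1 + b / norm w) * norm w"
      unfolding norm_mult norm_of_real using b by simp
    ultimately have "norm w + b \<le> b" using wn by (simp add: field_simps)
    then show False using wn by simp
  qed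
qed

end

section \<open>The resolvent of a rank one perturbation and the Laplace transform\<close>

context weighted_density
begin

text \<open>\<kappa> = i K f1 gives \<open>T1\<close> and \<kappa> = 0 gives i times multiplication,
  so one computation serves both the resolvent in \<open>F0\<close> and that in
  \<open>F1_left\<close>.\<close>

definition rank_one_op :: "complex \<Rightarrow> (real \<Rightarrow> complex) \<Rightarrow> real \<Rightarrow> complex" where
  "rank_one_op \<kappa> u = (\<lambda>\<omega>. \<i> * mult_op u \<omega> + \<kappa> * L2_inner g u P0)"

lemma T1_eq_rank_one_op: "T1 g K f1 = rank_one_op (\<i> * of_real K * f1)"
  by (rule ext) (simp add: T1_def rank_one_op_def)

lemma mult_eq_rank_one_op: "(\<lambda>u \<omega>. \<i> * mult_op u \<omega>) = rank_one_op 0"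
  by (rule ext) (simp add: rank_one_op_def)

abbreviation "wt_fun u \<equiv> (\<lambda>\<omega>. complex_of_real (g \<omega>) * u \<omega>)"

lemma wt_fun_integrable: "u \<in> L2 g \<Longrightarrow> integrable lborel (wt_fun u)"
  using L2_integrable[of u] integrable_weighted[OF L2_measurable, of u] by blast

lemma const_L2: "(\<lambda>_. c) \<in> L2 g"
  by (simp add: L2_def del: L2_measurable)

lemma divide_L2:
  assumes z: "Re z \<noteq> 0" and u: "u \<in> L2 g"
  shows "(\<lambda>\<omega>. u \<omega> / (z - \<i> * of_real \<omega>)) \<in> L2 g"
proof (rule L2_bound[OF _ u])
  have [measurable]: "u \<in> borel_measurable borel" using u by simp
  show "(\<lambda>\<omega>. u \<omega> / (z - \<i> * of_real \<omega>)) \<in> borel_measurable borel" by measurable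
  show "norm (u \<omega> / (z - \<i> * of_real \<omega>)) \<le> 1 / \<bar>Re z\<bar> * norm (u \<omega>)" for \<omega>
  proof -
    have "norm (u \<omega>) / norm (z - \<i> * of_real \<omega>) \<le> norm (u \<omega>) / \<bar>Re z\<bar>"
      using norm_minus_imaginary_ge[of z \<omega>] z by (intro divide_left_mono mult_pos_pos) auto
    then show ?thesis by (simp add: norm_divide)
  qed
qed

lemma L2_inner_divide:
  assumes "Re z \<noteq> 0" "u \<in> L2 g"
  shows "L2_inner g (\<lambda>\<omega>. u \<omega> / (z - \<i> * of_real \<omega>)) P0 = cauchy_transform (wt_fun u) z"
  unfolding L2_inner_P0 cauchy_transform_def
    by (subst integral_weighted) (use L2_measurable[OF divide_L2[OF assms]] in auto)

lemma nonzero_minus_imaginary: "Re z \<noteq> 0 \<Longrightarrow> z - \<i> * of_real \<omega> \<noteq> 0"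
  using norm_minus_imaginary_ge[of z \<omega>] by force

text \<open>Solving pointwise, u = (q + \<kappa> c) / (z - i \<omega>) with the number c = (u, P0);
  integrating against the weight turns this into a linear equation for c alone.\<close>

lemma resolvent_equation_inner:
  assumes z: "Re z \<noteq> 0" and q: "q \<in> L2 g" and u: "u \<in> L2 g"
    and eq: "AE \<omega> in \<mu>. z * u \<omega> - rank_one_op \<kappa> u \<omega> = q \<omega>"
  shows "L2_inner g u P0 * (1 - \<kappa> * D0 z) = cauchy_transform (wt_fun q) z"
proof -
  define c where "c = L2_inner g u P0"
  define v where "v = (\<lambda>\<omega>. q \<omega> / (z - \<i> * of_real \<omega>) + \<kappa> * c * (1 / (z - \<i> * of_real \<omega>)))"
  note L = divide_L2[OF z q] divide_L2[OF z const_L2[of 1]]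
  have "AE \<omega> in \<mu>. u \<omega> = v \<omega>" using eq
  proof eventually_elim
    case (elim \<omega>)
    then have "(z - \<i> * of_real \<omega>) * u \<omega> = q \<omega> + \<kappa> * c"
      by (simp add: rank_one_op_def mult_op_def c_def algebra_simps)
    then have "u \<omega> = (q \<omega> + \<kappa> * c) / (z - \<i> * of_real \<omega>)"
      using nonzero_minus_imaginary[OF z, of \<omega>] by (metis nonzero_mult_div_cancel_left)
    then show ?case by (simp add: v_def add_divide_distrib)
  qed
  moreover have v: "v \<in> L2 g" unfolding v_def by (intro L2_add L2_scale L)
  ultimately have "c = L2_inner g v P0" unfolding c_def by (intro L2_inner_P0_cong_AE u)
  also have "\<dots> = L2_inner g (\<lambda>\<omega>. q \<omega> / (z - \<i> * of_real \<omega>)) P0 + \<kappa> * c * L2_inner g (\<lambda>\<omega>. 1 / (z - \<i> * of_real \<omega>)) P0"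
    unfolding v_def using L2_inner_P0_linear[OF L, of 1 "\<kappa> * c"] by simp
  also have "\<dots> = cauchy_transform (wt_fun q) z + \<kappa> * c * D0 z"
    using L2_inner_divide[OF z q] L2_inner_divide[OF z const_L2[of 1]] by simp
  finally show ?thesis unfolding c_def by (simp add: algebra_simps)
qed

lemma resolvent_equation_solvable:
  assumes z: "Re z \<noteq> 0" and q: "q \<in> L2 g" and nz: "1 - \<kappa> * D0 z \<noteq> 0"
  obtains u where "u \<in> mult_dom g" "\<And>\<omega>. z * u \<omega> - rank_one_op \<kappa> u \<omega> = q \<omega>"
    "L2_inner g u P0 = cauchy_transform (wt_fun q) z / (1 - \<kappa> * D0 z)"
proof -
  define c where "c = cauchy_transform (wt_fun q) z / (1 - \<kappa> * D0 z)"
  define w where "w = (\<lambda>\<omega>. 1 * q \<omega> + \<kappa> * c * 1)"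
  have w: "w \<in> L2 g" unfolding w_def by (intro L2_add L2_scale q const_L2)
  define u where "u = (\<lambda>\<omega>. w \<omega> / (z - \<i> * of_real \<omega>))"
  have u: "u \<in> L2 g" unfolding u_def by (rule divide_L2[OF z w])
  \<comment> \<open>Membership in the domain: \<omega> u(\<omega>) is a combination of w and u,
    hence square integrable.\<close>
  have "mult_op u = (\<lambda>\<omega>. \<i> * (w \<omega> - z * u \<omega>))"
  proof
    fix \<omega>
    have "(z - \<i> * of_real \<omega>) * u \<omega> = w \<omega>" using nonzero_minus_imaginary[OF z] by (simp add: u_def)
    then have "w \<omega> - z * u \<omega> = - (\<i> * (of_real \<omega> * u \<omega>))" by (simp add: algebra_simps)
    then show "mult_op u \<omega> = \<i> * (w \<omega> - z * u \<omega>)" by (simp add: mult_op_def)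
  qed
  moreover have "(\<lambda>\<omega>. \<i> * (w \<omega> - z * u \<omega>)) \<in> L2 g" by (intro L2_scale L2_diff u w)
  ultimately have dom: "u \<in> mult_dom g" using u by (simp add: mult_dom_def)
  have "L2_inner g u P0 = cauchy_transform (wt_fun w) z" unfolding u_def by (rule L2_inner_divide[OF z w])
  also have "\<dots> = (\<integral>\<omega>. wt_fun q \<omega> / (z - \<i> * of_real \<omega>) + \<kappa> * c * (of_real (g \<omega>) / (z - \<i> * of_real \<omega>)) \<partial>lborel)"
    unfolding cauchy_transform_def
      by (intro Bochner_Integration.integral_cong refl) (simp add: w_def add_divide_distrib algebra_simps)
  also have "\<dots> = cauchy_transform (wt_fun q) z + \<kappa> * c * D0 z"
    unfolding cauchy_transform_def
    by (subst Bochner_Integration.integral_add[OF cauchy_transform_integrable'[OF wt_fun_integrable[OF q] z] integrable_mult_right[OF cauchy_transform_integrable'[OF cg_integrable z]]])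
      (simp only: integral_mult_right_zero)
  also have "\<dots> = c" using nz by (simp add: c_def field_simps)
  finally have inner: "L2_inner g u P0 = c" .
  have "z * u \<omega> - rank_one_op \<kappa> u \<omega> = q \<omega>" for \<omega>
  proof -
    have "(z - \<i> * of_real \<omega>) * u \<omega> = w \<omega>" using nonzero_minus_imaginary[OF z] by (simp add: u_def)
    then show ?thesis by (simp add: rank_one_op_def mult_op_def inner w_def algebra_simps)
  qed
  then show thesis using that dom inner by (simp add: c_def)
qed

text \<open>The choice in \<open>resolvent\<close> does no harm: a solution of the resolvent
  equation exists, and all solutions have the same product with \<open>P0\<close>.\<close>

lemma inner_resolvent:
  assumes z: "Re z \<noteq> 0" and q: "q \<in> L2 g" and nz: "1 - \<kappa> * D0 z \<noteq> 0"
  shows "L2_inner g (resolvent g (mult_dom g) (rank_one_op \<kappa>) z q) P0 = cauchy_transform (wt_fun q) z / (1 - \<kappa> * D0 z)"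
proof -
  obtain u where u: "u \<in> mult_dom g" "\<And>\<omega>. z * u \<omega> - rank_one_op \<kappa> u \<omega> = q \<omega>"
    using resolvent_equation_solvable[OF z q nz] by metis
  define r where "r = resolvent g (mult_dom g) (rank_one_op \<kappa>) z q"
  have "r \<in> mult_dom g \<and> (AE \<omega> in \<mu>. z * r \<omega> - rank_one_op \<kappa> r \<omega> = q \<omega>)"
    unfolding r_def resolvent_def by (rule someI[of _ u]) (use u in auto)
  then have "L2_inner g r P0 * (1 - \<kappa> * D0 z) = cauchy_transform (wt_fun q) z"
    by (intro resolvent_equation_inner[OF z q]) (auto simp: mult_dom_def)
  then show ?thesis using nz by (simp add: r_def field_simps)
qed

lemma rank_one_op_L2: "u \<in> mult_dom g \<Longrightarrow> rank_one_op \<kappa> u \<in> L2 g"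
proof -
  assume u: "u \<in> mult_dom g"
  have "(\<lambda>\<omega>. \<i> * mult_op u \<omega> + \<kappa> * L2_inner g u P0) \<in> L2 g"
    by (intro L2_add L2_scale const_L2) (use u in \<open>auto simp: mult_dom_def\<close>)
  then show ?thesis by (simp add: rank_one_op_def)
qed

end

section \<open>The Laplace transform of the order parameter\<close>

lemma set_integrable_exp_minus:
  fixes c :: real
  assumes "0 < c" shows "set_integrable lborel {0..} (\<lambda>t. exp (- (c * t)))"
proof -
  have "(\<lambda>t. exp (- c * t)) absolutely_integrable_on {0..}"
    by (rule nonnegative_absolutely_integrable_1) (use integrable_on_exp_minus_to_infinity[OF assms] in auto)
  then show ?thesis unfolding set_integrable_def
    by (subst (asm) integrable_completion) auto
qed

lemma tendsto_exp_minus_at_top: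
  fixes c :: real
  assumes "0 < c" shows "((\<lambda>t. exp (- (c * t))) \<longlongrightarrow> 0) at_top"
proof -
  have "filterlim (\<lambda>t. c * t) at_top at_top"
    by (rule filterlim_tendsto_pos_mult_at_top[OF tendsto_const assms filterlim_ident])
  then have "filterlim (\<lambda>t. - (c * t)) at_bot at_top" by (simp add: filterlim_uminus_at_bot)
  then show ?thesis by (rule filterlim_compose[OF exp_at_bot])
qed

context L2_semigroup
begin

text \<open>With w the image of v under the generator and z v - w = q, the function exp(- z t) Z v t
  has derivative - exp(- z t) Z q t. Integrating this scalar identity over the half line replaces
  the vector valued integral of the semigroup.\<close>

lemma laplace_Z:
  assumes q: "q \<in> L2 g" and v: "v \<in> L2 g" "w \<in> L2 g"
    and lim: "((\<lambda>h. N (\<lambda>\<omega>. (S h v \<omega> - v \<omega>) / of_real h - w \<omega>)) \<longlongrightarrow> 0) (at_right 0)"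
    and eq: "\<And>\<omega>. z * v \<omega> - w \<omega> = q \<omega>"
    and M: "\<And>t u. 0 \<le> t \<Longrightarrow> u \<in> L2 g \<Longrightarrow> norm (Z u t) \<le> M * exp (a * t) * N u" and z: "a < Re z"
  shows "set_integrable lborel {0..} (\<lambda>t. exp (- (z * of_real t)) * Z q t)"
    and "(LINT t:{0..}|lborel. exp (- (z * of_real t)) * Z q t) = L2_inner g v P0"
proof -
  define F where "F t = exp (- (z * of_real t)) * Z q t" for t
  have contF: "continuous_on {0..} F"
    unfolding F_def by (intro continuous_intros Z_continuous q)
  have expbound: "norm (exp (- (z * of_real t)) * Z u t) \<le> M * N u * exp (- ((Re z - a) * t))" if t: "0 \<le> t"
    and u: "u \<in> L2 g" for t u
  proof -
    have "norm (exp (- (z * of_real t)) * Z u t) \<le> exp (- (Re z * t)) * (M * exp (a * t) * N u)"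
      unfolding norm_mult by (intro mult_mono M t u) auto
    also have "\<dots> = M * N u * (exp (- (Re z * t)) * exp (a * t))" by simp
    also have "exp (- (Re z * t)) * exp (a * t) = exp (- ((Re z - a) * t))"
      by (simp add: algebra_simps flip: exp_add)
    finally show ?thesis .
  qed
  show int: "set_integrable lborel {0..} (\<lambda>t. exp (- (z * of_real t)) * Z q t)"
  proof (rule set_integrable_bound)
    have "set_integrable lborel {0..} (\<lambda>t. exp (- ((Re z - a) * t)))"
      using z by (intro set_integrable_exp_minus) simp
    then show "set_integrable lborel {0..} (\<lambda>t. M * N q * exp (- ((Re z - a) * t)))"
      by (rule set_integrable_mult_right)
    show "set_borel_measurable lborel {0..} (\<lambda>t. exp (- (z * of_real t)) * Z q t)"
      using contF unfolding F_def[symmetric] set_borel_measurable_def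
      by (simp add: borel_measurable_continuous_on_indicator)
    show "AE t in lborel. t \<in> {0..} \<longrightarrow> norm (exp (- (z * of_real t)) * Z q t) \<le> norm (M * N q * exp (- ((Re z - a) * t)))"
      using order_trans[OF expbound[OF _ q] abs_ge_self] by (intro AE_I2) simp
  qed
  have Zw: "Z w t = z * Z v t - Z q t" if "0 \<le> t" for t
  proof -
    have "w = (\<lambda>\<omega>. z * v \<omega> + (- 1) * q \<omega>)" by (rule ext) (simp flip: eq)
    then show ?thesis using Z_linear[OF that v(1) q, of z "- 1"] by simp
  qed
  have deriv: "((\<lambda>t. exp (- (z * of_real t)) * Z v t) has_vector_derivative - F t) (at t within {0..b})"
    if t: "t \<in> {0..b}" for t b
  proof -
    have "(Z v has_vector_derivative Z w t) (at t within {0..b})"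
      by (rule has_vector_derivative_within_subset[OF Z_has_derivative[OF v _ lim]]) (use t in auto)
    moreover have "((\<lambda>t. exp (- (z * of_real t))) has_vector_derivative (- z * exp (- (z * of_real t)))) (at t within {0..b})"
      by (rule has_vector_derivative_real_field) (auto intro!: derivative_eq_intros)
    ultimately have "((\<lambda>t. exp (- (z * of_real t)) * Z v t) has_vector_derivative
        exp (- (z * of_real t)) * Z w t + (- z * exp (- (z * of_real t))) * Z v t) (at t within {0..b})"
      by (intro has_vector_derivative_mult)
    then show ?thesis using t by (simp add: Zw F_def algebra_simps)
  qed
  have FTC: "(LINT t:{0..b}|lborel. F t) = L2_inner g v P0 - exp (- (z * of_real b)) * Z v b" if b: "0 \<le> b"
    for b
  proof -
    have "((\<lambda>t. - F t) has_integral (exp (- (z * of_real b)) * Z v b - exp (- (z * of_real 0)) * Z v 0)) {0..b}"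
      by (rule fundamental_theorem_of_calculus[OF b deriv])
    from has_integral_neg[OF this] have "(F has_integral (Z v 0 - exp (- (z * of_real b)) * Z v b)) {0..b}"
      by simp
    then have "integral {0..b} F = L2_inner g v P0 - exp (- (z * of_real b)) * Z v b"
      using Z_zero[OF v(1)] by (simp add: integral_unique)
    moreover have "set_integrable lborel {0..b} F"
      by (rule set_integrable_subset[OF int[folded F_def]]) auto
    ultimately show ?thesis using set_borel_integral_eq_integral(2)[of "{0..b}" F] by simp
  qed
  have "((\<lambda>b. LINT t:{0..b}|lborel. F t) \<longlongrightarrow> (LINT t:{0..}|lborel. F t)) at_top"
    by (rule tendsto_set_lebesgue_integral_at_top) (use int in \<open>auto simp: F_def\<close>)
  moreover have "((\<lambda>b. L2_inner g v P0 - exp (- (z * of_real b)) * Z v b) \<longlongrightarrow> L2_inner g v P0 - 0) at_top"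
  proof (rule tendsto_diff[OF tendsto_const], rule Lim_null_comparison)
    show "\<forall>\<^sub>F b in at_top. norm (exp (- (z * of_real b)) * Z v b) \<le> M * N v * exp (- ((Re z - a) * b))"
      by (rule eventually_mono[OF eventually_ge_at_top[of 0]]) (rule expbound[OF _ v(1)])
    show "((\<lambda>b. M * N v * exp (- ((Re z - a) * b))) \<longlongrightarrow> 0) at_top"
      by (rule tendsto_mult_right_zero[OF tendsto_exp_minus_at_top]) (use z in simp)
  qed
  then have "((\<lambda>b. LINT t:{0..b}|lborel. F t) \<longlongrightarrow> L2_inner g v P0 - 0) at_top"
  proof (rule Lim_transform_eventually)
    show "\<forall>\<^sub>F b in at_top. L2_inner g v P0 - exp (- (z * of_real b)) * Z v b = (LINT t:{0..b}|lborel. F t)"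
    using eventually_ge_at_top[of 0] by eventually_elim (simp add: FTC)
  qed
  ultimately have "(LINT t:{0..}|lborel. F t) = L2_inner g v P0 - 0"
    by (rule tendsto_unique[OF trivial_limit_at_top_linorder])
  then show "(LINT t:{0..}|lborel. exp (- (z * of_real t)) * Z q t) = L2_inner g v P0" by (simp add: F_def)
qed

end

section \<open>Integrals over bent arcs\<close>

lemma Arg2pi_of_real_cis:
  assumes "0 < R" "0 \<le> \<theta>" "\<theta> < 2 * pi"
  shows "Arg2pi (of_real R * cis \<theta>) = \<theta>"
  by (rule Arg2pi_unique[of R]) (use assms in \<open>auto simp: cis_conv_exp mult.commute\<close>)

lemma polar_mem_vertical_sectors:
  assumes R: "0 < R" and \<theta>: "pi / 2 - d \<le> \<bar>\<theta>\<bar>" "\<bar>\<theta>\<bar> \<le> pi / 2 + \<delta>" "\<bar>\<theta>\<bar> \<le> pi" "d \<le> \<delta>"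
  shows "of_real R * cis \<theta> \<in> vertical_sectors \<delta>"
proof (cases "0 \<le> \<theta>")
  case True
  then have "Arg2pi (of_real R * cis \<theta>) = \<theta>" using R \<theta> pi_gt_zero by (intro Arg2pi_of_real_cis) linarith+
  then show ?thesis using True \<theta> R by (auto simp: vertical_sectors_def)
next
  case False
  have "of_real R * cis \<theta> = of_real R * cis (\<theta> + 2 * pi)" by (simp add: cis_mult[symmetric])
  moreover have "Arg2pi (of_real R * cis (\<theta> + 2 * pi)) = \<theta> + 2 * pi"
    using False R \<theta> by (intro Arg2pi_of_real_cis) auto
  ultimately have "Arg2pi (of_real R * cis \<theta>) = \<theta> + 2 * pi" by metis
  then show ?thesis using False \<theta> R by (auto simp: vertical_sectors_def abs_le_iff)
qed

lemma left_half_plane_sectors: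
  assumes z: "Re z \<le> 0" "z \<noteq> 0" and \<delta>: "0 < \<delta>"
  shows "z \<in> vertical_sectors \<delta> \<or> (z \<in> left_sector \<delta> \<and> pi / 2 + \<delta> < Arg2pi z \<and> Arg2pi z < 3 * pi / 2 - \<delta>)"
proof -
  have A: "0 \<le> Arg2pi z" "Arg2pi z < 2 * pi" using Arg2pi[of z] by auto
  have "0 < norm z" using z(2) by simp
  have c: "cos (Arg2pi z) \<le> 0"
  proof (rule ccontr)
    assume "\<not> cos (Arg2pi z) \<le> 0"
    then have "0 < norm z * cos (Arg2pi z)" using \<open>0 < norm z\<close> by (intro mult_pos_pos) auto
    then show False using z(1) cos_Arg2pi[of z] by simp
  qed
  have "pi / 2 \<le> Arg2pi z" using c A cos_gt_zero_pi[of "Arg2pi z"] by (cases "Arg2pi z < pi / 2") auto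
  moreover have "Arg2pi z \<le> 3 * pi / 2"
  proof (rule ccontr)
    assume "\<not> Arg2pi z \<le> 3 * pi / 2"
    then have "0 < cos (Arg2pi z - 2 * pi)" using A by (intro cos_gt_zero_pi) auto
    then show False using c by (simp add: cos_diff)
  qed
  ultimately show ?thesis using z(2) by (auto simp: vertical_sectors_def left_sector_def abs_le_iff)
qed

lemma cos_le_minus_sin:
  assumes "0 \<le> d" "d \<le> pi / 2" "pi / 2 + d \<le> x" "x \<le> 3 * pi / 2 - d"
  shows "cos x \<le> - sin d"
proof -
  have "cos (pi / 2 - d) \<le> cos \<bar>x - pi\<bar>" using assms by (intro cos_monotone_0_pi_le) auto
  then show ?thesis by (simp add: cos_diff)
qed

lemma eventually_inf_at_infinity_iff:
  fixes P :: "complex \<Rightarrow> bool"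
  shows "eventually P (inf at_infinity (principal A)) \<longleftrightarrow> (\<exists>b. \<forall>z\<in>A. b \<le> norm z \<longrightarrow> P z)"
  by (auto simp: eventually_inf_principal eventually_at_infinity)

text \<open>Half of \<delta>, capped: the rays at angle pi/2 + \<eta> run inside the vertical
  sectors, where \<open>F\<close> is small, and deviate from the imaginary axis by at most
  pi/4.\<close>

definition contour_angle :: "real \<Rightarrow> real" where "contour_angle \<delta> = min \<delta> (pi / 2) / 2"

locale sectorial_decay =
  fixes F :: "complex \<Rightarrow> complex" and \<delta> :: real
  assumes mero: "F nicely_meromorphic_on UNIV"
    and analytic_right: "\<And>z. 0 \<le> Re z \<Longrightarrow> F analytic_on {z}"
    and \<delta>: "0 < \<delta>"
    and decay: "(F \<longlongrightarrow> 0) (inf at_infinity (principal (vertical_sectors \<delta>)))"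
begin

abbreviation "\<eta> \<equiv> contour_angle \<delta>"
abbreviation "\<phi> \<equiv> pi / 2 + \<eta>"

lemma \<eta>: "0 < \<eta>" "\<eta> < \<delta>" "\<eta> \<le> pi / 4"
  using \<delta> pi_gt_zero by (auto simp: contour_angle_def min_def field_simps)

lemma sin_\<eta>_pos: "0 < sin \<eta>"
  using \<eta> pi_gt_zero by (intro sin_gt_zero) auto

lemma analytic_nonpole: "\<not> is_pole F z \<Longrightarrow> F analytic_on {z}"
  using nicely_meromorphic_on_imp_analytic_at[OF mero, of z] by simp

lemma decay_bound:
  assumes "0 < e" shows "\<exists>b>0. \<forall>z\<in>vertical_sectors \<delta>. b \<le> norm z \<longrightarrow> norm (F z) < e"
proof -
  have "\<forall>\<^sub>F z in inf at_infinity (principal (vertical_sectors \<delta>)). norm (F z) < e"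
    using tendstoD[OF decay assms] by simp
  then obtain b where "\<forall>z\<in>vertical_sectors \<delta>. b \<le> norm z \<longrightarrow> norm (F z) < e"
    unfolding eventually_inf_at_infinity_iff by blast
  then show ?thesis by (intro exI[of _ "max b 1"]) auto
qed

definition R0 :: real where
  "R0 = (SOME b. 0 < b \<and> (\<forall>z\<in>vertical_sectors \<delta>. b \<le> norm z \<longrightarrow> norm (F z) < 1))"

lemma R0: "0 < R0" "\<And>z. z \<in> vertical_sectors \<delta> \<Longrightarrow> R0 \<le> norm z \<Longrightarrow> norm (F z) < 1"
proof -
  have "0 < R0 \<and> (\<forall>z\<in>vertical_sectors \<delta>. R0 \<le> norm z \<longrightarrow> norm (F z) < 1)"
    unfolding R0_def by (rule someI_ex) (use decay_bound[of 1] in auto)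
  then show "0 < R0" "\<And>z. z \<in> vertical_sectors \<delta> \<Longrightarrow> R0 \<le> norm z \<Longrightarrow> norm (F z) < 1" by auto
qed

text \<open>The sector is closed, and z may lie on its boundary. But the ray from z outwards stays
  in the sector, and along this ray |F| < 1 contradicts a pole at z.\<close>

lemma no_pole_vertical:
  assumes z: "z \<in> vertical_sectors \<delta>" "R0 \<le> norm z"
  shows "\<not> is_pole F z"
proof
  assume "is_pole F z"
  then have pole: "filterlim F at_infinity (at z)" by (simp add: is_pole_def)
  have z0: "z \<noteq> 0" using z(2) R0(1) by auto
  have "filterlim (\<lambda>n. of_real (1 + 1 / real (Suc n)) * z) (at z) sequentially"
    unfolding filterlim_at
  proof (intro conjI)
    have "((\<lambda>n. of_real (1 + 1 / real (Suc n)) * z) \<longlongrightarrow> of_real (1 + 0) * z) sequentially"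
      by (intro tendsto_intros LIMSEQ_Suc[OF lim_1_over_n])
    then show "((\<lambda>n. of_real (1 + 1 / real (Suc n)) * z) \<longlongrightarrow> z) sequentially" by simp
    have "of_real (1 + 1 / real (Suc n)) * z \<noteq> z" for n
    proof
      assume "of_real (1 + 1 / real (Suc n)) * z = z"
      then have "of_real (1 / real (Suc n)) * z = 0" by (simp add: algebra_simps)
      then show False using z0 by (simp del: of_nat_Suc)
    qed
    then show "\<forall>\<^sub>F n in sequentially. of_real (1 + 1 / real (Suc n)) * z \<in> UNIV \<and> of_real (1 + 1 / real (Suc n)) * z \<noteq> z" by simp
  qed
  from filterlim_compose[OF pole this]
  have "\<forall>\<^sub>F n in sequentially. 1 \<le> norm (F (of_real (1 + 1 / real (Suc n)) * z))"
    unfolding filterlim_at_infinity[OF order.refl] by (auto dest: spec[of _ 1])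
  then obtain n where n: "1 \<le> norm (F (of_real (1 + 1 / real (Suc n)) * z))"
    using eventually_happens'[OF sequentially_bot] by blast
  define c where "c = 1 + 1 / real (Suc n)"
  have c: "1 \<le> c" by (simp add: c_def)
  have "of_real c * z \<in> vertical_sectors \<delta>" using z(1) c by (auto simp: vertical_sectors_def)
  moreover have "1 * norm z \<le> c * norm z" using c by (intro mult_right_mono) auto
  then have "norm z \<le> norm (of_real c * z)" using c by (simp add: norm_mult)
  ultimately show False using R0(2)[of "of_real c * z"] z(2) n by (simp add: c_def)
qed

lemma bent_region:
  assumes R: "R0 \<le> R" and \<theta>: "\<bar>\<theta>\<bar> \<le> pi / 2 + \<delta>" "\<bar>\<theta>\<bar> \<le> pi"
  shows "F analytic_on {of_real R * cis \<theta>}" and "pi / 2 \<le> \<bar>\<theta>\<bar> \<Longrightarrow> norm (F (of_real R * cis \<theta>)) < 1"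
proof -
  have R': "0 < R" using R R0(1) by simp
  have V: "of_real R * cis \<theta> \<in> vertical_sectors \<delta>" if "pi / 2 \<le> \<bar>\<theta>\<bar>"
    by (rule polar_mem_vertical_sectors[OF R', of 0]) (use that \<theta> \<delta> in auto)
  have n: "norm (of_real R * cis \<theta>) = R" using R' by (simp add: norm_mult)
  show "pi / 2 \<le> \<bar>\<theta>\<bar> \<Longrightarrow> norm (F (of_real R * cis \<theta>)) < 1" using R0(2)[OF V] R n by simp
  show "F analytic_on {of_real R * cis \<theta>}"
  proof (cases "pi / 2 \<le> \<bar>\<theta>\<bar>")
    case True then show ?thesis using no_pole_vertical[OF V] R n by (intro analytic_nonpole) simp
  next
    case False
    then have "0 < cos \<theta>" by (intro cos_gt_zero_pi) auto
    then show ?thesis using R' by (intro analytic_right) simp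
  qed
qed

(* With dz = i z d\<theta>, the two integrals are those of exp (z t) F(z) / z^2 and of exp (z t) F(z). *)
definition bent_arc :: "real \<Rightarrow> complex \<Rightarrow> complex" where
  "bent_arc R t = 1 / (2 * pi) * integral {- \<phi>..\<phi>}
     (\<lambda>\<theta>. exp (of_real R * cis \<theta> * t) * F (of_real R * cis \<theta>) / (of_real R * cis \<theta>))"

definition bent_arc2 :: "real \<Rightarrow> complex \<Rightarrow> complex" where
  "bent_arc2 R t = 1 / (2 * pi) * integral {- \<phi>..\<phi>}
     (\<lambda>\<theta>. exp (of_real R * cis \<theta> * t) * F (of_real R * cis \<theta>) * (of_real R * cis \<theta>))"

lemma continuous_on_circle:
  assumes "\<And>\<theta>. \<theta> \<in> A \<Longrightarrow> F analytic_on {of_real R * cis \<theta>}"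
  shows "continuous_on A (\<lambda>\<theta>. F (of_real R * cis \<theta>))"
proof -
  have "F analytic_on ((\<lambda>\<theta>. of_real R * cis \<theta>) ` A)"
    using assms by (subst analytic_on_analytic_at) auto
  then have "continuous_on ((\<lambda>\<theta>. of_real R * cis \<theta>) ` A) F"
    by (intro holomorphic_on_imp_continuous_on analytic_imp_holomorphic)
  then show ?thesis by (rule continuous_on_compose2) (auto intro!: continuous_intros)
qed

lemma integral_exp_deriv:
  fixes c m :: "real \<Rightarrow> complex"
  assumes [continuous_intros]: "continuous_on {x..y} c" "continuous_on {x..y} m"
  shows "((\<lambda>t. integral {x..y} (\<lambda>\<theta>. exp (m \<theta> * t) * c \<theta>)) has_field_derivative integral {x..y} (\<lambda>\<theta>. exp (m \<theta> * t) * (m \<theta> * c \<theta>))) (at t)"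
proof -
  have "((\<lambda>t. integral (cbox x y) (\<lambda>\<theta>. exp (m \<theta> * t) * c \<theta>)) has_field_derivative
      integral (cbox x y) (\<lambda>\<theta>. exp (m \<theta> * t) * (m \<theta> * c \<theta>))) (at t within UNIV)"
  proof (rule leibniz_rule_field_derivative)
    show "((\<lambda>t. exp (m \<theta> * t) * c \<theta>) has_field_derivative exp (m \<theta> * t) * (m \<theta> * c \<theta>)) (at t within UNIV)"
      for t \<theta>
      by (auto intro!: derivative_eq_intros)
    show "(\<lambda>\<theta>. exp (m \<theta> * t) * c \<theta>) integrable_on cbox x y" for t
      by (intro integrable_continuous) (auto intro!: continuous_intros)
    have s: "continuous_on (UNIV \<times> {x..y}) (\<lambda>p. m (snd p))" "continuous_on (UNIV \<times> {x..y}) (\<lambda>p. c (snd p))"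
      by (rule continuous_on_compose2[OF _ continuous_on_snd[OF continuous_on_id]]; use assms in auto)+
    show "continuous_on (UNIV \<times> cbox x y) (\<lambda>(t, \<theta>). exp (m \<theta> * t) * (m \<theta> * c \<theta>))"
      unfolding split_beta cbox_interval by (intro continuous_intros s)
  qed auto
  then show ?thesis by simp
qed

lemma arc_analytic: "R0 \<le> R \<Longrightarrow> \<theta> \<in> {- \<phi>..\<phi>} \<Longrightarrow> F analytic_on {of_real R * cis \<theta>}"
  by (rule bent_region(1)) (use \<eta> pi_gt_zero in auto)

text \<open>Each derivative in t brings down a factor z; starting from the weight 1/z, two of them
  produce the weight z.\<close>

lemma bent_arc_deriv2:
  assumes R: "R0 \<le> R"
  shows "(deriv ^^ 2) (bent_arc R) t = bent_arc2 R t" and "bent_arc R holomorphic_on UNIV"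
proof -
  define I where "I k t = 1 / (2 * pi) * integral {- \<phi>..\<phi>}
     (\<lambda>\<theta>. exp (of_real R * cis \<theta> * t) * ((of_real R * cis \<theta>) ^ k * (F (of_real R * cis \<theta>) / (of_real R * cis \<theta>))))" for k t
  have R': "0 < R" using R R0 by simp
  have cF: "continuous_on {- \<phi>..\<phi>} (\<lambda>\<theta>. F (of_real R * cis \<theta>))"
    by (rule continuous_on_circle[OF arc_analytic[OF R]])
  have D: "(I k has_field_derivative I (Suc k) t) (at t)" for k t
  proof -
    have "((\<lambda>t. integral {- \<phi>..\<phi>} (\<lambda>\<theta>. exp (of_real R * cis \<theta> * t) * ((of_real R * cis \<theta>) ^ k * (F (of_real R * cis \<theta>) / (of_real R * cis \<theta>)))))
       has_field_derivative integral {- \<phi>..\<phi>} (\<lambda>\<theta>. exp (of_real R * cis \<theta> * t) * (of_real R * cis \<theta> * ((of_real R * cis \<theta>) ^ k * (F (of_real R * cis \<theta>) / (of_real R * cis \<theta>)))))) (at t)"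
    proof (rule integral_exp_deriv)
      show "continuous_on {- \<phi>..\<phi>} (\<lambda>\<theta>. (of_real R * cis \<theta>) ^ k * (F (of_real R * cis \<theta>) / (of_real R * cis \<theta>)))"
        by (intro continuous_intros cF) (use R' in auto)
      show "continuous_on {- \<phi>..\<phi>} (\<lambda>\<theta>. of_real R * cis \<theta>)" by (intro continuous_intros)
    qed
    from DERIV_cmult[OF this, of "1 / (2 * pi)"] show ?thesis unfolding I_def
      by (simp only: power_Suc mult.assoc)
  qed
  have I0: "bent_arc R = I 0" by (rule ext) (simp add: bent_arc_def I_def)
  have d: "deriv (I k) = I (Suc k)" for k by (rule ext) (rule DERIV_imp_deriv[OF D])
  have "(deriv ^^ 2) (bent_arc R) t = I 2 t" unfolding I0 by (simp add: numeral_2_eq_2 d)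
  also have "\<dots> = bent_arc2 R t"
  proof -
    have "(\<lambda>\<theta>. exp (of_real R * cis \<theta> * t) * ((of_real R * cis \<theta>) ^ 2 * (F (of_real R * cis \<theta>) / (of_real R * cis \<theta>))))
      = (\<lambda>\<theta>. exp (of_real R * cis \<theta> * t) * F (of_real R * cis \<theta>) * (of_real R * cis \<theta>))"
      by (rule ext) (use R' in \<open>simp add: power2_eq_square\<close>)
    then show ?thesis unfolding I_def bent_arc2_def by (simp only:)
  qed
  finally show "(deriv ^^ 2) (bent_arc R) t = bent_arc2 R t" .
  show "bent_arc R holomorphic_on UNIV" unfolding I0 using D by (auto simp: holomorphic_on_open)
qed

text \<open>The sector |arg t| < \<eta>, with the angle condition in linear form. For these t the
  factor exp(z t) has modulus at most 1 on the two rays where arg z is \<open>\<phi>\<close> or its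
  negative.\<close>

definition \<Theta> :: "complex set" where "\<Theta> = {t. \<bar>Im t\<bar> * cos \<eta> < sin \<eta> * Re t}"

lemma \<Theta>_props: "open \<Theta>" "convex \<Theta>" "\<And>t. 0 < t \<Longrightarrow> of_real t \<in> \<Theta>"
proof -
  show "open \<Theta>" unfolding \<Theta>_def by (intro open_Collect_less continuous_intros)
  have "0 < cos \<eta>" using \<eta> pi_gt_zero by (intro cos_gt_zero_pi) auto
  have eq: "\<Theta> = {t. inner (Complex (- sin \<eta>) (cos \<eta>)) t < 0} \<inter> {t. inner (Complex (- sin \<eta>) (- cos \<eta>)) t < 0}"
  proof -
    have iff: "\<bar>y\<bar> * cos \<eta> < s \<longleftrightarrow> y * cos \<eta> < s \<and> - y * cos \<eta> < s" for y s
    proof -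
      have "\<bar>y\<bar> * cos \<eta> = \<bar>y * cos \<eta>\<bar>" using \<open>0 < cos \<eta>\<close> by (simp add: abs_mult)
      then show ?thesis by (auto simp: abs_less_iff)
    qed
    show ?thesis unfolding \<Theta>_def iff by (auto simp: inner_complex_def algebra_simps)
  qed
  show "convex \<Theta>" unfolding eq by (intro convex_Int convex_halfspace_lt)
  show "of_real t \<in> \<Theta>" if "0 < t" for t using that sin_\<eta>_pos by (simp add: \<Theta>_def)
qed

lemma Re_ray_nonpos:
  assumes "t \<in> \<Theta>" "\<theta> = \<phi> \<or> \<theta> = - \<phi>" "0 \<le> r"
  shows "Re (of_real r * cis \<theta> * t) \<le> 0"
proof -
  have cs: "cos \<theta> = - sin \<eta>" "sin \<theta> = cos \<eta> \<or> sin \<theta> = - cos \<eta>"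
    using assms(2)
      by (auto simp: cos_add sin_add cos_diff sin_diff cos_minus[of \<phi>, unfolded minus_add_distrib] sin_minus[of \<phi>, unfolded minus_add_distrib])
  have c: "0 \<le> cos \<eta>" using \<eta> pi_gt_zero by (intro cos_ge_zero) auto
  have "\<bar>Im t * sin \<theta>\<bar> = \<bar>Im t\<bar> * cos \<eta>" using cs(2) c by (auto simp: abs_mult)
  then have "cos \<theta> * Re t - sin \<theta> * Im t \<le> 0" using assms(1) unfolding cs(1) \<Theta>_def
    by (simp add: mult.commute abs_le_iff)
  then have "r * (cos \<theta> * Re t - sin \<theta> * Im t) \<le> 0" using assms(3) by (rule mult_nonneg_nonpos[rotated])
  then show ?thesis by (simp add: algebra_simps)
qed

(* In the logarithmic coordinate s, z = e^s, arcs become vertical and rays horizontal segments of a convex strip,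
   on which the integrand has a primitive. *)
lemma bent_arc_diff:
  assumes t: "t \<in> \<Theta>" and R: "R0 < R" "R \<le> R'"
  shows "norm (bent_arc R' t - bent_arc R t) \<le> 1 / R"
proof (cases "R = R'")
  case True
  then show ?thesis using R R0(1) by simp
next
  case False
  then have RR: "0 < R" "R < R'" "0 < R'" using R R0(1) by auto
  \<comment> \<open>The strip |Im s| < pi/2 + d contains the angles up to \<open>\<phi>\<close>, and
    exp maps it to where \<open>F\<close> is analytic: d \<le> \<delta> keeps the image within the
    sectors, d \<le> pi/2 keeps the angles at modulus at most pi.\<close>
  define d where "d = min \<delta> (pi / 2)"
  have d: "\<eta> < d" "d \<le> \<delta>" "d \<le> pi / 2" using \<eta> pi_gt_zero by (auto simp: d_def)
  define \<Omega> where "\<Omega> = {s. ln R0 < Re s} \<inter> {s. - (pi / 2 + d) < Im s} \<inter> {s. Im s < pi / 2 + d}"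
  have \<Omega>: "open \<Omega>" "convex \<Omega>" unfolding \<Omega>_def
    by (intro open_Int open_halfspace_Re_gt open_halfspace_Im_gt open_halfspace_Im_lt)
      (intro convex_Int convex_halfspace_Re_gt convex_halfspace_Im_gt convex_halfspace_Im_lt)
  have exps: "exp s = of_real (exp (Re s)) * cis (Im s)" for s by (simp add: exp_eq_polar)
  \<comment> \<open>With z = e^s and dz = z ds, this is exp(z t) F(z) dz / z^2.\<close>
  define H where "H s = exp (exp s * t) * F (exp s) * exp (- s)" for s
  have "F analytic_on {exp s}" if "s \<in> \<Omega>" for s
    unfolding exps
  proof (rule bent_region(1))
    have "exp (ln R0) \<le> exp (Re s)" using that unfolding exp_le_cancel_iff by (simp add: \<Omega>_def)
    then show "R0 \<le> exp (Re s)" using R0(1) by simp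
  qed (use that d in \<open>auto simp: \<Omega>_def\<close>)
  then have "(F \<circ> exp) analytic_on \<Omega>"
    by (intro analytic_on_compose analytic_intros) (subst analytic_on_analytic_at, auto)
  then have "(\<lambda>s. F (exp s)) holomorphic_on \<Omega>" by (simp add: o_def analytic_imp_holomorphic)
  then have "H holomorphic_on \<Omega>" unfolding H_def by (intro holomorphic_intros)
  then obtain G where "\<And>s. s \<in> \<Omega> \<Longrightarrow> (G has_field_derivative H s) (at s within \<Omega>)"
    using holomorphic_convex_primitive'[OF \<Omega>(2,1)] by metis
  then have G: "(G has_field_derivative H s) (at s)" if "s \<in> \<Omega>" for s
    using that \<Omega>(1) by (metis at_within_open)
  have arc: "bent_arc r t = (G (Complex (ln r) \<phi>) - G (Complex (ln r) (- \<phi>))) / (2 * pi * \<i>)" if r: "R0 < r"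
    for r
  proof -
    have r0: "0 < r" using r R0(1) by simp
    have mem: "Complex (ln r) \<theta> \<in> \<Omega>" if "\<theta> \<in> {- \<phi>..\<phi>}" for \<theta>
      using that r r0 R0(1) d by (auto simp: \<Omega>_def)
    have "((\<lambda>\<theta>. \<i> * (exp (of_real r * cis \<theta> * t) * F (of_real r * cis \<theta>) / (of_real r * cis \<theta>))) has_integral
        G (Complex (ln r) \<phi>) - G (Complex (ln r) (- \<phi>))) {- \<phi>..\<phi>}"
    proof (rule fundamental_theorem_of_calculus)
      fix \<theta> assume \<theta>: "\<theta> \<in> {- \<phi>..\<phi>}"
      have "((\<lambda>\<theta>. Complex (ln r) \<theta>) has_vector_derivative \<i>) (at \<theta>)"
        by (auto intro!: derivative_eq_intros simp: has_vector_derivative_complex_iff)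
      then have "((G \<circ> (\<lambda>\<theta>. Complex (ln r) \<theta>)) has_vector_derivative (\<i> * H (Complex (ln r) \<theta>))) (at \<theta>)"
        by (rule field_vector_diff_chain_at) (rule G[OF mem[OF \<theta>]])
      moreover have "exp (Complex (ln r) \<theta>) = of_real r * cis \<theta>" using r0 by (simp add: exps)
      moreover from this have "exp (- Complex (ln r) \<theta>) = 1 / (of_real r * cis \<theta>)"
        by (simp add: exp_minus field_simps)
      ultimately show "((\<lambda>\<theta>. G (Complex (ln r) \<theta>)) has_vector_derivative \<i> * (exp (of_real r * cis \<theta> * t) * F (of_real r * cis \<theta>) / (of_real r * cis \<theta>))) (at \<theta> within {- \<phi>..\<phi>})"
        by (auto simp: H_def o_def intro: has_vector_derivative_at_within)
    qed (use \<eta> pi_gt_zero in auto)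
    from integral_unique[OF this, unfolded integral_mult_right, symmetric] show ?thesis
      by (simp add: bent_arc_def)
  qed
  have ray: "norm (G (Complex (ln R') \<theta>) - G (Complex (ln R) \<theta>)) \<le> 1 / R" if \<theta>: "\<theta> = \<phi> \<or> \<theta> = - \<phi>" for \<theta>
  proof -
    have lnRR: "ln R < ln R'" using RR by simp
    have "0 < \<phi>" using \<eta>(1) pi_gt_zero by linarith
    then have \<theta>': "\<bar>\<theta>\<bar> = \<phi>" using \<theta> by (metis abs_minus_cancel abs_of_pos)
    have mem: "Complex x \<theta> \<in> \<Omega>" if "ln R \<le> x" for x
    proof -
      have "ln R0 < ln R" using R R0(1) by simp
      then show ?thesis using that \<theta>' d unfolding \<Omega>_def by (auto simp: abs_if split: if_splits)
    qed
    have der: "((\<lambda>x. G (Complex x \<theta>)) has_vector_derivative H (Complex x \<theta>)) (at x)" if x: "ln R \<le> x" for x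
    proof -
      have "((\<lambda>x. Complex x \<theta>) has_vector_derivative 1) (at x)"
        by (auto intro!: derivative_eq_intros simp: has_vector_derivative_complex_iff)
      then have "((G \<circ> (\<lambda>x. Complex x \<theta>)) has_vector_derivative (1 * H (Complex x \<theta>))) (at x)"
        by (rule field_vector_diff_chain_at) (rule G[OF mem[OF x]])
      then show ?thesis by (simp add: o_def)
    qed
    \<comment> \<open>On a ray |H| \<le> e^-x, and the primitive - e^-x gives 1/R - 1/R'.\<close>
    have "norm (G (Complex (ln R') \<theta>) - G (Complex (ln R) \<theta>)) \<le> - exp (- ln R') - (- exp (- ln R))"
    proof (rule differentiable_bound_general[OF lnRR])
      show "continuous_on {ln R..ln R'} (\<lambda>x. G (Complex x \<theta>))"
        by (intro continuous_at_imp_continuous_on ballI has_vector_derivative_continuous[OF der]) simp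
      show "continuous_on {ln R..ln R'} (\<lambda>x. - exp (- x))" by (intro continuous_intros)
      fix x assume x: "ln R < x" "x < ln R'"
      show "((\<lambda>x. G (Complex x \<theta>)) has_vector_derivative H (Complex x \<theta>)) (at x)" using der x by simp
      show "((\<lambda>x. - exp (- x)) has_vector_derivative exp (- x)) (at x)"
        by (auto intro!: derivative_eq_intros simp: has_real_derivative_iff_has_vector_derivative[symmetric])
      have ex: "exp (Complex x \<theta>) = of_real (exp x) * cis \<theta>" by (simp add: exps)
      have "R0 \<le> exp x"
      proof -
        have "R0 < R" by fact
        also have "R = exp (ln R)" using RR by simp
        also have "\<dots> < exp x" using x by simp
        finally show ?thesis by simp
      qed
      then have "norm (F (exp (Complex x \<theta>))) < 1" unfolding ex
        by (intro bent_region(2)) (use \<theta>' \<eta> pi_gt_zero in auto)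
      moreover have "norm (exp (exp (Complex x \<theta>) * t)) \<le> 1"
        using Re_ray_nonpos[OF t \<theta> exp_ge_zero[of x]] unfolding ex
          by (simp only: norm_exp_eq_Re exp_le_one_iff)
      ultimately have "norm (exp (exp (Complex x \<theta>) * t)) * norm (F (exp (Complex x \<theta>))) * norm (exp (- Complex x \<theta>)) \<le> 1 * 1 * exp (- x)"
        by (intro mult_mono) auto
      then show "norm (H (Complex x \<theta>)) \<le> exp (- x)" by (simp add: H_def norm_mult)
    qed
    also have "\<dots> \<le> 1 / R" using RR by (simp add: exp_minus inverse_eq_divide)
    finally show ?thesis .
  qed
  have "bent_arc R' t - bent_arc R t = ((G (Complex (ln R') \<phi>) - G (Complex (ln R) \<phi>)) - (G (Complex (ln R') (- \<phi>)) - G (Complex (ln R) (- \<phi>)))) / (2 * pi * \<i>)"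
    using arc[of R] arc[of R'] R RR by (simp add: diff_divide_distrib)
  then have "norm (bent_arc R' t - bent_arc R t) = norm ((G (Complex (ln R') \<phi>) - G (Complex (ln R) \<phi>)) - (G (Complex (ln R') (- \<phi>)) - G (Complex (ln R) (- \<phi>)))) / (2 * pi)"
    by (simp only: norm_divide) (simp add: norm_mult)
  also have "\<dots> \<le> (1 / R + 1 / R) / (2 * pi)"
    using order_trans[OF norm_triangle_ineq4 add_mono[OF ray[of \<phi>] ray[of "- \<phi>"]]]
      by (intro divide_right_mono) auto
  also have "\<dots> = (1 / R) * (1 / pi)" by (simp add: field_simps)
  also have "\<dots> \<le> (1 / R) * 1" using RR pi_ge_two by (intro mult_left_mono) auto
  finally show ?thesis by simp
qed

definition bent_limit :: "complex \<Rightarrow> complex" where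
  "bent_limit t = lim (\<lambda>n. bent_arc (R0 + real (Suc n)) t)"

text \<open>The bound on differences does not involve the larger radius, so the arcs are Cauchy in
  R, and the limit along a sequence of radii, as taken in the definition, is the limit along all
  R.\<close>

lemma bent_limit_diff:
  assumes t: "t \<in> \<Theta>" and R: "R0 < R"
  shows "norm (bent_arc R t - bent_limit t) \<le> 1 / R"
proof -
  have pos: "0 < R" using R R0(1) by simp
  have "Cauchy (\<lambda>n. bent_arc (R0 + real (Suc n)) t)"
  proof (rule CauchyI')
    fix e :: real assume e: "0 < e"
    obtain m where m: "inverse (real (Suc m)) < e" using reals_Archimedean[OF e] by blast
    show "\<exists>M. \<forall>m\<ge>M. \<forall>n>m. dist (bent_arc (R0 + real (Suc m)) t) (bent_arc (R0 + real (Suc n)) t) < e"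
    proof (intro exI[of _ m] allI impI)
      fix i n assume "m \<le> i" "i < n"
      have "norm (bent_arc (R0 + real (Suc n)) t - bent_arc (R0 + real (Suc i)) t) \<le> 1 / (R0 + real (Suc i))"
        by (rule bent_arc_diff[OF t]) (use \<open>i < n\<close> in auto)
      also have "\<dots> \<le> 1 / real (Suc m)" using \<open>m \<le> i\<close> R0(1) by (intro divide_left_mono) auto
      also have "\<dots> < e" using m by (simp add: inverse_eq_divide)
      finally show "dist (bent_arc (R0 + real (Suc i)) t) (bent_arc (R0 + real (Suc n)) t) < e"
        by (simp add: dist_norm norm_minus_commute)
    qed
  qed
  then have lim: "(\<lambda>n. bent_arc (R0 + real (Suc n)) t) \<longlonglongrightarrow> bent_limit t"
    unfolding bent_limit_def by (simp add: Cauchy_convergent_iff convergent_LIMSEQ_iff)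
  have "(\<lambda>n. norm (bent_arc (R0 + real (Suc n)) t - bent_arc R t)) \<longlonglongrightarrow> norm (bent_limit t - bent_arc R t)"
    by (intro tendsto_intros lim)
  moreover have "\<forall>\<^sub>F n in sequentially. norm (bent_arc (R0 + real (Suc n)) t - bent_arc R t) \<le> 1 / R"
  proof -
    obtain m where m: "R < real m" using reals_Archimedean2 by blast
    have "norm (bent_arc (R0 + real (Suc n)) t - bent_arc R t) \<le> 1 / R" if "m \<le> n" for n
      by (rule bent_arc_diff[OF t R]) (use that m R0(1) in linarith)
    then show ?thesis by (auto simp: eventually_sequentially)
  qed
  ultimately have "norm (bent_limit t - bent_arc R t) \<le> 1 / R" by (rule tendsto_upperbound) simp
  then show ?thesis by (simp add: norm_minus_commute)
qed

lemma uniform_limit_bent: "uniform_limit \<Theta> bent_arc bent_limit at_top"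
proof (rule uniform_limitI)
  fix e :: real assume e: "0 < e"
  show "\<forall>\<^sub>F R in at_top. \<forall>t\<in>\<Theta>. dist (bent_arc R t) (bent_limit t) < e"
  proof (rule eventually_mono[OF eventually_gt_at_top[of "max R0 (1 / e)"]], intro ballI)
    fix R t assume R: "max R0 (1 / e) < R" and t: "t \<in> \<Theta>"
    have "dist (bent_arc R t) (bent_limit t) \<le> 1 / R" using bent_limit_diff[OF t, of R] R
      by (simp add: dist_norm)
    also have "\<dots> < e" using R e R0(1) by (simp add: field_simps)
    finally show "dist (bent_arc R t) (bent_limit t) < e" .
  qed
qed

lemma bent_holomorphic_eventually: "\<forall>\<^sub>F R in at_top. bent_arc R holomorphic_on \<Theta>"
  by (rule eventually_mono[OF eventually_ge_at_top[of R0]])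
    (rule holomorphic_on_subset[OF bent_arc_deriv2(2)], auto)

lemma bent_limit_holomorphic: "bent_limit holomorphic_on \<Theta>"
proof -
  have "bent_limit holomorphic_on ball z r" if "cball z r \<subseteq> \<Theta>" for z r
  proof -
    have "\<forall>\<^sub>F R in at_top. continuous_on (cball z r) (bent_arc R) \<and> bent_arc R holomorphic_on ball z r"
      using bent_holomorphic_eventually
    proof eventually_elim
      case (elim R)
      have "bent_arc R holomorphic_on cball z r" by (rule holomorphic_on_subset[OF elim that])
      then show ?case
        by (auto intro: holomorphic_on_imp_continuous_on holomorphic_on_subset[OF _ ball_subset_cball])
    qed
    from holomorphic_uniform_limit[OF this uniform_limit_on_subset[OF uniform_limit_bent that]]
    show ?thesis by simp
  qed
  then have "bent_limit analytic_on \<Theta>"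
    unfolding analytic_on_def using \<Theta>_props(1)[unfolded open_contains_cball] by blast
  then show ?thesis by (rule analytic_imp_holomorphic)
qed

lemma bent_arc2_tendsto: "t \<in> \<Theta> \<Longrightarrow> ((\<lambda>R. bent_arc2 R t) \<longlongrightarrow> (deriv ^^ 2) bent_limit t) at_top"
proof -
  assume t: "t \<in> \<Theta>"
  have "((\<lambda>R. (deriv ^^ 2) (bent_arc R) t) \<longlongrightarrow> (deriv ^^ 2) bent_limit t) at_top"
    by (rule higher_deriv_complex_uniform_limit[OF uniform_limit_bent bent_holomorphic_eventually _ \<Theta>_props(1) t]) simp
  moreover have "\<forall>\<^sub>F R in at_top. (deriv ^^ 2) (bent_arc R) t = bent_arc2 R t"
    by (rule eventually_mono[OF eventually_ge_at_top[of R0]]) (rule bent_arc_deriv2(1))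
  ultimately show ?thesis by (rule Lim_transform_eventually)
qed

end

section \<open>Laplace inversion\<close>

lemma integral_period_shift:
  fixes f :: "real \<Rightarrow> complex"
  assumes cont: "continuous_on UNIV f" and per: "\<And>x. f (x + p) = f x" and c: "0 \<le> c" "c \<le> p"
  shows "integral {- c..p - c} f = integral {0..p} f"
proof -
  have int: "f integrable_on {a..b}" for a b
    by (rule integrable_continuous_real) (rule continuous_on_subset[OF cont], simp)
  have "integral {- c..p - c} f = integral {- c..0} f + integral {0..p - c} f"
    by (rule Henstock_Kurzweil_Integration.integral_combine[symmetric]) (use c int in auto)
  also have "integral {- c..0} f = integral {- c..0} (f \<circ> (+) p)"
    using per by (simp add: o_def add.commute)
  also have "\<dots> = integral {p - c..p} f" by (simp add: integral_shift_Icc_real)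
  also have "integral {p - c..p} f + integral {0..p - c} f = integral {0..p - c} f + integral {p - c..p} f"
    by simp
  also have "\<dots> = integral {0..p} f"
    by (rule Henstock_Kurzweil_Integration.integral_combine) (use c int in auto)
  finally show ?thesis .
qed

lemma cis_plus_2pi [simp]: "cis (x + 2 * pi) = cis x"
  by (simp add: cis_mult[symmetric])

lemma bounded_arc_integral:
  fixes h :: "real \<Rightarrow> complex"
  assumes h: "h \<in> borel_measurable borel" and b: "\<And>\<theta>. norm (h \<theta>) \<le> B * indicator {- pi..pi} \<theta>"
  shows "integrable lborel h" and "norm (\<integral>\<theta>. h \<theta> \<partial>lborel) \<le> 2 * pi * B"
proof -
  have i: "integrable lborel (\<lambda>\<theta>. B * indicator {- pi..pi} \<theta> :: real)" by simp
  show hi: "integrable lborel h"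
  proof (rule Bochner_Integration.integrable_bound[OF i])
    show "AE \<theta> in lborel. norm (h \<theta>) \<le> norm (B * indicator {- pi..pi} \<theta> :: real)"
      by (intro AE_I2 order_trans[OF b]) simp
  qed (use h in simp)
  have "norm (\<integral>\<theta>. h \<theta> \<partial>lborel) \<le> (\<integral>\<theta>. B * indicator {- pi..pi} \<theta> \<partial>lborel)"
    by (rule Bochner_Integration.integral_norm_bound_integral[OF hi i b])
  also have "\<dots> = 2 * pi * B" by simp
  finally show "norm (\<integral>\<theta>. h \<theta> \<partial>lborel) \<le> 2 * pi * B" .
qed

text \<open>The part of the circle of radius R with Re z \<ge> a, as a set of angles. It is used one
  above the growth exponent of \<open>Z\<close>, well inside the half plane where the Laplace
  integral converges.\<close>

definition right_arc :: "real \<Rightarrow> real \<Rightarrow> real set" where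
  "right_arc R a = {\<theta>. - pi \<le> \<theta> \<and> \<theta> \<le> pi \<and> a \<le> R * cos \<theta>}"

lemma right_arc_measurable [measurable]: "right_arc R a \<in> sets borel"
proof -
  have "closed (right_arc R a)" unfolding right_arc_def
    by (intro closed_Collect_conj closed_Collect_le continuous_intros)
  then show ?thesis by simp
qed

text \<open>The residue of exp(u \<tau>) / u^2 at 0 is \<tau>, and du = i u d\<theta> on the
  circle.\<close>

lemma circle_integral_exp:
  fixes \<tau> :: complex
  assumes R: "0 < R"
  shows "integral {- pi..pi} (\<lambda>\<theta>. exp (of_real R * cis \<theta> * \<tau>) / (of_real R * cis \<theta>)) = 2 * pi * \<tau>"
proof -
  define f where "f \<theta> = exp (of_real R * cis \<theta> * \<tau>) / (of_real R * cis \<theta>)" for \<theta>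
  have cf: "continuous_on UNIV f" unfolding f_def using R by (intro continuous_intros) auto
  have "((\<lambda>u. exp (u * \<tau>) / (u - 0) ^ Suc 1) has_contour_integral ((2 * pi * \<i>) / (fact 1) * (deriv ^^ 1) (\<lambda>u. exp (u * \<tau>)) 0)) (circlepath 0 R)"
    by (rule Cauchy_has_contour_integral_higher_derivative_circlepath) (use R in \<open>auto intro!: continuous_intros holomorphic_intros\<close>)
  moreover have "deriv (\<lambda>u. exp (u * \<tau>)) 0 = \<tau>"
    by (rule DERIV_imp_deriv) (auto intro!: derivative_eq_intros)
  ultimately have "((\<lambda>u. exp (u * \<tau>) / u\<^sup>2) has_contour_integral (2 * pi * \<i> * \<tau>)) (circlepath 0 R)"
    by (simp add: power2_eq_square)
  then have "((\<lambda>\<theta>. exp ((0 + R * cis \<theta>) * \<tau>) / (0 + R * cis \<theta>)\<^sup>2 * R * \<i> * cis \<theta>) has_integral (2 * pi * \<i> * \<tau>)) {0..2 * pi}"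
    unfolding circlepath_def by (subst (asm) has_contour_integral_part_circlepath_iff) auto
  moreover have "exp ((0 + R * cis \<theta>) * \<tau>) / (0 + R * cis \<theta>)\<^sup>2 * R * \<i> * cis \<theta> = \<i> * f \<theta>" for \<theta>
    using R by (simp add: f_def power2_eq_square)
  ultimately have "((\<lambda>\<theta>. \<i> * f \<theta>) has_integral (2 * pi * \<i> * \<tau>)) {0..2 * pi}" by (simp only:)
  from integral_unique[OF this, unfolded integral_mult_right] have "integral {0..2 * pi} f = 2 * pi * \<tau>"
    by simp
  moreover have "integral {- pi..2 * pi - pi} f = integral {0..2 * pi} f"
    by (rule integral_period_shift[OF cf]) (auto simp: f_def)
  ultimately show ?thesis by (simp add: f_def[abs_def])
qed

definition arc_kernel :: "real \<Rightarrow> real \<Rightarrow> real \<Rightarrow> complex" where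
  "arc_kernel R a \<tau> = (\<integral>\<theta>. indicator (right_arc R a) \<theta> *\<^sub>R (exp (of_real R * cis \<theta> * of_real \<tau>) / (of_real R * cis \<theta>)) \<partial>lborel)"

text \<open>For \<tau> \<le> 0 the integrand is small on the arc itself. For \<tau> > 0 it is small
  on the complementary arc, where Re z < a, and the full circle contributes 2 pi \<tau>. So up to
  O(1/R) this is 2 pi times the kernel of double integration.\<close>

lemma arc_kernel_approx:
  assumes R: "0 < R" and a: "0 < a"
  shows "norm (arc_kernel R a \<tau> - of_real (2 * pi) * of_real (max \<tau> 0)) \<le> 2 * pi * (exp (a * \<tau>) / R)"
proof -
  define f where "f \<theta> = exp (of_real R * cis \<theta> * of_real \<tau>) / (of_real R * cis \<theta>)" for \<theta>
  have nf: "norm (f \<theta>) = exp (R * cos \<theta> * \<tau>) / R" for \<theta>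
    using R by (simp add: f_def norm_divide norm_mult)
  have cf: "continuous_on UNIV f" unfolding f_def using R by (intro continuous_intros) auto
  have [measurable]: "f \<in> borel_measurable borel" by (rule borel_measurable_continuous_onI[OF cf])
  show ?thesis
  proof (cases "\<tau> \<le> 0")
    case True
    have "norm (\<integral>\<theta>. indicator (right_arc R a) \<theta> *\<^sub>R f \<theta> \<partial>lborel) \<le> 2 * pi * (exp (a * \<tau>) / R)"
    proof (rule bounded_arc_integral(2))
      fix \<theta>
      show "norm (indicator (right_arc R a) \<theta> *\<^sub>R f \<theta>) \<le> exp (a * \<tau>) / R * indicator {- pi..pi} \<theta>"
      proof (cases "\<theta> \<in> right_arc R a")
        case T: True
        then have "R * cos \<theta> * \<tau> \<le> a * \<tau>" using True by (intro mult_right_mono_neg) (auto simp: right_arc_def)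
        then have "exp (R * cos \<theta> * \<tau>) / R \<le> exp (a * \<tau>) / R" using R by (intro divide_right_mono) auto
        then show ?thesis using T by (simp add: nf) (simp add: right_arc_def)
      qed (use R in simp)
    qed measurable
    then show ?thesis using True by (simp add: arc_kernel_def f_def)
  next
    case False
    have si: "set_integrable lborel {- pi..pi} f"
      by (rule borel_integrable_atLeastAtMost') (rule continuous_on_subset[OF cf], simp)
    have full: "(\<integral>\<theta>. indicator {- pi..pi} \<theta> *\<^sub>R f \<theta> \<partial>lborel) = 2 * pi * of_real \<tau>"
      using set_borel_integral_eq_integral(2)[OF si] circle_integral_exp[OF R, of "of_real \<tau>"]
      by (simp add: set_lebesgue_integral_def f_def[abs_def])
    have bd: "norm (indicator ({- pi..pi} - right_arc R a) \<theta> *\<^sub>R f \<theta>) \<le> exp (a * \<tau>) / R * indicator {- pi..pi} \<theta>" for \<theta>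
    proof (cases "\<theta> \<in> {- pi..pi} - right_arc R a")
      case T: True
      then have "R * cos \<theta> * \<tau> \<le> a * \<tau>" using False by (intro mult_right_mono) (auto simp: right_arc_def)
      then have "exp (R * cos \<theta> * \<tau>) / R \<le> exp (a * \<tau>) / R" using R by (intro divide_right_mono) auto
      then show ?thesis using T by (simp add: nf)
    qed (use R in simp)
    have mb: "(\<lambda>\<theta>. indicator ({- pi..pi} - right_arc R a) \<theta> *\<^sub>R f \<theta>) \<in> borel_measurable borel" by measurable
    note b = bounded_arc_integral[OF mb bd]
    have "indicator (right_arc R a) \<theta> *\<^sub>R f \<theta> = indicator {- pi..pi} \<theta> *\<^sub>R f \<theta> - indicator ({- pi..pi} - right_arc R a) \<theta> *\<^sub>R f \<theta>" for \<theta>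
      by (auto simp: right_arc_def indicator_def)
    then have "arc_kernel R a \<tau> = (\<integral>\<theta>. indicator {- pi..pi} \<theta> *\<^sub>R f \<theta> - indicator ({- pi..pi} - right_arc R a) \<theta> *\<^sub>R f \<theta> \<partial>lborel)"
      unfolding arc_kernel_def f_def[symmetric] by (simp only:)
    also have "\<dots> = 2 * pi * of_real \<tau> - (\<integral>\<theta>. indicator ({- pi..pi} - right_arc R a) \<theta> *\<^sub>R f \<theta> \<partial>lborel)"
      unfolding full[symmetric]
        by (rule Bochner_Integration.integral_diff[OF si[unfolded set_integrable_def] b(1)])
    finally show ?thesis using b(2) False by simp
  qed
qed

text \<open>At a positive real the complex derivative is also the derivative along the reals, where
  f agrees with g. Applied twice, this recovers \<open>Z\<close> from its double integral.\<close>

lemma holomorphic_real_deriv: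
  assumes f: "f holomorphic_on \<Theta>" and \<Theta>: "open \<Theta>" "\<And>t. 0 < t \<Longrightarrow> of_real t \<in> \<Theta>"
    and eq: "\<And>t. 0 < t \<Longrightarrow> f (of_real t) = g t"
    and g: "\<And>t. 0 < t \<Longrightarrow> (g has_vector_derivative g' t) (at t)" and t: "0 < t"
  shows "deriv f (of_real t) = g' t"
proof -
  have "(f has_field_derivative deriv f (of_real t)) (at (of_real t))"
    using f \<Theta> t by (intro holomorphic_derivI) auto
  then have "((\<lambda>x. f (of_real x)) has_vector_derivative deriv f (of_real t)) (at t)"
    by (rule has_vector_derivative_real_field)
  then have "(g has_vector_derivative deriv f (of_real t)) (at t)"
    by (rule has_vector_derivative_transform_within_open[of _ _ _ "{0<..}"]) (use t eq in auto)
  then show ?thesis using g[OF t] by (rule vector_derivative_unique_at)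
qed

locale laplace_inversion = sectorial_decay +
  fixes Z :: "real \<Rightarrow> complex" and a M :: real
  assumes Z_cont: "continuous_on {0..} Z"
    and Z_bound: "\<And>t. 0 \<le> t \<Longrightarrow> norm (Z t) \<le> M * exp (a * t)"
    and a_pos: "0 < a"
    and laplace: "\<And>z. a < Re z \<Longrightarrow> (LINT t:{0..}|lborel. exp (- (z * of_real t)) * Z t) = F z"
begin

lemma M_nonneg: "0 \<le> M"
  using order_trans[OF norm_ge_zero Z_bound[of 0]] by simp

abbreviation "Z0 \<equiv> (\<lambda>s. indicator {0..} s *\<^sub>R Z s)"

lemma Z0_measurable [measurable]: "Z0 \<in> borel_measurable borel"
  using Z_cont by (intro borel_measurable_continuous_on_indicator) auto

lemma Z0_bound: "norm (Z0 s) \<le> M * (indicator {0..} s *\<^sub>R exp (a * s))"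
  using Z_bound[of s] by (auto simp: indicator_def)

lemma weight_integral:
  "integrable lborel (\<lambda>s. indicator {0..} s *\<^sub>R exp (- s :: real))" "(\<integral>s. indicator {0..} s *\<^sub>R exp (- s :: real) \<partial>lborel) = 1"
proof -
  have si: "set_integrable lborel {0..} (\<lambda>s. exp (- (1 * s) :: real))" by (rule set_integrable_exp_minus) simp
  then show "integrable lborel (\<lambda>s. indicator {0..} s *\<^sub>R exp (- s :: real))"
    by (simp add: set_integrable_def)
  have "integral {0..} (\<lambda>s. exp (- (1 * s) :: real)) = 1"
    using has_integral_exp_minus_to_infinity[of 1 0] by (auto dest: integral_unique)
  then show "(\<integral>s. indicator {0..} s *\<^sub>R exp (- s :: real) \<partial>lborel) = 1"
    using set_borel_integral_eq_integral(2)[OF si] by (simp add: set_lebesgue_integral_def)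
qed

text \<open>The twice iterated integral of \<open>Z\<close> from 0, by Cauchy's formula for repeated
  integration.\<close>

definition Z_double_integral :: "real \<Rightarrow> complex" where
  "Z_double_integral t = integral {0..t} (\<lambda>s. of_real (t - s) * Z s)"

lemma Z_double_integral_lebesgue:
  assumes t: "0 \<le> t"
  shows "Z_double_integral t = (\<integral>s. of_real (max (t - s) 0) * Z0 s \<partial>lborel)"
    and "integrable lborel (\<lambda>s. of_real (max (t - s) 0) * Z0 s)"
proof -
  have si: "set_integrable lborel {0..t} (\<lambda>s. of_real (t - s) * Z s)"
    by (intro borel_integrable_atLeastAtMost' continuous_intros continuous_on_subset[OF Z_cont]) auto
  have eq: "indicator {0..t} s *\<^sub>R (of_real (t - s) * Z s) = of_real (max (t - s) 0) * Z0 s" for s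
    by (auto simp: indicator_def max_def)
  show "Z_double_integral t = (\<integral>s. of_real (max (t - s) 0) * Z0 s \<partial>lborel)"
    using set_borel_integral_eq_integral(2)[OF si] unfolding set_lebesgue_integral_def eq
      by (simp add: Z_double_integral_def)
  show "integrable lborel (\<lambda>s. of_real (max (t - s) 0) * Z0 s)"
    using si unfolding set_integrable_def eq .
qed

lemma Z_double_integral_deriv:
  assumes t: "0 < t"
  shows "(Z_double_integral has_vector_derivative integral {0..t} Z) (at t)"
    and "((\<lambda>t. integral {0..t} Z) has_vector_derivative Z t) (at t)"
proof -
  have c: "continuous_on {0..t + 1} Z" by (rule continuous_on_subset[OF Z_cont]) auto
  have c2: "continuous_on {0..t + 1} (\<lambda>s. of_real s * Z s)" by (intro continuous_intros c)
  have at: "at t within {0..t + 1} = at t" using t by (intro at_within_interior) auto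
  have d1: "((\<lambda>u. integral {0..u} Z) has_vector_derivative Z t) (at t)"
    using integral_has_vector_derivative[OF c, of t] t at by auto
  have d2: "((\<lambda>u. integral {0..u} (\<lambda>s. of_real s * Z s)) has_vector_derivative of_real t * Z t) (at t)"
    using integral_has_vector_derivative[OF c2, of t] t at by auto
  \<comment> \<open>The variable t also occurs in the integrand. Separating it leaves ordinary
    integrals with a variable end point, and the two boundary terms t Z t cancel.\<close>
  have "((\<lambda>u. of_real u * integral {0..u} Z - integral {0..u} (\<lambda>s. of_real s * Z s)) has_vector_derivative
      (of_real t * Z t + 1 * integral {0..t} Z - of_real t * Z t)) (at t)"
    by (intro has_vector_derivative_diff has_vector_derivative_mult d1 d2)
      (auto intro!: derivative_eq_intros simp: has_vector_derivative_of_real)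
  moreover have "of_real u * integral {0..u} Z - integral {0..u} (\<lambda>s. of_real s * Z s) = Z_double_integral u"
    if "u \<in> {0<..}" for u
  proof -
    have cu: "continuous_on {0..u} Z" by (rule continuous_on_subset[OF Z_cont]) auto
    have "Z_double_integral u = integral {0..u} (\<lambda>s. of_real u * Z s - of_real s * Z s)"
      unfolding Z_double_integral_def by (simp add: left_diff_distrib)
    also have "\<dots> = integral {0..u} (\<lambda>s. of_real u * Z s) - integral {0..u} (\<lambda>s. of_real s * Z s)"
      by (intro Henstock_Kurzweil_Integration.integral_diff integrable_continuous_real continuous_intros cu)
    finally show ?thesis by (simp add: integral_mult_right)
  qed
  ultimately show "(Z_double_integral has_vector_derivative integral {0..t} Z) (at t)"
    using has_vector_derivative_transform_within_open[of _ "of_real t * Z t + 1 * integral {0..t} Z - of_real t * Z t" t "{0<..}" Z_double_integral] t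
    by simp
  show "((\<lambda>t. integral {0..t} Z) has_vector_derivative Z t) (at t)" by (rule d1)
qed

lemma right_arc_fubini:
  assumes R: "0 < R"
  shows "(\<integral>\<theta>. indicator (right_arc R (a + 1)) \<theta> *\<^sub>R (exp (of_real R * cis \<theta> * of_real t) * F (of_real R * cis \<theta>) / (of_real R * cis \<theta>)) \<partial>lborel)
     = (\<integral>s. arc_kernel R (a + 1) (t - s) * Z0 s \<partial>lborel)"
    and "integrable lborel (\<lambda>s. arc_kernel R (a + 1) (t - s) * Z0 s)"
proof -
  define S where "S = right_arc R (a + 1)"
  define k
    where "k \<theta> s = (indicator S \<theta> *\<^sub>R (exp (of_real R * cis \<theta> * of_real (t - s)) / (of_real R * cis \<theta>))) * Z0 s" for \<theta> s
  have [measurable]: "S \<in> sets borel" by (simp add: S_def)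
  have [measurable]: "cis \<in> borel_measurable borel"
    by (intro borel_measurable_continuous_onI continuous_intros)
  have km: "case_prod k \<in> borel_measurable (lborel \<Otimes>\<^sub>M lborel)"
    unfolding k_def case_prod_beta by measurable
  define B where "B = exp (R * \<bar>t\<bar>) / R * M"
  have B: "0 \<le> B" using R M_nonneg by (simp add: B_def)
  \<comment> \<open>On the arc Re z \<ge> a + 1, so exp(- z s) against |Z s| \<le> M exp(a s) leaves
    exp(- s). This integrable majorant is the reason for cutting the arc at a + 1.\<close>
  have kb: "norm (k \<theta> s) \<le> (B * indicator {- pi..pi} \<theta>) * (indicator {0..} s *\<^sub>R exp (- s))" for \<theta> s
  proof (cases "\<theta> \<in> S \<and> 0 \<le> s")
    case True
    then have th: "\<theta> \<in> {- pi..pi}" "a + 1 \<le> R * cos \<theta>" by (auto simp: S_def right_arc_def)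
    have "norm (k \<theta> s) = exp (R * cos \<theta> * (t - s)) / R * norm (Z s)"
      using True R by (simp add: k_def norm_mult norm_divide)
    also have "\<dots> \<le> (exp (R * \<bar>t\<bar>) * exp (- (a + 1) * s)) / R * (M * exp (a * s))"
    proof (intro mult_mono divide_right_mono)
      have "cos \<theta> * t \<le> \<bar>cos \<theta> * t\<bar>" by simp
      also have "\<dots> \<le> 1 * \<bar>t\<bar>" unfolding abs_mult by (intro mult_right_mono) auto
      finally have "R * (cos \<theta> * t) \<le> R * \<bar>t\<bar>" using R by (simp add: mult_left_mono)
      moreover have "(a + 1) * s \<le> R * cos \<theta> * s" using th True by (intro mult_right_mono) auto
      ultimately have "R * cos \<theta> * (t - s) \<le> R * \<bar>t\<bar> + - (a + 1) * s" by (simp add: algebra_simps)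
      then show "exp (R * cos \<theta> * (t - s)) \<le> exp (R * \<bar>t\<bar>) * exp (- (a + 1) * s)" by (simp flip: exp_add)
    qed (use True R Z_bound in auto)
    also have "\<dots> = B * (exp (- (a + 1) * s) * exp (a * s))" by (simp add: B_def)
    also have "exp (- (a + 1) * s) * exp (a * s) = exp (- s)"
      by (simp flip: exp_add) (simp add: algebra_simps)
    finally show ?thesis using th True by simp
  next
    case False
    then have "k \<theta> s = 0" by (auto simp: k_def)
    then show ?thesis using B by (simp add: indicator_def)
  qed
  define m :: "real \<Rightarrow> real \<Rightarrow> real"
    where "m \<theta> s = (B * indicator {- pi..pi} \<theta>) * (indicator {0..} s *\<^sub>R exp (- s))" for \<theta> s
  have mm: "case_prod m \<in> borel_measurable (lborel \<Otimes>\<^sub>M lborel)"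
    unfolding m_def case_prod_beta by measurable
  have mnn: "0 \<le> m \<theta> s" for \<theta> s using B by (simp add: m_def)
  have mint: "integrable lborel (m \<theta>)" for \<theta>
    unfolding m_def[abs_def] by (rule integrable_mult_right[OF weight_integral(1)])
  have mval: "(\<integral>s. m \<theta> s \<partial>lborel) = B * indicator {- pi..pi} \<theta>" for \<theta>
    unfolding m_def integral_mult_right_zero weight_integral(2) by simp
  have maj: "integrable (lborel \<Otimes>\<^sub>M lborel) (case_prod m)"
  proof (rule lborel_pair.Fubini_integrable[OF mm])
    show "integrable lborel (\<lambda>\<theta>. \<integral>s. norm (case_prod m (\<theta>, s)) \<partial>lborel)"
      using mnn by (simp add: mval)
    show "AE \<theta> in lborel. integrable lborel (\<lambda>s. case_prod m (\<theta>, s))" using mint by simp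
  qed
  have ki: "integrable (lborel \<Otimes>\<^sub>M lborel) (case_prod k)"
  proof (rule Bochner_Integration.integrable_bound[OF maj km], intro AE_I2)
    fix p :: "real \<times> real"
    show "norm (case_prod k p) \<le> norm (case_prod m p)"
      using order_trans[OF kb[of "fst p" "snd p", folded m_def] abs_ge_self]
        by (simp only: case_prod_beta real_norm_def)
  qed
  have inner1: "(\<integral>\<theta>. k \<theta> s \<partial>lborel) = arc_kernel R (a + 1) (t - s) * Z0 s" for s
    unfolding k_def arc_kernel_def S_def by (rule integral_mult_left_zero)
  have inner2: "(\<integral>s. k \<theta> s \<partial>lborel) = indicator S \<theta> *\<^sub>R (exp (of_real R * cis \<theta> * of_real t) * F (of_real R * cis \<theta>) / (of_real R * cis \<theta>))" for \<theta>
  proof (cases "\<theta> \<in> S")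
    case True
    define z where "z = of_real R * cis \<theta>"
    have "a < Re z" using True by (simp add: S_def right_arc_def z_def)
    then have F: "F z = (\<integral>s. indicator {0..} s *\<^sub>R (exp (- (z * of_real s)) * Z s) \<partial>lborel)"
      using laplace by (simp add: set_lebesgue_integral_def)
    have "k \<theta> s = (exp (z * of_real t) / z) * (indicator {0..} s *\<^sub>R (exp (- (z * of_real s)) * Z s))" for s
    proof -
      have "exp (z * of_real (t - s)) = exp (z * of_real t) * exp (- (z * of_real s))"
      proof -
        have "z * of_real (t - s) = z * of_real t + - (z * of_real s)" by (simp add: algebra_simps)
        then show ?thesis by (simp only: exp_add)
      qed
      then show ?thesis using True by (simp add: k_def z_def[symmetric])
    qed
    then have "(\<integral>s. k \<theta> s \<partial>lborel) = (exp (z * of_real t) / z) * F z"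
      unfolding F by (simp only: integral_mult_right_zero)
    then show ?thesis using True by (simp add: z_def)
  qed (simp add: k_def)
  show "(\<integral>\<theta>. indicator (right_arc R (a + 1)) \<theta> *\<^sub>R (exp (of_real R * cis \<theta> * of_real t) * F (of_real R * cis \<theta>) / (of_real R * cis \<theta>)) \<partial>lborel)
     = (\<integral>s. arc_kernel R (a + 1) (t - s) * Z0 s \<partial>lborel)"
    using lborel_pair.Fubini_integral[OF ki] unfolding inner1 inner2 S_def by simp
  show "integrable lborel (\<lambda>s. arc_kernel R (a + 1) (t - s) * Z0 s)"
    using lborel_pair.integrable_snd[OF ki] unfolding inner1 .
qed

text \<open>The kernel error, of size exp((a+1)(t-s)) / R, is integrated against |Z s| \<le> M exp(a
  s); the exponents combine to exp((a+1) t) exp(- s), and exp(- s) has integral 1.\<close>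

lemma right_arc_approx:
  assumes R: "0 < R" and t: "0 \<le> t"
  shows "norm ((\<integral>\<theta>. indicator (right_arc R (a + 1)) \<theta> *\<^sub>R (exp (of_real R * cis \<theta> * of_real t) * F (of_real R * cis \<theta>) / (of_real R * cis \<theta>)) \<partial>lborel)
     - of_real (2 * pi) * Z_double_integral t) \<le> 2 * pi * M * exp ((a + 1) * t) / R"
proof -
  note U = Z_double_integral_lebesgue[OF t]
  define C where "C = 2 * pi * M * exp ((a + 1) * t) / R"
  have eq: "(\<integral>s. arc_kernel R (a + 1) (t - s) * Z0 s \<partial>lborel) - of_real (2 * pi) * Z_double_integral t
      = (\<integral>s. arc_kernel R (a + 1) (t - s) * Z0 s - of_real (2 * pi) * (of_real (max (t - s) 0) * Z0 s) \<partial>lborel)"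
    unfolding U(1) using right_arc_fubini(2)[OF R] U(2)
    by (subst Bochner_Integration.integral_diff) (auto simp only: integral_mult_right_zero integrable_mult_right)
  have le: "norm (\<integral>s. arc_kernel R (a + 1) (t - s) * Z0 s - of_real (2 * pi) * (of_real (max (t - s) 0) * Z0 s) \<partial>lborel)
     \<le> (\<integral>s. C * (indicator {0..} s *\<^sub>R exp (- s)) \<partial>lborel)"
  proof (rule Bochner_Integration.integral_norm_bound_integral)
    show "integrable lborel (\<lambda>s. arc_kernel R (a + 1) (t - s) * Z0 s - of_real (2 * pi) * (of_real (max (t - s) 0) * Z0 s))"
      by (intro Bochner_Integration.integrable_diff right_arc_fubini(2)[OF R] integrable_mult_right U(2))
    show "integrable lborel (\<lambda>s. C * (indicator {0..} s *\<^sub>R exp (- s)))"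
      by (intro integrable_mult_right weight_integral(1))
    fix s
    have "norm (arc_kernel R (a + 1) (t - s) * Z0 s - of_real (2 * pi) * (of_real (max (t - s) 0) * Z0 s))
        = norm (arc_kernel R (a + 1) (t - s) - of_real (2 * pi) * of_real (max (t - s) 0)) * norm (Z0 s)"
      by (simp only: norm_mult[symmetric] left_diff_distrib mult.assoc)
    also have "\<dots> \<le> (2 * pi * (exp ((a + 1) * (t - s)) / R)) * (M * (indicator {0..} s *\<^sub>R exp (a * s)))"
      by (intro mult_mono arc_kernel_approx Z0_bound) (use R a_pos in auto)
    also have "\<dots> = 2 * pi * M / R * (indicator {0..} s *\<^sub>R (exp ((a + 1) * (t - s)) * exp (a * s)))" by simp
    also have "exp ((a + 1) * (t - s)) * exp (a * s) = exp ((a + 1) * t) * exp (- s)"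
      by (simp flip: exp_add) (simp add: algebra_simps)
    also have "2 * pi * M / R * (indicator {0..} s *\<^sub>R (exp ((a + 1) * t) * exp (- s))) = C * (indicator {0..} s *\<^sub>R exp (- s))"
      by (simp add: C_def)
    finally show "norm (arc_kernel R (a + 1) (t - s) * Z0 s - of_real (2 * pi) * (of_real (max (t - s) 0) * Z0 s)) \<le> C * (indicator {0..} s *\<^sub>R exp (- s))" .
  qed
  have "(\<integral>s. C * (indicator {0..} s *\<^sub>R exp (- s)) \<partial>lborel) = C"
    unfolding integral_mult_right_zero weight_integral(2) by simp
  with le show ?thesis unfolding right_arc_fubini(1)[OF R] eq C_def[symmetric] by (simp only:)
qed

text \<open>Once R sin \<eta> \<ge> a + 1, the points of the bent arc outside the right arc all lie
  in the vertical sectors. There |F| < 1 and Re z < a + 1, and the weight 1/z makes this part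
  O(1/R).\<close>

lemma bent_arc_approx:
  assumes t: "0 \<le> t" and R: "R0 < R" "(a + 1) / sin \<eta> \<le> R"
  shows "norm (bent_arc R (of_real t) - Z_double_integral t) \<le> (1 + M) * exp ((a + 1) * t) / R"
proof -
  have R': "0 < R" using R R0 by simp
  define S where "S = right_arc R (a + 1)"
  have [measurable]: "S \<in> sets borel" by (simp add: S_def)
  define f where "f \<theta> = exp (of_real R * cis \<theta> * of_real t) * F (of_real R * cis \<theta>) / (of_real R * cis \<theta>)"
    for \<theta>
  have cF: "continuous_on {- \<phi>..\<phi>} (\<lambda>\<theta>. F (of_real R * cis \<theta>))"
    by (rule continuous_on_circle[OF arc_analytic]) (use R in auto)
  have cf: "continuous_on {- \<phi>..\<phi>} f" unfolding f_def by (intro continuous_intros cF) (use R' in auto)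
  have si: "set_integrable lborel {- \<phi>..\<phi>} f" by (rule borel_integrable_atLeastAtMost'[OF cf])
  have Ssub: "S \<subseteq> {- \<phi>..\<phi>}"
  proof
    fix \<theta> assume "\<theta> \<in> S"
    then have th: "- pi \<le> \<theta>" "\<theta> \<le> pi" "0 < R * cos \<theta>" using a_pos by (auto simp: S_def right_arc_def)
    then have "0 < cos \<theta>" using R' by (simp add: zero_less_mult_iff)
    have "\<bar>\<theta>\<bar> \<le> pi / 2"
    proof (rule ccontr)
      assume "\<not> \<bar>\<theta>\<bar> \<le> pi / 2"
      then have "cos \<bar>\<theta>\<bar> \<le> cos (pi / 2)" using th by (intro cos_monotone_0_pi_le) auto
      then show False using \<open>0 < cos \<theta>\<close> by simp
    qed
    then show "\<theta> \<in> {- \<phi>..\<phi>}" using \<eta>(1) by (auto simp: abs_le_iff)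
  qed
  define I1 I2 where "I1 = (\<integral>\<theta>. indicator S \<theta> *\<^sub>R f \<theta> \<partial>lborel)"
    and "I2 = (\<integral>\<theta>. indicator ({- \<phi>..\<phi>} - S) \<theta> *\<^sub>R f \<theta> \<partial>lborel)"
  have b1: "bent_arc R (of_real t) = 1 / (2 * pi) * (\<integral>\<theta>. indicator {- \<phi>..\<phi>} \<theta> *\<^sub>R f \<theta> \<partial>lborel)"
    using set_borel_integral_eq_integral(2)[OF si]
      by (simp add: bent_arc_def set_lebesgue_integral_def f_def[abs_def])
  have b2: "(\<integral>\<theta>. indicator {- \<phi>..\<phi>} \<theta> *\<^sub>R f \<theta> \<partial>lborel) = (\<integral>\<theta>. indicator S \<theta> *\<^sub>R f \<theta> \<partial>lborel) + (\<integral>\<theta>. indicator ({- \<phi>..\<phi>} - S) \<theta> *\<^sub>R f \<theta> \<partial>lborel)"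
  proof -
    have "set_integrable lborel S f" "set_integrable lborel ({- \<phi>..\<phi>} - S) f"
      by (rule set_integrable_subset[OF si]; use Ssub in auto)+
    moreover have "indicator {- \<phi>..\<phi>} \<theta> *\<^sub>R f \<theta> = indicator S \<theta> *\<^sub>R f \<theta> + indicator ({- \<phi>..\<phi>} - S) \<theta> *\<^sub>R f \<theta>"
      for \<theta>
      using Ssub by (auto simp: indicator_def)
    ultimately show ?thesis unfolding set_integrable_def by (simp only: Bochner_Integration.integral_add)
  qed
  have b3: "norm (\<integral>\<theta>. indicator ({- \<phi>..\<phi>} - S) \<theta> *\<^sub>R f \<theta> \<partial>lborel) \<le> 2 * pi * (exp ((a + 1) * t) / R)"
  proof (rule bounded_arc_integral(2))
    have "set_borel_measurable lborel ({- \<phi>..\<phi>} - S) f"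
      using set_integrable_subset[OF si, of "{- \<phi>..\<phi>} - S"]
        by (auto simp: set_integrable_def set_borel_measurable_def)
    then show "(\<lambda>\<theta>. indicator ({- \<phi>..\<phi>} - S) \<theta> *\<^sub>R f \<theta>) \<in> borel_measurable borel"
      by (simp add: set_borel_measurable_def)
    fix \<theta>
    show "norm (indicator ({- \<phi>..\<phi>} - S) \<theta> *\<^sub>R f \<theta>) \<le> exp ((a + 1) * t) / R * indicator {- pi..pi} \<theta>"
    proof (cases "\<theta> \<in> {- \<phi>..\<phi>} - S")
      case True
      have pi: "\<bar>\<theta>\<bar> \<le> \<phi>" "\<bar>\<theta>\<bar> \<le> pi" using True \<eta>(3) pi_gt_zero by (auto simp: abs_le_iff)
      then have less: "R * cos \<theta> < a + 1" using True by (auto simp: S_def right_arc_def abs_le_iff)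
      also have "a + 1 \<le> R * sin \<eta>" using R(2) sin_\<eta>_pos by (simp add: field_simps)
      finally have cs: "cos \<theta> < sin \<eta>" using R' by simp
      have "pi / 2 - \<eta> \<le> \<bar>\<theta>\<bar>"
      proof (rule ccontr)
        assume "\<not> ?thesis"
        then have "cos (pi / 2 - \<eta>) \<le> cos \<bar>\<theta>\<bar>" using \<eta> pi_gt_zero by (intro cos_monotone_0_pi_le) auto
        then show False using cs by (simp add: cos_diff)
      qed
      then have "of_real R * cis \<theta> \<in> vertical_sectors \<delta>"
        by (rule polar_mem_vertical_sectors[OF R']) (use pi \<eta> in auto)
      then have "norm (F (of_real R * cis \<theta>)) \<le> 1" using R0(2)[of "of_real R * cis \<theta>"] R R'
        by (simp add: norm_mult)
      moreover have "norm (exp (of_real R * cis \<theta> * of_real t)) \<le> exp ((a + 1) * t)"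
        using less t by (simp add: mult_right_mono)
      ultimately have "norm (exp (of_real R * cis \<theta> * of_real t)) * norm (F (of_real R * cis \<theta>)) \<le> exp ((a + 1) * t) * 1"
        by (intro mult_mono) auto
      then have "norm (f \<theta>) \<le> exp ((a + 1) * t) / R" using R' unfolding f_def norm_divide norm_mult
        by (simp add: divide_right_mono)
      then show ?thesis using True pi by (simp add: abs_le_iff)
    qed (use R' in simp)
  qed
  have b4: "norm ((\<integral>\<theta>. indicator S \<theta> *\<^sub>R f \<theta> \<partial>lborel) - of_real (2 * pi) * Z_double_integral t) \<le> 2 * pi * M * exp ((a + 1) * t) / R"
    using right_arc_approx[OF R' t] by (simp add: S_def f_def)
  note I = b1[unfolded b2, folded I1_def I2_def] b3[folded I2_def] b4[folded I1_def]
  have "bent_arc R (of_real t) - Z_double_integral t = ((I1 - of_real (2 * pi) * Z_double_integral t) + I2) / (2 * pi)"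
    unfolding I(1) by (simp add: field_simps)
  then have "norm (bent_arc R (of_real t) - Z_double_integral t) = norm ((I1 - of_real (2 * pi) * Z_double_integral t) + I2) / (2 * pi)"
    by (simp only: norm_divide) (simp add: norm_mult)
  also have "\<dots> \<le> (2 * pi * M * exp ((a + 1) * t) / R + 2 * pi * (exp ((a + 1) * t) / R)) / (2 * pi)"
    by (intro divide_right_mono norm_triangle_mono I) auto
  also have "\<dots> = (1 + M) * exp ((a + 1) * t) / R" by (simp add: add_divide_distrib ring_distribs)
  finally show ?thesis .
qed

lemma bent_limit_of_real:
  assumes t: "0 < t" shows "bent_limit (of_real t) = Z_double_integral t"
proof -
  have "((\<lambda>R. bent_arc R (of_real t)) \<longlongrightarrow> bent_limit (of_real t)) at_top"
    using uniform_limit_bent \<Theta>_props(3)[OF t] by (rule tendsto_uniform_limitI)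
  moreover have "((\<lambda>R. bent_arc R (of_real t) - Z_double_integral t) \<longlongrightarrow> 0) at_top"
  proof (rule Lim_null_comparison)
    show "\<forall>\<^sub>F R in at_top. norm (bent_arc R (of_real t) - Z_double_integral t) \<le> (1 + M) * exp ((a + 1) * t) / R"
      using eventually_gt_at_top[of R0] eventually_ge_at_top[of "(a + 1) / sin \<eta>"]
      by eventually_elim (rule bent_arc_approx, use t in auto)
    show "((\<lambda>R. (1 + M) * exp ((a + 1) * t) / R) \<longlongrightarrow> 0) at_top"
      by (rule tendsto_divide_0[OF tendsto_const]) (rule filterlim_at_top_imp_at_infinity[OF filterlim_ident])
  qed
  then have "((\<lambda>R. bent_arc R (of_real t)) \<longlongrightarrow> Z_double_integral t) at_top" by (simp add: LIM_zero_iff)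
  ultimately show ?thesis by (rule tendsto_unique[OF trivial_limit_at_top_linorder])
qed

lemma deriv2_bent_limit:
  assumes t: "0 < t" shows "(deriv ^^ 2) bent_limit (of_real t) = Z t"
proof -
  have 1: "deriv bent_limit (of_real t) = integral {0..t} Z" if "0 < t" for t
    by (rule holomorphic_real_deriv[OF bent_limit_holomorphic \<Theta>_props(1,3) bent_limit_of_real Z_double_integral_deriv(1) that])
  have "deriv (deriv bent_limit) (of_real t) = Z t"
    by (rule holomorphic_real_deriv[OF holomorphic_deriv[OF bent_limit_holomorphic \<Theta>_props(1)] \<Theta>_props(1,3) 1 Z_double_integral_deriv(2) t])
  then show ?thesis by (simp add: numeral_2_eq_2)
qed

lemma bent_arc2_tendsto_Z: "0 < t \<Longrightarrow> ((\<lambda>R. bent_arc2 R (of_real t)) \<longlongrightarrow> Z t) at_top"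
  using bent_arc2_tendsto[OF \<Theta>_props(3), of t] deriv2_bent_limit[of t] by simp

text \<open>The second derivative of \<open>bent_limit\<close> extends \<open>Z\<close>
  holomorphically from t > 0 to the connected set \<Theta>, so the identity theorem applies. This
  leads from large times back to all times in the proof that resonances exist.\<close>

lemma Z_zero_if_eventually_zero:
  assumes z: "\<And>t. t0 < t \<Longrightarrow> Z t = 0" and t: "0 < t"
  shows "Z t = 0"
proof -
  define f where "f = (deriv ^^ 2) bent_limit"
  have hol: "f holomorphic_on \<Theta>" unfolding f_def
    by (intro holomorphic_higher_deriv bent_limit_holomorphic \<Theta>_props)
  define c where "c = max t0 0 + 1"
  have c: "0 < c" "t0 < c" by (auto simp: c_def)
  have "f (of_real t) = 0"
  proof (rule analytic_continuation[OF hol \<Theta>_props(1) convex_connected[OF \<Theta>_props(2)], where U = "complex_of_real ` {c..}" and \<xi> = "of_real c"])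
    show "complex_of_real ` {c..} \<subseteq> \<Theta>" using \<Theta>_props(3) c by auto
    show "of_real c \<in> \<Theta>" "of_real t \<in> \<Theta>" using \<Theta>_props(3) t c by auto
    show "of_real c islimpt complex_of_real ` {c..}"
      unfolding islimpt_approachable
    proof (intro allI impI)
      fix e :: real assume e: "0 < e"
      have "of_real (c + e / 2) \<in> complex_of_real ` {c..}" using e by (intro imageI) simp
      moreover have "of_real (c + e / 2) \<noteq> complex_of_real c" using e unfolding of_real_eq_iff by simp
      moreover have "dist (of_real (c + e / 2)) (complex_of_real c) < e" using e unfolding dist_of_real
        by (simp add: dist_real_def)
      ultimately show "\<exists>x'\<in>complex_of_real ` {c..}. x' \<noteq> of_real c \<and> dist x' (of_real c) < e" by blast
    qed
    show "f w = 0" if "w \<in> complex_of_real ` {c..}" for w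
      using that z deriv2_bent_limit c by (auto simp: f_def)
  qed
  then show ?thesis using deriv2_bent_limit[OF t] by (simp add: f_def)
qed

end

section \<open>Expansion over residues\<close>

text \<open>With F = g / (z - \<alpha>)^(k+1) the residue is the k-th derivative of exp(z t) g(z) at
  \<alpha> over k!, and Leibniz' rule collects the powers of t in front of exp(\<alpha> t).\<close>

lemma residue_exp_at_pole:
  assumes hol: "F holomorphic_on U - {\<alpha>}" and U: "open U" "\<alpha> \<in> U" and pole: "is_pole F \<alpha>"
  shows "\<exists>p. \<forall>t. residue (\<lambda>z. exp (z * t) * F z) \<alpha> = poly p t * exp (\<alpha> * t)"
proof -
  define n g where "n = zorder F \<alpha>" and "g = zor_poly F \<alpha>"
  obtain r where n: "n < 0"
    and r: "0 < r" "g holomorphic_on cball \<alpha> r" "\<And>w. w \<in> cball \<alpha> r - {\<alpha>} \<Longrightarrow> F w = g w / (w - \<alpha>) ^ nat (- n)"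
    using zorder_exist_pole[OF hol U pole] unfolding n_def g_def by metis
  define k where "k = nat (- n) - 1"
  have k: "nat (- n) = Suc k" using n by (simp add: k_def)
  have g: "g holomorphic_on ball \<alpha> r" using r(2) holomorphic_on_subset ball_subset_cball by metis
  define p where "p = (\<Sum>i=0..k. monom (of_nat (k choose i) * (deriv ^^ (k - i)) g \<alpha> / fact k) i)"
  have "residue (\<lambda>z. exp (z * t) * F z) \<alpha> = poly p t * exp (\<alpha> * t)" for t
  proof -
    have he: "(\<lambda>z. exp (z * t)) holomorphic_on ball \<alpha> r" by (intro holomorphic_intros)
    have de: "(deriv ^^ i) (\<lambda>z. exp (z * t)) = (\<lambda>z. t ^ i * exp (z * t))" for i
    proof (induction i)
      case (Suc i)
      have "deriv (\<lambda>z. t ^ i * exp (z * t)) = (\<lambda>z. t ^ Suc i * exp (z * t))"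
        by (rule ext, rule DERIV_imp_deriv) (auto intro!: derivative_eq_intros)
      then show ?case using Suc by simp
    qed simp
    have "residue (\<lambda>z. exp (z * t) * F z) \<alpha> = residue (\<lambda>z. exp (z * t) * g z / (z - \<alpha>) ^ Suc k) \<alpha>"
    proof (rule residue_cong)
      have "\<forall>\<^sub>F z in at \<alpha>. z \<in> cball \<alpha> r - {\<alpha>}"
        using eventually_at_in_open[of "ball \<alpha> r" \<alpha>] r(1) by (auto elim!: eventually_mono)
      then show "\<forall>\<^sub>F z in at \<alpha>. exp (z * t) * F z = exp (z * t) * g z / (z - \<alpha>) ^ Suc k"
        by eventually_elim (simp add: r(3) k del: power_Suc)
    qed simp
    also have "\<dots> = (deriv ^^ k) (\<lambda>z. exp (z * t) * g z) \<alpha> / fact k"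
      by (rule residue_holomorphic_over_power[of "ball \<alpha> r"]) (use r(1) in \<open>auto intro!: holomorphic_intros he g\<close>)
    also have "(deriv ^^ k) (\<lambda>z. exp (z * t) * g z) \<alpha> = (\<Sum>i=0..k. of_nat (k choose i) * (deriv ^^ i) (\<lambda>z. exp (z * t)) \<alpha> * (deriv ^^ (k - i)) g \<alpha>)"
      by (rule higher_deriv_mult[OF he g]) (use r(1) in auto)
    also have "\<dots> / fact k = poly p t * exp (\<alpha> * t)"
      unfolding p_def de poly_sum sum_divide_distrib sum_distrib_right
      by (intro sum.cong refl) (simp add: poly_monom field_simps)
    finally show ?thesis .
  qed
  then show ?thesis by blast
qed

text \<open>The radii spoiled by \<alpha> lie in an interval of length 2 \<rho> \<alpha>; in total
  this is at most 2 S, too little to fill an interval of length 2 S + 1.\<close>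

lemma exists_avoiding_radius:
  fixes A :: "complex set" and \<rho> :: "complex \<Rightarrow> real"
  assumes A: "finite A" and pos: "\<And>\<alpha>. \<alpha> \<in> A \<Longrightarrow> 0 \<le> \<rho> \<alpha>" and S: "sum \<rho> A \<le> S"
  shows "\<exists>r\<in>{X..X + 2 * S + 1}. \<forall>\<alpha>\<in>A. \<rho> \<alpha> \<le> \<bar>norm \<alpha> - r\<bar>"
proof (rule ccontr)
  assume neg: "\<not> ?thesis"
  have S0: "0 \<le> S" using order_trans[OF sum_nonneg S] pos by blast
  have sub: "{X..X + 2 * S + 1} \<subseteq> (\<Union>\<alpha>\<in>A. {norm \<alpha> - \<rho> \<alpha>..norm \<alpha> + \<rho> \<alpha>})"
  proof
    fix r assume "r \<in> {X..X + 2 * S + 1}"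
    then have "\<not> (\<forall>\<alpha>\<in>A. \<rho> \<alpha> \<le> \<bar>norm \<alpha> - r\<bar>)" using neg by blast
    then obtain \<alpha> where "\<alpha> \<in> A" "\<bar>norm \<alpha> - r\<bar> < \<rho> \<alpha>" by (auto simp: not_le)
    then show "r \<in> (\<Union>\<alpha>\<in>A. {norm \<alpha> - \<rho> \<alpha>..norm \<alpha> + \<rho> \<alpha>})" by (intro UN_I[of \<alpha>]) auto
  qed
  have "ennreal (2 * S + 1) = emeasure lborel {X..X + 2 * S + 1}" using S0 by simp
  also have "\<dots> \<le> emeasure lborel (\<Union>\<alpha>\<in>A. {norm \<alpha> - \<rho> \<alpha>..norm \<alpha> + \<rho> \<alpha>})"
    by (rule emeasure_mono[OF sub]) (use A in \<open>auto intro!: sets.finite_UN\<close>)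
  also have "\<dots> \<le> (\<Sum>\<alpha>\<in>A. emeasure lborel {norm \<alpha> - \<rho> \<alpha>..norm \<alpha> + \<rho> \<alpha>})"
    by (rule emeasure_subadditive_finite) (use A in auto)
  also have "\<dots> = (\<Sum>\<alpha>\<in>A. ennreal (2 * \<rho> \<alpha>))" by (intro sum.cong refl) (use pos in simp)
  also have "\<dots> = ennreal (\<Sum>\<alpha>\<in>A. 2 * \<rho> \<alpha>)" by (rule sum_ennreal) (use pos in simp)
  finally have "2 * S + 1 \<le> (\<Sum>\<alpha>\<in>A. 2 * \<rho> \<alpha>)" using pos by (simp add: sum_nonneg)
  then show False using S by (simp flip: sum_distrib_left)
qed

text \<open>The set \<open>R\<close> is only required to contain the poles of \<open>F\<close>: a
  root of the denominator of \<open>F1\<close> may be cancelled by the numerator, and such a point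
  contributes a zero term.\<close>

locale resonance_expansion = laplace_inversion +
  fixes D \<beta> :: real and R :: "complex set"
  assumes D: "0 < D" and \<beta>: "0 < \<beta>"
    and growth: "exp_bounded_off_poles F (left_sector \<delta>) D \<beta>"
    and R_left: "\<And>z. z \<in> R \<Longrightarrow> Re z < 0"
    and poles: "\<And>z. is_pole F z \<Longrightarrow> z \<in> R"
    and R_finite: "\<And>r. finite (R \<inter> cball 0 r)"
begin

definition P where "P = {z. is_pole F z}"

lemma P_R: "P \<subseteq> R" using poles by (auto simp: P_def)

lemma P_left: "\<alpha> \<in> P \<Longrightarrow> Re \<alpha> < 0" using P_R R_left by auto

lemma finite_P: "finite (P \<inter> cball 0 r)"
  by (rule finite_subset[OF _ R_finite[of r]]) (use P_R in auto)

lemma finite_P_ball: "finite (P \<inter> ball 0 r)"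
  by (rule finite_subset[OF _ finite_P[of r]]) auto

lemma F_analytic: "z \<notin> P \<Longrightarrow> F analytic_on {z}"
  using analytic_nonpole by (simp add: P_def)

lemma F_holomorphic: "U \<inter> P = {} \<Longrightarrow> F holomorphic_on U"
  using F_analytic by (intro analytic_imp_holomorphic) (subst analytic_on_analytic_at, auto)

lemma punctured_neighbourhood:
  assumes r: "cball \<alpha> r \<inter> P \<subseteq> {\<alpha>}" "0 \<le> r"
  obtains U where "open U" "cball \<alpha> r \<subseteq> U" "U \<inter> P \<subseteq> {\<alpha>}"
proof
  define B where "B = P \<inter> ball 0 (norm \<alpha> + r + 1) - {\<alpha>}"
  show "open (ball 0 (norm \<alpha> + r + 1) - B)"
    unfolding B_def by (intro open_Diff open_ball finite_imp_closed finite_Diff finite_P_ball)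
  show "cball \<alpha> r \<subseteq> ball 0 (norm \<alpha> + r + 1) - B"
  proof
    fix z assume z: "z \<in> cball \<alpha> r"
    have "norm z \<le> norm \<alpha> + norm (z - \<alpha>)" by (rule norm_triangle_sub)
    then have "z \<in> ball 0 (norm \<alpha> + r + 1)" using z by (simp add: dist_norm norm_minus_commute)
    then show "z \<in> ball 0 (norm \<alpha> + r + 1) - B" using z r(1) by (auto simp: B_def)
  qed
qed (auto)

text \<open>The factor r comes from the length of the circle. It makes the residues summable when
  the radii are.\<close>

lemma residue_bound:
  assumes r: "cball \<alpha> r \<inter> P \<subseteq> {\<alpha>}" "0 < r"
    and B: "0 \<le> B" "\<And>z. norm (z - \<alpha>) = r \<Longrightarrow> norm (exp (z * t) * F z) \<le> B"
  shows "norm (residue (\<lambda>z. exp (z * t) * F z) \<alpha>) \<le> B * r"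
proof -
  obtain U where U: "open U" "cball \<alpha> r \<subseteq> U" "U \<inter> P \<subseteq> {\<alpha>}" using punctured_neighbourhood[OF r(1)] r(2)
    by (metis less_imp_le)
  have "(\<lambda>z. exp (z * t) * F z) holomorphic_on U - {\<alpha>}"
    by (intro holomorphic_intros F_holomorphic) (use U in auto)
  then have "((\<lambda>z. exp (z * t) * F z) has_contour_integral 2 * pi * \<i> * residue (\<lambda>z. exp (z * t) * F z) \<alpha>) (circlepath \<alpha> r)"
    by (intro base_residue[OF U(1)]) (use U r in auto)
  from has_contour_integral_bound_circlepath[OF this B(1) r(2) B(2)]
  have "norm (2 * pi * \<i> * residue (\<lambda>z. exp (z * t) * F z) \<alpha>) \<le> B * (2 * pi * r)" by simp
  then have "2 * pi * norm (residue (\<lambda>z. exp (z * t) * F z) \<alpha>) \<le> 2 * pi * (B * r)"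
    by (simp add: norm_mult mult_ac)
  then show ?thesis by (simp add: mult_le_cancel_left_pos)
qed

definition term_at :: "complex \<Rightarrow> real \<Rightarrow> complex" where
  "term_at \<alpha> t = residue (\<lambda>z. exp (z * of_real t) * F z) \<alpha>"

lemma term_at_polynomial: "\<exists>p. \<forall>t. term_at \<alpha> t = poly p (of_real t) * exp (\<alpha> * of_real t)"
proof (cases "\<alpha> \<in> P")
  case True
  have "finite (cball \<alpha> 1 \<inter> P)"
  proof (rule finite_subset[OF _ finite_P[of "norm \<alpha> + 1"]])
    show "cball \<alpha> 1 \<inter> P \<subseteq> P \<inter> cball 0 (norm \<alpha> + 1)"
    proof
      fix z assume "z \<in> cball \<alpha> 1 \<inter> P"
      then show "z \<in> P \<inter> cball 0 (norm \<alpha> + 1)" using norm_triangle_sub[of z \<alpha>]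
        by (simp add: dist_norm norm_minus_commute)
    qed
  qed
  define U where "U = ball \<alpha> 1 - (cball \<alpha> 1 \<inter> P - {\<alpha>})"
  have "open U" unfolding U_def using \<open>finite (cball \<alpha> 1 \<inter> P)\<close>
    by (intro open_Diff open_ball finite_imp_closed finite_Diff)
  moreover have "F holomorphic_on U - {\<alpha>}" by (rule F_holomorphic) (auto simp: U_def)
  moreover have "\<alpha> \<in> U" by (simp add: U_def)
  ultimately obtain p where "\<forall>t. residue (\<lambda>z. exp (z * t) * F z) \<alpha> = poly p t * exp (\<alpha> * t)"
    using residue_exp_at_pole[of F U \<alpha>] True by (auto simp: P_def)
  then show ?thesis unfolding term_at_def by blast
next
  case False
  obtain U where "open U" "\<alpha> \<in> U" "F holomorphic_on U" using F_analytic[OF False] by (auto simp: analytic_at)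
  then have "term_at \<alpha> t = 0" for t unfolding term_at_def
    by (intro residue_holo[of U]) (auto intro!: holomorphic_intros)
  then show ?thesis by (intro exI[of _ 0]) simp
qed

lemma term_at_nonpole: "\<alpha> \<notin> P \<Longrightarrow> term_at \<alpha> t = 0"
proof -
  assume "\<alpha> \<notin> P"
  then obtain U where "open U" "\<alpha> \<in> U" "F holomorphic_on U" using F_analytic[of \<alpha>] by (auto simp: analytic_at)
  then show "term_at \<alpha> t = 0" unfolding term_at_def
    by (intro residue_holo[of U]) (auto intro!: holomorphic_intros)
qed

lemma term_at_decay:
  assumes "\<alpha> \<in> P" shows "\<exists>C\<ge>0. \<exists>\<gamma>>0. \<forall>t\<ge>0. norm (term_at \<alpha> t) \<le> C * exp (- \<gamma> * t)"
proof -
  \<comment> \<open>Half the distance of \<alpha> from the imaginary axis: on a circle of radius at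
    most \<gamma> about \<alpha> one has Re z \<le> - \<gamma>.\<close>
  define \<gamma> where "\<gamma> = - Re \<alpha> / 2"
  have \<gamma>: "0 < \<gamma>" using P_left[OF assms] by (simp add: \<gamma>_def)
  have "finite (P \<inter> cball 0 (norm \<alpha> + 1))" by (rule finite_P)
  from finite_set_avoid[OF this, of \<alpha>] obtain d
    where d: "0 < d" "\<And>x. x \<in> P \<inter> cball 0 (norm \<alpha> + 1) \<Longrightarrow> x \<noteq> \<alpha> \<Longrightarrow> d \<le> dist \<alpha> x" by blast
  define r where "r = min (min (d / 2) \<gamma>) 1"
  have r: "0 < r" "r < d" "r \<le> \<gamma>" "r \<le> 1" using d \<gamma> by (auto simp: r_def)
  have only: "cball \<alpha> r \<inter> P \<subseteq> {\<alpha>}"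
  proof
    fix z assume z: "z \<in> cball \<alpha> r \<inter> P"
    then have "norm z \<le> norm \<alpha> + 1" using norm_triangle_sub[of z \<alpha>] r
      by (simp add: dist_norm norm_minus_commute)
    then show "z \<in> {\<alpha>}" using d(2)[of z] z r by (cases "z = \<alpha>") auto
  qed
  have "F holomorphic_on sphere \<alpha> r" by (rule F_holomorphic) (use only r in auto)
  then have "compact (F ` sphere \<alpha> r)"
    by (intro compact_continuous_image holomorphic_on_imp_continuous_on) auto
  then obtain B where B: "0 < B" "\<And>z. z \<in> sphere \<alpha> r \<Longrightarrow> norm (F z) \<le> B"
    using compact_imp_bounded bounded_pos by (metis imageI)
  have "norm (term_at \<alpha> t) \<le> (B * r) * exp (- \<gamma> * t)" if t: "0 \<le> t" for t
  proof -
    have "norm (term_at \<alpha> t) \<le> (exp (- \<gamma> * t) * B) * r"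
      unfolding term_at_def
    proof (rule residue_bound[OF only r(1)])
      fix z assume z: "norm (z - \<alpha>) = r"
      have "Re z \<le> Re \<alpha> + r" using abs_Re_le_cmod[of "z - \<alpha>"] z by simp
      then have "Re z \<le> - \<gamma>" using r(3) by (simp add: \<gamma>_def)
      then have "Re z * t \<le> - \<gamma> * t" using t by (rule mult_right_mono)
      then have "norm (exp (z * of_real t)) \<le> exp (- \<gamma> * t)" by simp
      moreover have "norm (F z) \<le> B" using B(2)[of z] z by (simp add: dist_norm norm_minus_commute)
      ultimately show "norm (exp (z * of_real t) * F z) \<le> exp (- \<gamma> * t) * B" unfolding norm_mult
        by (intro mult_mono) auto
    qed (use B in simp)
    then show ?thesis by (simp add: mult_ac)
  qed
  moreover have "0 \<le> B * r" using B r by simp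
  ultimately show ?thesis using \<gamma> by blast
qed

lemma finite_terms_decay:
  assumes "finite A" "A \<subseteq> P"
  shows "\<exists>C\<ge>0. \<exists>\<gamma>>0. \<forall>t\<ge>0. (\<Sum>\<alpha>\<in>A. norm (term_at \<alpha> t)) \<le> C * exp (- \<gamma> * t)"
  using assms
proof (induction A rule: finite_induct)
  case empty
  then show ?case by (intro exI[of _ 0] conjI exI[of _ 1]) auto
next
  case (insert x A)
  then obtain C \<gamma> where C: "0 \<le> C" "0 < \<gamma>" "\<And>t. 0 \<le> t \<Longrightarrow> (\<Sum>\<alpha>\<in>A. norm (term_at \<alpha> t)) \<le> C * exp (- \<gamma> * t)"
    by auto
  obtain C' \<gamma>' where C': "0 \<le> C'" "0 < \<gamma>'" "\<And>t. 0 \<le> t \<Longrightarrow> norm (term_at x t) \<le> C' * exp (- \<gamma>' * t)"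
    using term_at_decay[of x] insert by auto
  define g where "g = min \<gamma> \<gamma>'"
  have "(\<Sum>\<alpha>\<in>insert x A. norm (term_at \<alpha> t)) \<le> (C + C') * exp (- g * t)" if t: "0 \<le> t" for t
  proof -
    have "C * exp (- \<gamma> * t) \<le> C * exp (- g * t)" "C' * exp (- \<gamma>' * t) \<le> C' * exp (- g * t)"
      using t C C' by (auto simp: g_def intro!: mult_left_mono mult_right_mono)
    then show ?thesis using C(3)[OF t] C'(3)[OF t] insert(1,2) by (simp add: ring_distribs)
  qed
  then show ?case using C C' by (intro exI[of _ "C + C'"] conjI exI[of _ g]) (auto simp: g_def)
qed

section \<open>Distant poles and their exceptional discs\<close>

abbreviation "\<sigma> \<equiv> sin \<eta>"

text \<open>At least 1, so that one bound covers both the left sector and the vertical sectors,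
  where |F| < 1.\<close>

definition D1 where "D1 = max 1 D"

definition PL where "PL = {\<alpha>\<in>left_sector \<delta>. is_pole F \<alpha>}"

definition \<rho> :: "complex \<Rightarrow> real" where
  "\<rho> = (SOME \<rho>. (\<forall>\<alpha>\<in>PL. 0 < \<rho> \<alpha>) \<and> disjoint_family_on (\<lambda>\<alpha>. ball \<alpha> (\<rho> \<alpha>)) PL \<and> \<rho> summable_on PL \<and>
     (\<forall>z\<in>left_sector \<delta> - (\<Union>\<alpha>\<in>PL. ball \<alpha> (\<rho> \<alpha>)). norm (F z) \<le> D * exp (\<beta> * norm z)))"

lemma \<rho>: "\<And>\<alpha>. \<alpha> \<in> PL \<Longrightarrow> 0 < \<rho> \<alpha>" "disjoint_family_on (\<lambda>\<alpha>. ball \<alpha> (\<rho> \<alpha>)) PL" "\<rho> summable_on PL"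
  "\<And>z. z \<in> left_sector \<delta> \<Longrightarrow> z \<notin> (\<Union>\<alpha>\<in>PL. ball \<alpha> (\<rho> \<alpha>)) \<Longrightarrow> norm (F z) \<le> D * exp (\<beta> * norm z)"
proof -
  have "(\<forall>\<alpha>\<in>PL. 0 < \<rho> \<alpha>) \<and> disjoint_family_on (\<lambda>\<alpha>. ball \<alpha> (\<rho> \<alpha>)) PL \<and> \<rho> summable_on PL \<and>
     (\<forall>z\<in>left_sector \<delta> - (\<Union>\<alpha>\<in>PL. ball \<alpha> (\<rho> \<alpha>)). norm (F z) \<le> D * exp (\<beta> * norm z))"
    unfolding \<rho>_def by (rule someI_ex[OF growth[unfolded exp_bounded_off_poles_def, folded PL_def]])
  then show "\<And>\<alpha>. \<alpha> \<in> PL \<Longrightarrow> 0 < \<rho> \<alpha>" "disjoint_family_on (\<lambda>\<alpha>. ball \<alpha> (\<rho> \<alpha>)) PL" "\<rho> summable_on PL"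
    "\<And>z. z \<in> left_sector \<delta> \<Longrightarrow> z \<notin> (\<Union>\<alpha>\<in>PL. ball \<alpha> (\<rho> \<alpha>)) \<Longrightarrow> norm (F z) \<le> D * exp (\<beta> * norm z)" by auto
qed

definition S where "S = infsum \<rho> PL"

lemma \<rho>_sum_le: "finite A \<Longrightarrow> A \<subseteq> PL \<Longrightarrow> sum \<rho> A \<le> S"
  unfolding S_def by (rule finite_sum_le_infsum[OF \<rho>(3)]) (use \<rho>(1) in \<open>auto intro: less_imp_le\<close>)

lemma \<rho>_le: "\<alpha> \<in> PL \<Longrightarrow> \<rho> \<alpha> \<le> S"
  using \<rho>_sum_le[of "{\<alpha>}"] by simp

lemma S_nonneg: "0 \<le> S"
  using \<rho>_sum_le[of "{}"] by simp

lemma F_growth: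
  assumes z: "Re z \<le> 0" "R0 \<le> norm z" "z \<notin> (\<Union>\<alpha>\<in>PL. ball \<alpha> (\<rho> \<alpha>))"
  shows "norm (F z) \<le> D1 * exp (\<beta> * norm z)"
proof -
  have z0: "z \<noteq> 0" using z(2) R0(1) by auto
  have e: "1 \<le> exp (\<beta> * norm z)" using \<beta> by simp
  show ?thesis
  proof (cases "z \<in> vertical_sectors \<delta>")
    case True
    then have "norm (F z) \<le> 1 * 1" using R0(2) z(2) by (simp add: less_imp_le)
    also have "\<dots> \<le> D1 * exp (\<beta> * norm z)" using e by (intro mult_mono) (auto simp: D1_def)
    finally show ?thesis .
  next
    case False
    then have "z \<in> left_sector \<delta>" using left_half_plane_sectors[OF z(1) z0 \<delta>] by blast
    then have "norm (F z) \<le> D * exp (\<beta> * norm z)" using \<rho>(4) z(3) by blast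
    also have "\<dots> \<le> D1 * exp (\<beta> * norm z)" by (intro mult_right_mono) (auto simp: D1_def)
    finally show ?thesis .
  qed
qed

lemma far_pole:
  assumes \<alpha>: "\<alpha> \<in> P" "R0 \<le> norm \<alpha>"
  shows "\<alpha> \<in> PL" "Re \<alpha> \<le> - \<sigma> * norm \<alpha>"
proof -
  have "\<alpha> \<noteq> 0" using \<alpha>(2) R0(1) by auto
  moreover have "\<alpha> \<notin> vertical_sectors \<delta>" using no_pole_vertical[of \<alpha>] \<alpha> by (auto simp: P_def)
  ultimately have *: "\<alpha> \<in> left_sector \<delta> \<and> pi / 2 + \<delta> < Arg2pi \<alpha> \<and> Arg2pi \<alpha> < 3 * pi / 2 - \<delta>"
    using left_half_plane_sectors[of \<alpha> \<delta>] P_left[OF \<alpha>(1)] \<delta> by auto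
  then show "\<alpha> \<in> PL" using \<alpha>(1) by (simp add: PL_def P_def)
  have "cos (Arg2pi \<alpha>) \<le> - \<sigma>" by (rule cos_le_minus_sin) (use * \<eta> pi_gt_zero in auto)
  then have "norm \<alpha> * cos (Arg2pi \<alpha>) \<le> norm \<alpha> * - \<sigma>" by (rule mult_left_mono) simp
  then show "Re \<alpha> \<le> - \<sigma> * norm \<alpha>" by (simp add: cos_Arg2pi mult.commute)
qed

text \<open>For a pole of modulus at least \<open>R1\<close> the disc, of radius at most S, stays
  outside the radius \<open>R0\<close>, and on it Re z \<le> - \<sigma> |\<alpha>| + S \<le> -
  1.\<close>

definition R1 where "R1 = R0 + S + (S + 1) / \<sigma>"

lemma R1: "R0 + S < R1" "S + 1 \<le> \<sigma> * x" if "R1 \<le> x" for x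
proof -
  have p: "0 < (S + 1) / \<sigma>" using S_nonneg sin_\<eta>_pos by simp
  then show "R0 + S < R1" by (simp add: R1_def)
  have "(S + 1) / \<sigma> \<le> x" using that R0(1) S_nonneg by (simp add: R1_def)
  then show "S + 1 \<le> \<sigma> * x" using sin_\<eta>_pos by (simp add: field_simps)
qed

text \<open>An open ball that is disjoint from another one is also disjoint from its closure. Hence
  the circle bounding an exceptional disc meets none of the open discs, and the growth bound holds
  on it.\<close>

lemma sphere_avoids:
  assumes \<alpha>: "\<alpha> \<in> PL" and w: "w \<in> cball \<alpha> (\<rho> \<alpha>)" "\<gamma> \<in> PL" "\<gamma> \<noteq> \<alpha>"
  shows "w \<notin> ball \<gamma> (\<rho> \<gamma>)"
proof
  assume w': "w \<in> ball \<gamma> (\<rho> \<gamma>)"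
  have "w \<in> closure (ball \<alpha> (\<rho> \<alpha>))" using w(1) \<rho>(1)[OF \<alpha>] by (simp add: closure_ball)
  then have "ball \<gamma> (\<rho> \<gamma>) \<inter> ball \<alpha> (\<rho> \<alpha>) \<noteq> {}"
    using w' open_Int_closure_eq_empty[OF open_ball, of \<gamma> "\<rho> \<gamma>" "ball \<alpha> (\<rho> \<alpha>)"] by blast
  then show False using \<rho>(2) \<alpha> w(2,3) unfolding disjoint_family_on_def by blast
qed

text \<open>On the circle of radius \<rho> \<alpha> the time t1 suffices to beat exp(\<beta> |z|) up
  to the constant exp((t1 + \<beta>) S), and the remaining time t - t1 gives decay at rate 1 because
  Re z \<le> - 1 there.\<close>

lemma far_term_bound:
  assumes \<alpha>: "\<alpha> \<in> P" "R1 \<le> norm \<alpha>" and t: "t1 \<le> t" and t1: "\<beta> \<le> \<sigma> * t1"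
  shows "norm (term_at \<alpha> t) \<le> D1 * exp ((t1 + \<beta>) * S) * exp (- (t - t1)) * \<rho> \<alpha>"
proof -
  have R0\<alpha>: "R0 + S < norm \<alpha>" using R1(1)[OF \<alpha>(2)] \<alpha>(2) by simp
  have \<alpha>L: "\<alpha> \<in> PL" and Re\<alpha>: "Re \<alpha> \<le> - \<sigma> * norm \<alpha>" using far_pole[OF \<alpha>(1)] R0\<alpha> S_nonneg by auto
  have r: "0 < \<rho> \<alpha>" "\<rho> \<alpha> \<le> S" using \<rho>(1) \<rho>_le \<alpha>L by auto
  have tpos: "0 \<le> t1"
  proof (rule ccontr)
    assume "\<not> 0 \<le> t1"
    then have "\<sigma> * t1 < 0" using sin_\<eta>_pos by (simp add: mult_pos_neg)
    then show False using t1 \<beta> by simp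
  qed
  have near: "R0 \<le> norm z" "Re z \<le> - \<sigma> * norm \<alpha> + S" "norm z \<le> norm \<alpha> + S" if z: "z \<in> cball \<alpha> (\<rho> \<alpha>)" for z
  proof -
    have zz: "norm (z - \<alpha>) \<le> S" using z r by (simp add: dist_norm norm_minus_commute)
    show "norm z \<le> norm \<alpha> + S" using norm_triangle_sub[of z \<alpha>] zz by simp
    show "R0 \<le> norm z" using norm_triangle_sub[of \<alpha> z] zz R0\<alpha> by (simp add: norm_minus_commute)
    show "Re z \<le> - \<sigma> * norm \<alpha> + S" using abs_Re_le_cmod[of "z - \<alpha>"] zz Re\<alpha> by simp
  qed
  have only: "cball \<alpha> (\<rho> \<alpha>) \<inter> P \<subseteq> {\<alpha>}"
  proof
    fix z assume z: "z \<in> cball \<alpha> (\<rho> \<alpha>) \<inter> P"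
    then have zL: "z \<in> PL" using far_pole(1)[of z] near(1)[of z] by auto
    then have "z \<in> ball z (\<rho> z)" using \<rho>(1) by simp
    then show "z \<in> {\<alpha>}" using sphere_avoids[OF \<alpha>L, of z z] z zL by blast
  qed
  have "norm (term_at \<alpha> t) \<le> (D1 * exp ((t1 + \<beta>) * S) * exp (- (t - t1))) * \<rho> \<alpha>"
    unfolding term_at_def
  proof (rule residue_bound[OF only r(1)])
    show "0 \<le> D1 * exp ((t1 + \<beta>) * S) * exp (- (t - t1))" by (simp add: D1_def)
    fix z assume z: "norm (z - \<alpha>) = \<rho> \<alpha>"
    then have zc: "z \<in> cball \<alpha> (\<rho> \<alpha>)" by (simp add: dist_norm norm_minus_commute)
    note nz = near[OF zc]
    have m1: "- \<sigma> * norm \<alpha> + S \<le> - 1" using R1(2)[OF \<alpha>(2)] by simp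
    have "z \<notin> ball \<gamma> (\<rho> \<gamma>)" if "\<gamma> \<in> PL" for \<gamma>
      using sphere_avoids[OF \<alpha>L zc that] z by (cases "\<gamma> = \<alpha>") (auto simp: dist_norm norm_minus_commute)
    then have Fz: "norm (F z) \<le> D1 * exp (\<beta> * norm z)" using nz m1 by (intro F_growth) auto
    have "Re z * t \<le> (- \<sigma> * norm \<alpha> + S) * t" using nz(2) t tpos by (intro mult_right_mono) auto
    also have "\<dots> = (- \<sigma> * norm \<alpha> + S) * (t - t1) + (- \<sigma> * norm \<alpha> + S) * t1" by (simp add: algebra_simps)
    also have "\<dots> \<le> (- 1) * (t - t1) + (- \<sigma> * norm \<alpha> + S) * t1" using m1 t
      by (intro add_right_mono mult_right_mono) auto
    finally have "Re z * t \<le> - (t - t1) + (- \<sigma> * norm \<alpha> + S) * t1" by simp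
    moreover have "\<beta> * norm z \<le> \<beta> * (norm \<alpha> + S)" using nz(3) \<beta> by (intro mult_left_mono) auto
    moreover have "\<beta> * norm \<alpha> \<le> (\<sigma> * t1) * norm \<alpha>" using t1 by (rule mult_right_mono) simp
    ultimately have "Re z * t + \<beta> * norm z \<le> (t1 + \<beta>) * S + - (t - t1)" by (simp add: algebra_simps)
    then have ex: "exp (Re z * t) * exp (\<beta> * norm z) \<le> exp ((t1 + \<beta>) * S) * exp (- (t - t1))"
      by (simp flip: exp_add)
    have "norm (exp (z * of_real t) * F z) \<le> exp (Re z * t) * (D1 * exp (\<beta> * norm z))"
      unfolding norm_mult using Fz by (intro mult_mono) auto
    also have "\<dots> = D1 * (exp (Re z * t) * exp (\<beta> * norm z))" by simp
    also have "\<dots> \<le> D1 * (exp ((t1 + \<beta>) * S) * exp (- (t - t1)))" using ex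
      by (rule mult_left_mono) (simp add: D1_def)
    finally show "norm (exp (z * of_real t) * F z) \<le> D1 * exp ((t1 + \<beta>) * S) * exp (- (t - t1))"
      by (simp add: mult.assoc)
  qed
  then show ?thesis .
qed

lemma far_poles_subset: "P - cball 0 R1 \<subseteq> PL"
proof
  fix \<alpha> assume "\<alpha> \<in> P - cball 0 R1"
  then show "\<alpha> \<in> PL" using far_pole(1)[of \<alpha>] R1(1)[of "norm \<alpha>"] S_nonneg by auto
qed

lemma \<rho>_summable_far: "\<rho> summable_on (P - cball 0 R1)"
  by (rule summable_on_subset_banach[OF \<rho>(3) far_poles_subset])

lemma far_terms_summable:
  assumes "t1 \<le> t" "\<beta> \<le> \<sigma> * t1"
  shows "(\<lambda>\<alpha>. norm (term_at \<alpha> t)) summable_on (P - cball 0 R1)"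
    and "infsum (\<lambda>\<alpha>. norm (term_at \<alpha> t)) (P - cball 0 R1) \<le> D1 * exp ((t1 + \<beta>) * S) * exp (- (t - t1)) * S"
proof -
  define C where "C = D1 * exp ((t1 + \<beta>) * S) * exp (- (t - t1))"
  have C: "0 \<le> C" by (simp add: C_def D1_def)
  have b: "norm (term_at \<alpha> t) \<le> C * \<rho> \<alpha>" if "\<alpha> \<in> P - cball 0 R1" for \<alpha>
    unfolding C_def by (rule far_term_bound) (use that assms in auto)
  have s: "(\<lambda>\<alpha>. C * \<rho> \<alpha>) summable_on (P - cball 0 R1)" by (intro summable_on_cmult_right \<rho>_summable_far)
  show n: "(\<lambda>\<alpha>. norm (term_at \<alpha> t)) summable_on (P - cball 0 R1)"
    by (rule summable_on_comparison_test[OF s b]) auto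
  have "infsum (\<lambda>\<alpha>. norm (term_at \<alpha> t)) (P - cball 0 R1) \<le> infsum (\<lambda>\<alpha>. C * \<rho> \<alpha>) (P - cball 0 R1)"
    by (rule infsum_mono[OF n s b])
  also have "\<dots> = C * infsum \<rho> (P - cball 0 R1)" by (rule infsum_cmult_right')
  also have "\<dots> \<le> C * S" unfolding S_def
    by (intro mult_left_mono C infsum_mono2 \<rho>_summable_far \<rho>(3) far_poles_subset) (use \<rho>(1) in \<open>auto intro: less_imp_le\<close>)
  finally show "infsum (\<lambda>\<alpha>. norm (term_at \<alpha> t)) (P - cball 0 R1) \<le> D1 * exp ((t1 + \<beta>) * S) * exp (- (t - t1)) * S" by (simp add: C_def)
qed

lemma terms_abs_summable:
  assumes "\<beta> \<le> \<sigma> * t" shows "(\<lambda>\<alpha>. norm (term_at \<alpha> t)) summable_on P"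
proof -
  have "(\<lambda>\<alpha>. norm (term_at \<alpha> t)) summable_on ((P \<inter> cball 0 R1) \<union> (P - cball 0 R1))"
    by (rule summable_on_Un_disjoint[OF summable_on_finite[OF finite_P] far_terms_summable(1)[OF order.refl assms]]) auto
  moreover have "(P \<inter> cball 0 R1) \<union> (P - cball 0 R1) = P" by auto
  ultimately show ?thesis by simp
qed


section \<open>Closing the contour on circles of good radius\<close>

lemma exists_good_radius:
  assumes X: "R0 \<le> X"
  shows "\<exists>r\<ge>X. \<forall>z. norm z = r \<longrightarrow> z \<notin> (\<Union>\<alpha>\<in>PL. ball \<alpha> (\<rho> \<alpha>))"
proof -
  \<comment> \<open>The radius will be at most X + 2 S + 1, and every disc has radius at most S. So
    poles of modulus above X + 3 S + 1 cannot interfere, and only finitely many remain.\<close>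
  define A where "A = PL \<inter> cball 0 (X + 3 * S + 1)"
  have fA: "finite A"
    by (rule finite_subset[OF _ finite_P[of "X + 3 * S + 1"]]) (auto simp: A_def PL_def P_def)
  have "\<exists>r\<in>{X..X + 2 * S + 1}. \<forall>\<alpha>\<in>A. \<rho> \<alpha> \<le> \<bar>norm \<alpha> - r\<bar>"
    by (rule exists_avoiding_radius[OF fA]) (use \<rho>(1) \<rho>_sum_le[OF fA] in \<open>auto simp: A_def intro: less_imp_le\<close>)
  then obtain r where r: "X \<le> r" "r \<le> X + 2 * S + 1" "\<And>\<alpha>. \<alpha> \<in> A \<Longrightarrow> \<rho> \<alpha> \<le> \<bar>norm \<alpha> - r\<bar>" by auto
  have "\<rho> \<alpha> \<le> \<bar>norm \<alpha> - r\<bar>" if \<alpha>: "\<alpha> \<in> PL" for \<alpha>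
  proof (cases "\<alpha> \<in> A")
    case False
    then have "X + 3 * S + 1 < norm \<alpha>" using \<alpha> by (simp add: A_def)
    then show ?thesis using r(2) \<rho>_le[OF \<alpha>] by linarith
  qed (rule r(3))
  then have "z \<notin> ball \<alpha> (\<rho> \<alpha>)" if "norm z = r" "\<alpha> \<in> PL" for z \<alpha>
    using that norm_triangle_ineq3[of \<alpha> z] by (force simp: dist_norm)
  then show ?thesis using r(1) by blast
qed

lemma left_arc_point:
  assumes r: "R0 \<le> r" "0 < r" and good: "\<And>z. norm z = r \<Longrightarrow> z \<notin> (\<Union>\<alpha>\<in>PL. ball \<alpha> (\<rho> \<alpha>))"
    and \<theta>: "\<phi> \<le> \<theta>" "\<theta> \<le> 2 * pi - \<phi>" and t: "0 \<le> t"
  shows "norm (exp (of_real r * cis \<theta> * of_real t) * F (of_real r * cis \<theta>) * (of_real r * cis \<theta>)) \<le> D1 * r * exp (- ((\<sigma> * t - \<beta>) * r))"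
proof -
  define z where "z = of_real r * cis \<theta>"
  have nz: "norm z = r" using r by (simp add: z_def norm_mult)
  have "cos \<theta> \<le> - \<sigma>" by (rule cos_le_minus_sin) (use \<theta> \<eta> pi_gt_zero in auto)
  then have "r * cos \<theta> \<le> r * - \<sigma>" using r by (intro mult_left_mono) auto
  then have Re: "Re z \<le> - (\<sigma> * r)" by (simp add: z_def mult.commute)
  also have "\<dots> \<le> 0" using sin_\<eta>_pos r by simp
  finally have F: "norm (F z) \<le> D1 * exp (\<beta> * r)" using F_growth[of z] good nz r by simp
  have "norm (exp (z * of_real t) * F z * z) \<le> exp (- (\<sigma> * r) * t) * (D1 * exp (\<beta> * r)) * r"
    unfolding norm_mult nz using F mult_right_mono[OF Re t] r by (intro mult_mono) (auto simp: D1_def)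
  also have "\<dots> = D1 * r * (exp (- (\<sigma> * r) * t) * exp (\<beta> * r))" by simp
  also have "exp (- (\<sigma> * r) * t) * exp (\<beta> * r) = exp (- ((\<sigma> * t - \<beta>) * r))"
    by (simp flip: exp_add) (simp add: algebra_simps)
  finally show ?thesis by (simp add: z_def)
qed

lemma sphere_no_pole:
  assumes r: "R0 \<le> r" and good: "\<And>z. norm z = r \<Longrightarrow> z \<notin> (\<Union>\<alpha>\<in>PL. ball \<alpha> (\<rho> \<alpha>))" and z: "norm z = r"
  shows "z \<notin> P"
proof
  assume "z \<in> P"
  then have "z \<in> PL" using far_pole(1) r z by simp
  then have "z \<in> ball z (\<rho> z)" using \<rho>(1) by simp
  then show False using good[OF z] \<open>z \<in> PL\<close> by blast
qed

lemma residue_sum: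
  assumes r: "R0 \<le> r" "0 < r" and good: "\<And>z. norm z = r \<Longrightarrow> z \<notin> (\<Union>\<alpha>\<in>PL. ball \<alpha> (\<rho> \<alpha>))" and t: "0 \<le> t"
  shows "norm ((\<Sum>\<alpha>\<in>P \<inter> ball 0 r. term_at \<alpha> t) - bent_arc2 r (of_real t)) \<le> D1 * r * exp (- ((\<sigma> * t - \<beta>) * r))"
proof -
  define f where "f z = exp (z * of_real t) * F z" for z
  define h where "h \<theta> = exp (of_real r * cis \<theta> * of_real t) * F (of_real r * cis \<theta>) * (of_real r * cis \<theta>)"
    for \<theta>
  \<comment> \<open>A slightly larger disc, since the residue theorem needs an open set around the
    circle. The poles that it adds have winding number 0.\<close>
  define U where "U = ball (0::complex) (r + 1)"
  have sph: "z \<notin> P" if "norm z = r" for z using sphere_no_pole[OF r(1) good that] .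
  have fin: "finite (P \<inter> U)" unfolding U_def by (rule finite_P_ball)
  have "contour_integral (circlepath 0 r) f = 2 * pi * \<i> * (\<Sum>p\<in>P \<inter> U. winding_number (circlepath 0 r) p * residue f p)"
  proof (rule Residue_theorem)
    show "f holomorphic_on U - P \<inter> U" unfolding f_def by (intro holomorphic_intros F_holomorphic) auto
    show "path_image (circlepath 0 r) \<subseteq> U - P \<inter> U" using sph r by (auto simp: U_def)
    show "\<forall>z. z \<notin> U \<longrightarrow> winding_number (circlepath 0 r) z = 0"
    proof (intro allI impI)
      fix z :: complex assume "z \<notin> U"
      then show "winding_number (circlepath 0 r) z = 0"
        by (intro winding_number_zero_outside[of _ "cball 0 r"]) (use r in \<open>auto simp: U_def\<close>)
    qed
  qed (use fin in \<open>auto simp: U_def\<close>)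
  also have "(\<Sum>p\<in>P \<inter> U. winding_number (circlepath 0 r) p * residue f p) = (\<Sum>p\<in>P \<inter> ball 0 r. residue f p)"
  proof (rule sum.mono_neutral_cong_right[OF fin])
    show "P \<inter> ball 0 r \<subseteq> P \<inter> U" by (auto simp: U_def)
    show "\<forall>p\<in>P \<inter> U - P \<inter> ball 0 r. winding_number (circlepath 0 r) p * residue f p = 0"
    proof
      fix p assume p: "p \<in> P \<inter> U - P \<inter> ball 0 r"
      then have "r < norm p" using sph[of p] by (cases "norm p = r") auto
      then have "winding_number (circlepath 0 r) p = 0"
        by (intro winding_number_zero_outside[of _ "cball 0 r"]) (use r in auto)
      then show "winding_number (circlepath 0 r) p * residue f p = 0" by simp
    qed
    show "winding_number (circlepath 0 r) p * residue f p = residue f p" if "p \<in> P \<inter> ball 0 r" for p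
      using that winding_number_circlepath[of p 0 r] by simp
  qed
  also have "(\<Sum>p\<in>P \<inter> ball 0 r. residue f p) = (\<Sum>\<alpha>\<in>P \<inter> ball 0 r. term_at \<alpha> t)"
    by (simp add: term_at_def f_def[abs_def])
  finally have ci: "contour_integral (circlepath 0 r) f = 2 * pi * \<i> * (\<Sum>\<alpha>\<in>P \<inter> ball 0 r. term_at \<alpha> t)" .
  have "f contour_integrable_on circlepath 0 r"
  proof (rule contour_integrable_holomorphic_simple[of _ "U - P \<inter> U"])
    show "open (U - P \<inter> U)" using fin by (intro open_Diff finite_imp_closed) (auto simp: U_def)
    show "f holomorphic_on U - P \<inter> U" unfolding f_def by (intro holomorphic_intros F_holomorphic) auto
  qed (use sph r in \<open>auto simp: U_def\<close>)
  then have "(f has_contour_integral (2 * pi * \<i> * (\<Sum>\<alpha>\<in>P \<inter> ball 0 r. term_at \<alpha> t))) (circlepath 0 r)"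
    unfolding ci[symmetric] by (rule has_contour_integral_integral)
  then have "((\<lambda>\<theta>. f (0 + r * cis \<theta>) * r * \<i> * cis \<theta>) has_integral (2 * pi * \<i> * (\<Sum>\<alpha>\<in>P \<inter> ball 0 r. term_at \<alpha> t))) {0..2 * pi}"
    unfolding circlepath_def by (subst (asm) has_contour_integral_part_circlepath_iff) auto
  moreover have "f (0 + r * cis \<theta>) * r * \<i> * cis \<theta> = \<i> * h \<theta>" for \<theta> by (simp add: f_def h_def)
  ultimately have "((\<lambda>\<theta>. \<i> * h \<theta>) has_integral (2 * pi * \<i> * (\<Sum>\<alpha>\<in>P \<inter> ball 0 r. term_at \<alpha> t))) {0..2 * pi}"
    by (simp only:)
  from integral_unique[OF this, unfolded integral_mult_right]
  have full: "integral {0..2 * pi} h = 2 * pi * (\<Sum>\<alpha>\<in>P \<inter> ball 0 r. term_at \<alpha> t)" by simp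
  have cont: "continuous_on UNIV h" unfolding h_def
    by (intro continuous_intros continuous_on_circle F_analytic sph) (use r in \<open>simp add: norm_mult\<close>)
  have int: "h integrable_on {x..y}" for x y
    by (rule integrable_continuous_real) (rule continuous_on_subset[OF cont], simp)
  have ph: "0 \<le> \<phi>" "\<phi> \<le> pi" using \<eta> pi_gt_zero by auto
  \<comment> \<open>By periodicity the full circle may start at the angle - \<phi>, and so it splits
    into the bent arc and the arc on the left.\<close>
  have "integral {- \<phi>..2 * pi - \<phi>} h = integral {0..2 * pi} h"
    by (rule integral_period_shift[OF cont]) (use ph in \<open>auto simp: h_def\<close>)
  moreover have "integral {- \<phi>..\<phi>} h + integral {\<phi>..2 * pi - \<phi>} h = integral {- \<phi>..2 * pi - \<phi>} h"
    by (rule Henstock_Kurzweil_Integration.integral_combine) (use ph int in auto)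
  moreover have "bent_arc2 r (of_real t) = 1 / (2 * pi) * integral {- \<phi>..\<phi>} h"
    by (simp add: bent_arc2_def h_def[abs_def])
  ultimately have "(\<Sum>\<alpha>\<in>P \<inter> ball 0 r. term_at \<alpha> t) - bent_arc2 r (of_real t) = integral {\<phi>..2 * pi - \<phi>} h / (2 * pi)"
    using full by (simp add: field_simps)
  then have "norm ((\<Sum>\<alpha>\<in>P \<inter> ball 0 r. term_at \<alpha> t) - bent_arc2 r (of_real t)) = norm (integral {\<phi>..2 * pi - \<phi>} h) / (2 * pi)"
    by (simp only: norm_divide) (simp add: norm_mult)
  also have "\<dots> \<le> (D1 * r * exp (- ((\<sigma> * t - \<beta>) * r)) * (2 * pi - \<phi> - \<phi>)) / (2 * pi)"
  proof (intro divide_right_mono)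
    show "norm (integral {\<phi>..2 * pi - \<phi>} h) \<le> D1 * r * exp (- ((\<sigma> * t - \<beta>) * r)) * (2 * pi - \<phi> - \<phi>)"
    proof (rule integral_bound)
      show "continuous_on {\<phi>..2 * pi - \<phi>} h" by (rule continuous_on_subset[OF cont]) simp
      show "norm (h \<theta>) \<le> D1 * r * exp (- ((\<sigma> * t - \<beta>) * r))" if "\<theta> \<in> {\<phi>..2 * pi - \<phi>}" for \<theta>
        unfolding h_def by (rule left_arc_point[OF r good]) (use that t in auto)
    qed (use ph in simp)
  qed simp
  also have "\<dots> \<le> (D1 * r * exp (- ((\<sigma> * t - \<beta>) * r)) * (2 * pi)) / (2 * pi)"
    using ph r by (intro divide_right_mono mult_left_mono) (auto simp: D1_def)
  also have "\<dots> = D1 * r * exp (- ((\<sigma> * t - \<beta>) * r))" by simp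
  finally show ?thesis .
qed

lemma tendsto_times_exp_minus:
  fixes c :: real
  assumes c: "0 < c" shows "((\<lambda>r. r * exp (- (c * r))) \<longlongrightarrow> 0) at_top"
proof -
  have "filterlim (\<lambda>r. c * r) at_top at_top"
    by (rule filterlim_tendsto_pos_mult_at_top[OF tendsto_const c filterlim_ident])
  from filterlim_compose[OF tendsto_power_div_exp_0[of 1] this]
  have "((\<lambda>r. (1 / c) * ((c * r) ^ 1 / exp (c * r))) \<longlongrightarrow> (1 / c) * 0) at_top"
    by (intro tendsto_mult tendsto_const)
  then show ?thesis using c by (simp add: exp_minus field_simps)
qed

lemma has_sum_terms:
  assumes t: "\<beta> < \<sigma> * t"
  shows "((\<lambda>\<alpha>. term_at \<alpha> t) has_sum Z t) P"
proof -
  have tpos: "0 < t"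
  proof (rule ccontr)
    assume "\<not> 0 < t"
    then have "\<sigma> * t \<le> 0" using sin_\<eta>_pos by (simp add: mult_nonneg_nonpos)
    then show False using t \<beta> by simp
  qed
  have "\<forall>n. \<exists>r. R0 + real n \<le> r \<and> (\<forall>z. norm z = r \<longrightarrow> z \<notin> (\<Union>\<alpha>\<in>PL. ball \<alpha> (\<rho> \<alpha>)))"
    using exists_good_radius by simp
  then obtain r where r: "\<And>n. R0 + real n \<le> r n" "\<And>n z. norm z = r n \<Longrightarrow> z \<notin> (\<Union>\<alpha>\<in>PL. ball \<alpha> (\<rho> \<alpha>))"
    by metis
  have rpos: "0 < r n" "R0 \<le> r n" "real n \<le> r n" for n using r(1)[of n] R0(1) by auto
  have rinf: "filterlim r at_top sequentially"
    by (rule filterlim_at_top_mono[OF filterlim_real_sequentially]) (use rpos(3) in simp)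
  define s where "s n = (\<Sum>\<alpha>\<in>P \<inter> ball 0 (r n). term_at \<alpha> t)" for n
  have "(\<lambda>n. bent_arc2 (r n) (of_real t)) \<longlonglongrightarrow> Z t"
    by (rule filterlim_compose[OF bent_arc2_tendsto_Z[OF tpos] rinf])
  moreover have "(\<lambda>n. s n - bent_arc2 (r n) (of_real t)) \<longlonglongrightarrow> 0"
  proof (rule Lim_null_comparison)
    show "\<forall>\<^sub>F n in sequentially. norm (s n - bent_arc2 (r n) (of_real t)) \<le> D1 * (r n * exp (- ((\<sigma> * t - \<beta>) * r n)))"
      unfolding s_def mult.assoc[symmetric]
        by (intro always_eventually allI residue_sum rpos r(2)) (use tpos in auto)
    have "(\<lambda>n. r n * exp (- ((\<sigma> * t - \<beta>) * r n))) \<longlonglongrightarrow> 0"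
      by (rule filterlim_compose[OF tendsto_times_exp_minus rinf]) (use t in simp)
    then show "(\<lambda>n. D1 * (r n * exp (- ((\<sigma> * t - \<beta>) * r n)))) \<longlonglongrightarrow> 0" by (rule tendsto_mult_right_zero)
  qed
  ultimately have "(\<lambda>n. (s n - bent_arc2 (r n) (of_real t)) + bent_arc2 (r n) (of_real t)) \<longlonglongrightarrow> 0 + Z t"
    by (rule tendsto_add[rotated])
  then have sZ: "s \<longlonglongrightarrow> Z t" by simp
  have "(\<lambda>\<alpha>. term_at \<alpha> t) summable_on P"
    by (rule abs_summable_summable[OF terms_abs_summable]) (use t in simp)
  then have hs: "((\<lambda>\<alpha>. term_at \<alpha> t) has_sum infsum (\<lambda>\<alpha>. term_at \<alpha> t) P) P" by (rule has_sum_infsum)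
  \<comment> \<open>The discs exhaust \<open>P\<close>, so the unordered sum, which exists by
    absolute summability, is the limit along them.\<close>
  have "filterlim (\<lambda>n. P \<inter> ball 0 (r n)) (finite_subsets_at_top P) sequentially"
    unfolding filterlim_finite_subsets_at_top
  proof (intro allI impI)
    fix X assume X: "finite X \<and> X \<subseteq> P"
    obtain b where b: "\<And>x. x \<in> X \<Longrightarrow> norm x < b" using finite_imp_bounded[of X] X unfolding bounded_pos_less
      by blast
    have "\<forall>\<^sub>F n in sequentially. b \<le> r n" using rinf unfolding filterlim_at_top by blast
    then show "\<forall>\<^sub>F n in sequentially. finite (P \<inter> ball 0 (r n)) \<and> X \<subseteq> P \<inter> ball 0 (r n) \<and> P \<inter> ball 0 (r n) \<subseteq> P"
      by eventually_elim (use X b finite_P_ball in force)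
  qed
  from filterlim_compose[OF hs[unfolded has_sum_def] this]
  have "s \<longlonglongrightarrow> infsum (\<lambda>\<alpha>. term_at \<alpha> t) P" by (simp add: s_def[abs_def])
  then have "infsum (\<lambda>\<alpha>. term_at \<alpha> t) P = Z t" using sZ by (rule LIMSEQ_unique)
  then show ?thesis using hs by simp
qed

text \<open>\<sigma> t0 = \<beta> + 1 leaves a strict margin, so the expansion also holds at
  \<open>t0\<close> itself, where the decay estimate starts.\<close>

definition t0 where "t0 = (\<beta> + 1) / \<sigma>"

lemma t0: "0 < t0" "\<sigma> * t0 = \<beta> + 1" and t0_less: "t0 \<le> t \<Longrightarrow> \<beta> < \<sigma> * t"
proof -
  show "0 < t0" "\<sigma> * t0 = \<beta> + 1" using \<beta> sin_\<eta>_pos by (auto simp: t0_def)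
  then show "\<beta> < \<sigma> * t" if "t0 \<le> t" using mult_left_mono[OF that, of \<sigma>] sin_\<eta>_pos by simp
qed

theorem Z_expansion: "t0 \<le> t \<Longrightarrow> ((\<lambda>\<alpha>. term_at \<alpha> t) has_sum Z t) R"
  using has_sum_terms[OF t0_less, of t]
  by (subst has_sum_cong_neutral[where T = P and g = "\<lambda>\<alpha>. term_at \<alpha> t"]) (use P_R term_at_nonpole in auto)

theorem Z_zero_if_no_resonances: "R = {} \<Longrightarrow> 0 < t \<Longrightarrow> Z t = 0"
proof (rule Z_zero_if_eventually_zero[of t0])
  show "Z t = 0" if "R = {}" "t0 < t" for t using infsumI[OF Z_expansion[of t]] that by simp
qed

text \<open>The finitely many poles within \<open>R1\<close> decay at positive rates of their own.
  All others together decay like exp(- t), by the estimate with t1 = t0, so a common rate exists. On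
  the interval up to \<open>t0\<close> the growth bound is absorbed into the constant.\<close>

theorem Z_exponential_decay: "\<exists>C>0. \<exists>\<gamma>>0. \<forall>t\<ge>0. norm (Z t) \<le> C * exp (- \<gamma> * t)"
proof -
  obtain C1 \<gamma>1
    where C1: "0 \<le> C1" "0 < \<gamma>1" "\<And>t. 0 \<le> t \<Longrightarrow> (\<Sum>\<alpha>\<in>P \<inter> cball 0 R1. norm (term_at \<alpha> t)) \<le> C1 * exp (- \<gamma>1 * t)"
    using finite_terms_decay[OF finite_P[of R1]] by auto
  define C2 where "C2 = D1 * exp ((t0 + \<beta>) * S) * S * exp t0"
  have C2: "0 \<le> C2" using S_nonneg by (simp add: C2_def D1_def)
  define \<gamma> where "\<gamma> = min \<gamma>1 1"
  have \<gamma>: "0 < \<gamma>" "\<gamma> \<le> \<gamma>1" "\<gamma> \<le> 1" using C1 by (auto simp: \<gamma>_def)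
  have large: "norm (Z t) \<le> (C1 + C2) * exp (- \<gamma> * t)" if t: "t0 \<le> t" for t
  proof -
    have tp: "0 \<le> t" using t t0(1) by simp
    have b: "\<beta> \<le> \<sigma> * t" "\<beta> \<le> \<sigma> * t0" using t0_less[OF t] t0_less[of t0] by auto
    have sm: "(\<lambda>\<alpha>. norm (term_at \<alpha> t)) summable_on P" by (rule terms_abs_summable[OF b(1)])
    have "norm (Z t) \<le> infsum (\<lambda>\<alpha>. norm (term_at \<alpha> t)) P"
      by (rule norm_infsum_le[OF has_sum_terms[OF t0_less[OF t]] has_sum_infsum[OF sm]]) simp
    also have "P = (P \<inter> cball 0 R1) \<union> (P - cball 0 R1)" by auto
    also have "infsum (\<lambda>\<alpha>. norm (term_at \<alpha> t)) \<dots> = infsum (\<lambda>\<alpha>. norm (term_at \<alpha> t)) (P \<inter> cball 0 R1) + infsum (\<lambda>\<alpha>. norm (term_at \<alpha> t)) (P - cball 0 R1)"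
      by (rule infsum_Un_disjoint[OF summable_on_finite[OF finite_P] far_terms_summable(1)[OF t b(2)]]) auto
    also have "\<dots> \<le> C1 * exp (- \<gamma>1 * t) + D1 * exp ((t0 + \<beta>) * S) * exp (- (t - t0)) * S"
      using C1(3)[OF tp] far_terms_summable(2)[OF t b(2)] finite_P[of R1] by (intro add_mono) auto
    also have "D1 * exp ((t0 + \<beta>) * S) * exp (- (t - t0)) * S = C2 * exp (- 1 * t)"
      unfolding C2_def by (simp add: exp_diff exp_minus field_simps)
    also have "C1 * exp (- \<gamma>1 * t) + C2 * exp (- 1 * t) \<le> C1 * exp (- \<gamma> * t) + C2 * exp (- \<gamma> * t)"
      using C1(1) C2 mult_right_mono[OF \<gamma>(2) tp] mult_right_mono[OF \<gamma>(3) tp]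
        by (intro add_mono mult_left_mono) auto
    finally show ?thesis by (simp add: ring_distribs)
  qed
  define C3 where "C3 = M * exp (a * t0) * exp (\<gamma> * t0)"
  have small: "norm (Z t) \<le> C3 * exp (- \<gamma> * t)" if t: "0 \<le> t" "t \<le> t0" for t
  proof -
    have "norm (Z t) \<le> M * exp (a * t) * 1" using Z_bound[OF t(1)] by simp
    also have "\<dots> \<le> (M * exp (a * t0)) * (exp (\<gamma> * t0) * exp (- \<gamma> * t))"
    proof (intro mult_mono)
      show "exp (a * t) \<le> exp (a * t0)" using t a_pos by simp
      show "1 \<le> exp (\<gamma> * t0) * exp (- \<gamma> * t)" using t \<gamma> by (simp add: mult_left_mono flip: exp_add)
    qed (use M_nonneg in auto)
    finally show ?thesis by (simp add: C3_def mult.assoc)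
  qed
  have C3: "0 \<le> C3" using M_nonneg by (simp add: C3_def)
  have "norm (Z t) \<le> (C1 + C2 + C3 + 1) * exp (- \<gamma> * t)" if t: "0 \<le> t" for t
  proof (cases "t0 \<le> t")
    case True
    have "(C1 + C2) * exp (- \<gamma> * t) \<le> (C1 + C2 + C3 + 1) * exp (- \<gamma> * t)" using C3
      by (intro mult_right_mono) auto
    then show ?thesis using large[OF True] by linarith
  next
    case False
    have "C3 * exp (- \<gamma> * t) \<le> (C1 + C2 + C3 + 1) * exp (- \<gamma> * t)" using C1 C2 by (intro mult_right_mono) auto
    then show ?thesis using small[of t] False t by linarith
  qed
  moreover have "0 < C1 + C2 + C3 + 1" using C1 C2 C3 by simp
  ultimately show ?thesis using \<gamma>(1) by blast
qed

end

section \<open>The continued resolvent\<close>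

definition norm_less :: "complex \<Rightarrow> complex \<Rightarrow> bool" where
  "norm_less x y \<longleftrightarrow> norm x < norm y \<or> (norm x = norm y \<and> (Re x < Re y \<or> (Re x = Re y \<and> Im x < Im y)))"

lemma norm_less_irrefl: "\<not> norm_less x x"
  by (simp add: norm_less_def)

lemma norm_less_trans: "norm_less x y \<Longrightarrow> norm_less y z \<Longrightarrow> norm_less x z"
  by (auto simp: norm_less_def)

lemma norm_less_linear: "x \<noteq> y \<Longrightarrow> norm_less x y \<or> norm_less y x"
  by (auto simp: norm_less_def not_less complex_eq_iff)

text \<open>\<open>norm_less\<close> breaks ties and is a linear order in which each point has
  finitely many predecessors in \<open>R\<close>. Their number is a rank; it is injective and takes
  all values below each value that it takes, so its inverse is the enumeration, whether
  \<open>R\<close> is finite or not.\<close>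

lemma enumerates_by_norm_exists:
  assumes fin: "\<And>r. finite (R \<inter> cball 0 r)"
  shows "\<exists>\<alpha>. enumerates_by_norm \<alpha> R"
proof -
  define L where "L x = {y \<in> R. norm_less y x}" for x
  define rank where "rank x = card (L x)" for x
  have finL: "finite (L x)" for x
    by (rule finite_subset[OF _ fin[of "norm x"]]) (auto simp: L_def norm_less_def)
  have mono: "rank x < rank y" if "x \<in> R" "norm_less x y" for x y
    unfolding rank_def
  proof (rule psubset_card_mono[OF finL])
    have "x \<in> L y" "x \<notin> L x" using that norm_less_irrefl by (auto simp: L_def)
    moreover have "L x \<subseteq> L y" using that(2) norm_less_trans by (auto simp: L_def)
    ultimately show "L x \<subset> L y" by blast
  qed
  have inj: "inj_on rank R"
  proof (rule inj_onI, rule ccontr)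
    fix x y assume "x \<in> R" "y \<in> R" "rank x = rank y" "x \<noteq> y"
    then show False using norm_less_linear[of x y] mono[of x y] mono[of y x] by auto
  qed
  have pred: "\<exists>x\<in>R. rank y = Suc (rank x)" if y: "y \<in> R" "rank y \<noteq> 0" for y
  proof -
    have "L y \<noteq> {}" using y by (auto simp: rank_def)
    then have "finite (rank ` L y)" "rank ` L y \<noteq> {}" using finL by auto
    then have "Max (rank ` L y) \<in> rank ` L y" by (rule Max_in)
    then obtain x where x: "x \<in> L y" "rank x = Max (rank ` L y)" by auto
    have "L y = insert x (L x)"
    proof
      show "L y \<subseteq> insert x (L x)"
      proof
        fix z assume z: "z \<in> L y"
        then have "rank z \<le> rank x" unfolding x(2) by (intro Max_ge) (use finL in auto)
        then have "\<not> norm_less x z" using mono[of x z] x(1) by (auto simp: L_def)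
        then show "z \<in> insert x (L x)" using norm_less_linear[of x z] z by (auto simp: L_def)
      qed
      show "insert x (L x) \<subseteq> L y" using x(1) norm_less_trans by (auto simp: L_def)
    qed
    moreover have "x \<notin> L x" using norm_less_irrefl by (simp add: L_def)
    ultimately have "rank y = Suc (rank x)" using finL by (simp add: rank_def)
    then show ?thesis using x(1) by (auto simp: L_def)
  qed
  have down: "n \<in> rank ` R" if "y \<in> R" "n \<le> rank y" for n y
    using that
  proof (induction "rank y" arbitrary: y)
    case 0 then show ?case by (metis imageI le_zero_eq)
  next
    case (Suc m)
    show ?case
    proof (cases "n = rank y")
      case False
      obtain x where "x \<in> R" "rank y = Suc (rank x)" using pred[of y] Suc(2,3) by auto
      then show ?thesis using Suc(1)[of x] Suc(2,4) False by auto
    qed (use Suc in auto)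
  qed
  have img: "rank ` R = enum_index R"
  proof (cases "finite R")
    case True
    have "rank ` R \<subseteq> {..<card R}"
    proof
      fix n assume "n \<in> rank ` R"
      then obtain y where y: "y \<in> R" "n = rank y" by auto
      have "L y \<subset> R" using y(1) norm_less_irrefl by (auto simp: L_def)
      then show "n \<in> {..<card R}" using psubset_card_mono[OF True] y by (simp add: rank_def)
    qed
    then have "rank ` R = {..<card R}" using card_image[OF inj] by (intro card_subset_eq) auto
    then show ?thesis using True by (auto simp: enum_index_def)
  next
    case False
    then have "infinite (rank ` R)" using finite_image_iff[OF inj] by simp
    then have "\<exists>m\<in>rank ` R. n \<le> m" for n unfolding infinite_nat_iff_unbounded_le by auto
    then have "rank ` R = UNIV" using down by auto
    then show ?thesis using False by (simp add: enum_index_def)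
  qed
  then have bij: "bij_betw rank R (enum_index R)" using inj by (simp add: bij_betw_def)
  define \<alpha> where "\<alpha> = inv_into R rank"
  have \<alpha>: "\<alpha> n \<in> R" "rank (\<alpha> n) = n" if "n \<in> enum_index R" for n
    using that img inv_into_into[of n rank R] f_inv_into_f[of n rank R] by (auto simp: \<alpha>_def)
  have "bij_betw \<alpha> (enum_index R) R" unfolding \<alpha>_def by (rule bij_betw_inv_into[OF bij])
  moreover have "norm (\<alpha> m) \<le> norm (\<alpha> n)" if mn: "m \<in> enum_index R" "n \<in> enum_index R" "m \<le> n" for m n
  proof (rule ccontr)
    assume "\<not> norm (\<alpha> m) \<le> norm (\<alpha> n)"
    then have "norm_less (\<alpha> n) (\<alpha> m)" by (simp add: norm_less_def)
    then have "rank (\<alpha> n) < rank (\<alpha> m)" by (rule mono[OF \<alpha>(1)[OF mn(2)]])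
    then show False using \<alpha>(2) mn by simp
  qed
  ultimately show ?thesis unfolding enumerates_by_norm_def by blast
qed

lemma has_sum_enumeration:
  fixes f :: "complex \<Rightarrow> complex"
  assumes \<alpha>: "bij_betw \<alpha> (enum_index R) R" and f: "(f has_sum s) R"
  shows "(\<lambda>n. if n \<in> enum_index R then f (\<alpha> n) else 0) sums s"
proof -
  have "((\<lambda>n. f (\<alpha> n)) has_sum s) (enum_index R)" using f has_sum_reindex_bij_betw[OF \<alpha>, of f s] by simp
  then have "((\<lambda>n. if n \<in> enum_index R then f (\<alpha> n) else 0) has_sum s) UNIV"
    by (subst has_sum_cong_neutral[where T = "enum_index R" and g = "\<lambda>n. f (\<alpha> n)"]) auto
  then show ?thesis by (rule has_sum_imp_sums)
qed

section \<open>Numerator and denominator of the continued resolvent\<close>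

locale kuramoto = density_continuation g gs
  for g :: "real \<Rightarrow> real" and gs :: "complex \<Rightarrow> complex" +
  fixes K :: real and f1 :: complex and q :: "real \<Rightarrow> complex" and qs :: "complex \<Rightarrow> complex"
  assumes f1: "Im f1 < 0" and K_pos: "0 < K" and K_less: "ereal K < critical_coupling g f1"
    and q: "q \<in> L2 g" and q_continuation: "analytic_continuation_upper q qs"
begin

abbreviation "\<kappa> \<equiv> \<i> * complex_of_real K * f1"
abbreviation "FF \<equiv> F1 g gs K f1 q qs"
abbreviation "RP \<equiv> resonance_poles g gs K f1"
abbreviation "NE \<equiv> cauchy_ext (wt_fun q) (\<lambda>z. gs z * qs z)"

definition BE :: "complex \<Rightarrow> complex" where "BE z = 1 - \<kappa> * DE z"

definition QE :: "complex \<Rightarrow> complex" where "QE z = NE z / BE z"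

lemma \<kappa>_nonzero: "\<kappa> \<noteq> 0"
  using f1 K_pos by auto

lemma qs_of_real: "qs (of_real x) = q x" and qs_analytic: "0 \<le> Im z \<Longrightarrow> qs analytic_on {z}"
  using q_continuation by (auto simp: analytic_continuation_upper_def intro: analytic_on_subset)

lemma product_continuation:
  "gs (of_real x) * qs (of_real x) = wt_fun q x"
  "(\<lambda>z. gs z * qs z) analytic_on \<real>"
  "(\<lambda>z. gs z * qs z) meromorphic_on {z. 0 < Im z}"
proof -
  show "gs (of_real x) * qs (of_real x) = wt_fun q x" by (simp add: gs_of_real qs_of_real)
  have "qs analytic_on {z. 0 \<le> Im z}" using q_continuation by (simp add: analytic_continuation_upper_def)
  moreover have "\<real> \<subseteq> {z. 0 \<le> Im z}" "{z. 0 < Im z} \<subseteq> {z. 0 \<le> Im z}" by (auto elim!: Reals_cases)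
  ultimately have "qs analytic_on \<real>" "qs analytic_on {z. 0 < Im z}" by (meson analytic_on_subset)+
  moreover have "gs meromorphic_on {z. 0 < Im z}" using gs_mero by (simp add: nicely_meromorphic_on_def)
  ultimately show "(\<lambda>z. gs z * qs z) analytic_on \<real>" "(\<lambda>z. gs z * qs z) meromorphic_on {z. 0 < Im z}"
    using gs_analytic
      by (auto intro!: analytic_on_mult meromorphic_on_mult intro: analytic_on_imp_meromorphic_on)
qed

lemma NE_analytic_right: "0 \<le> Re z \<Longrightarrow> NE analytic_on {z}"
  using cauchy_ext_analytic_right[OF wt_fun_integrable[OF q]] cauchy_ext_axis(1)[OF wt_fun_integrable[OF q] product_continuation(1,2)]
  by (cases "Re z = 0") auto

lemma BE_analytic_right: "0 \<le> Re z \<Longrightarrow> BE analytic_on {z}"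
  unfolding BE_def[abs_def] by (intro analytic_intros DE_analytic_closed_right)

lemma BE_nonzero_right: "0 \<le> Re z \<Longrightarrow> BE z \<noteq> 0"
  using DE_neq_critical[OF f1 K_pos K_less, of z] \<kappa>_nonzero by (auto simp: BE_def field_simps)

lemma QE_analytic_right: "0 \<le> Re z \<Longrightarrow> QE analytic_on {z}"
  unfolding QE_def[abs_def]
    by (intro analytic_intros NE_analytic_right BE_analytic_right) (auto simp: BE_nonzero_right)

lemma BE_meromorphic: "BE meromorphic_on UNIV"
  unfolding BE_def[abs_def]
  by (intro meromorphic_intros cauchy_ext_meromorphic[OF cg_integrable gs_of_real gs_analytic])
    (use gs_mero in \<open>simp add: nicely_meromorphic_on_def\<close>)

lemma QE_meromorphic: "QE meromorphic_on UNIV"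
  unfolding QE_def[abs_def]
  by (intro meromorphic_intros BE_meromorphic cauchy_ext_meromorphic[OF wt_fun_integrable[OF q] product_continuation])

lemma F0_eq_QE: "0 < Re z \<Longrightarrow> F0 g K f1 q z = QE z"
  using inner_resolvent[of z q \<kappa>] BE_nonzero_right[of z] q
  by (simp add: F0_def T1_eq_rank_one_op QE_def BE_def cauchy_ext_def)

lemma D_fun_eq: "D_fun g z = D0 z"
  by (simp add: D_fun_def cauchy_transform_def)

lemma F1_left_eq_QE: "Re z < 0 \<Longrightarrow> F1_left g gs K f1 q qs z = QE z"
  using inner_resolvent[of z q 0] q
  by (simp add: F1_left_def mult_eq_rank_one_op QE_def BE_def cauchy_ext_def D_fun_eq algebra_simps)

text \<open>In each of the three regions \<open>F1\<close> comes from the quotient \<open>QE\<close>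
  of continued transforms, so one function meromorphic on the plane replaces the case distinction.
  Removing singularities changes nothing in the closed right half plane, where \<open>QE\<close> is
  analytic.\<close>

lemma F1_eq: "FF = remove_sings QE"
proof
  fix z
  consider "0 < Re z" | "Re z = 0" | "Re z < 0" by linarith
  then show "FF z = remove_sings QE z"
  proof cases
    case 1
    then show ?thesis using remove_sings_at_analytic[OF QE_analytic_right[of z]]
      by (simp add: F1_def F0_eq_QE)
  next
    case 2
    have "isCont QE z" by (rule analytic_at_imp_isCont[OF QE_analytic_right]) (use 2 in simp)
    then have "(QE \<longlongrightarrow> QE z) (at z within {z. 0 < Re z})" unfolding isCont_def
      by (rule tendsto_within_subset) simp
    then have "(F0 g K f1 q \<longlongrightarrow> QE z) (at z within {z. 0 < Re z})"
      by (rule Lim_transform_eventually) (simp add: eventually_at_filter F0_eq_QE)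
    then have "Lim (at z within {z. 0 < Re z}) (F0 g K f1 q) = QE z"
      by (rule tendsto_Lim[OF at_right_halfplane_nontrivial, rotated]) (use 2 in simp)
    then show ?thesis using 2 remove_sings_at_analytic[OF QE_analytic_right[of z]] by (simp add: F1_def)
  next
    case 3
    have "\<forall>\<^sub>F u in at z. u \<in> {u. Re u < 0}"
      by (rule eventually_at_in_open') (use 3 in \<open>auto simp: open_halfspace_Re_lt\<close>)
    then have "\<forall>\<^sub>F u in at z. F1_left g gs K f1 q qs u = QE u" by eventually_elim (simp add: F1_left_eq_QE)
    then have "remove_sings (F1_left g gs K f1 q qs) z = remove_sings QE z" by (rule remove_sings_cong) simp
    then show ?thesis using 3 by (simp add: F1_def)
  qed
qed

lemma F1_mero: "FF nicely_meromorphic_on UNIV"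
  unfolding F1_eq by (rule remove_sings_nicely_meromorphic[OF QE_meromorphic])

lemma F1_analytic_right: "0 \<le> Re z \<Longrightarrow> FF analytic_on {z}"
  unfolding F1_eq by (intro remove_sings_analytic_on QE_analytic_right)

lemma resonance_poles_left: "z \<in> RP \<Longrightarrow> Re z < 0"
  by (simp add: resonance_poles_def)

lemma resonance_iff_BE:
  assumes "Re z < 0" "\<not> is_pole gs (- \<i> * z)"
  shows "z \<in> RP \<longleftrightarrow> BE z = 0"
  using assms \<kappa>_nonzero by (auto simp: resonance_poles_def BE_def cauchy_ext_def D_fun_eq field_simps)

text \<open>Where \<open>gs\<close> has no pole at -i z, the quotient is regular unless the
  denominator vanishes. At a pole of \<open>gs\<close> both parts are divided by \<open>gs\<close>:
  they then tend to 2 pi qs(-i z) and - 2 pi \<kappa>, and the second is nonzero, so the quotient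
  stays bounded.\<close>

lemma poles_subset_resonances:
  assumes "is_pole FF z" shows "z \<in> RP"
proof (rule ccontr)
  assume nR: "z \<notin> RP"
  have pole: "is_pole QE z"
    using assms QE_meromorphic unfolding F1_eq
    by (metis UNIV_I is_pole_remove_sings_iff meromorphic_on_isolated_singularity meromorphic_on_subset subset_UNIV)
  have left: "Re z < 0"
  proof (rule ccontr)
    assume "\<not> Re z < 0"
    then have "QE analytic_on {z}" by (intro QE_analytic_right) simp
    then show False using pole analytic_at_imp_no_pole by blast
  qed
  have qa: "qs analytic_on {- \<i> * z}" by (rule qs_analytic) (use left in simp)
  show False
  proof (cases "is_pole gs (- \<i> * z)")
    case False
    have ga: "gs analytic_on {- \<i> * z}"
      by (rule nicely_meromorphic_on_imp_analytic_at[OF gs_mero _ False]) (use left in simp)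
    have "BE analytic_on {z}" unfolding BE_def[abs_def]
      by (intro analytic_intros cauchy_ext_analytic_left[OF cg_integrable left ga])
    moreover have "NE analytic_on {z}"
      by (rule cauchy_ext_analytic_left[OF wt_fun_integrable[OF q] left]) (intro analytic_intros ga qa)
    moreover have "BE z \<noteq> 0" using nR resonance_iff_BE[OF left False] by simp
    ultimately have "QE analytic_on {z}" unfolding QE_def[abs_def] by (intro analytic_intros) auto
    then show False using pole analytic_at_imp_no_pole by blast
  next
    case True
    have rot: "filterlim (\<lambda>u. - \<i> * u) (at (- \<i> * z)) (at z)"
    proof (rule filterlim_atI)
      show "((\<lambda>u. - \<i> * u) \<longlongrightarrow> - \<i> * z) (at z)" by (rule tendsto_mult[OF tendsto_const tendsto_ident_at])
    qed (simp add: eventually_at_filter)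
    have ginf: "filterlim (\<lambda>u. gs (- \<i> * u)) at_infinity (at z)"
      using filterlim_compose[OF True[unfolded is_pole_def] rot] .
    have h0: "((\<lambda>u. inverse (gs (- \<i> * u))) \<longlongrightarrow> 0) (at z)"
      by (rule filterlim_compose[OF tendsto_inverse_0 ginf])
    have qlim: "((\<lambda>u. qs (- \<i> * u)) \<longlongrightarrow> qs (- \<i> * z)) (at z)"
      by (rule isCont_tendsto_compose[OF analytic_at_imp_isCont[OF qa]]) (intro tendsto_intros)
    have clim: "(cauchy_transform \<psi> \<longlongrightarrow> cauchy_transform \<psi> z) (at z)" if "integrable lborel \<psi>" for \<psi>
    proof -
      have "cauchy_transform \<psi> analytic_on {z}"
        by (rule analytic_on_subset[OF cauchy_transform_analytic[OF that]]) (use left in auto)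
      then show ?thesis using analytic_at_imp_isCont isCont_def by blast
    qed
    define num den
      where "num u = cauchy_transform (wt_fun q) u * inverse (gs (- \<i> * u)) + 2 * of_real pi * qs (- \<i> * u)"
      and "den u = (1 - \<kappa> * D0 u) * inverse (gs (- \<i> * u)) - 2 * of_real pi * \<kappa>" for u
    have "(num \<longlongrightarrow> cauchy_transform (wt_fun q) z * 0 + 2 * of_real pi * qs (- \<i> * z)) (at z)"
      unfolding num_def[abs_def] by (intro tendsto_intros clim h0 qlim wt_fun_integrable q)
    moreover have "(den \<longlongrightarrow> (1 - \<kappa> * D0 z) * 0 - 2 * of_real pi * \<kappa>) (at z)"
      unfolding den_def[abs_def] by (intro tendsto_intros clim h0 cg_integrable)
    ultimately have "((\<lambda>u. num u / den u) \<longlongrightarrow> (cauchy_transform (wt_fun q) z * 0 + 2 * of_real pi * qs (- \<i> * z)) / ((1 - \<kappa> * D0 z) * 0 - 2 * of_real pi * \<kappa>)) (at z)"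
      by (rule tendsto_divide) (use \<kappa>_nonzero in simp)
    moreover have "\<forall>\<^sub>F u in at z. num u / den u = QE u"
    proof -
      have "\<forall>\<^sub>F u in at z. gs (- \<i> * u) \<noteq> 0"
        using filterlim_at_infinity_imp_eventually_ne[OF ginf, of 0] .
      moreover have "\<forall>\<^sub>F u in at z. u \<in> {u. Re u < 0}"
        by (rule eventually_at_in_open') (use left in \<open>auto simp: open_halfspace_Re_lt\<close>)
      ultimately show ?thesis
      proof eventually_elim
        case (elim u)
        then have "NE u = gs (- \<i> * u) * num u" by (simp add: cauchy_ext_def num_def field_simps)
        moreover have "BE u = gs (- \<i> * u) * den u" using elim
          by (simp add: BE_def cauchy_ext_def den_def field_simps)
        ultimately show ?case using elim by (simp add: QE_def)
      qed
    qed
    ultimately have "(QE \<longlongrightarrow> (cauchy_transform (wt_fun q) z * 0 + 2 * of_real pi * qs (- \<i> * z)) / ((1 - \<kappa> * D0 z) * 0 - 2 * of_real pi * \<kappa>)) (at z)"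
      by (rule Lim_transform_eventually)
    then show False using pole not_tendsto_and_filterlim_at_infinity[of "at z"] unfolding is_pole_def
      by (auto simp: trivial_limit_at)
  qed
qed

text \<open>The denominator is meromorphic on the plane and has no zeros in the right half plane. So
  it is not identically zero, and its zeros accumulate nowhere, neither on the axis nor at a pole of
  \<open>gs\<close>.\<close>

lemma finite_resonances: "finite (RP \<inter> cball 0 r)"
proof (rule ccontr)
  assume "infinite (RP \<inter> cball 0 r)"
  then obtain p where p: "p islimpt (RP \<inter> cball 0 r)"
    using compact_cball[of "0::complex" r] unfolding compact_eq_Bolzano_Weierstrass by blast
  have "eventually (\<lambda>z. BE z = 0) (cosparse UNIV) \<or> eventually (\<lambda>z. BE z \<noteq> 0) (cosparse UNIV)"
    by (rule meromorphic_imp_constant_or_avoid[OF BE_meromorphic]) auto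
  then show False
  proof
    assume "eventually (\<lambda>z. BE z = 0) (cosparse UNIV)"
    then have "\<forall>\<^sub>F z in at (1::complex). BE z = 0" by (simp add: eventually_cosparse_open_eq)
    moreover have "\<forall>\<^sub>F z in at (1::complex). z \<in> {z. 0 < Re z}"
      by (rule eventually_at_in_open') (auto simp: open_halfspace_Re_gt)
    ultimately have "\<forall>\<^sub>F z in at (1::complex). False" by eventually_elim (use BE_nonzero_right in force)
    then show False by simp
  next
    assume "eventually (\<lambda>z. BE z \<noteq> 0) (cosparse UNIV)"
    then have "\<forall>\<^sub>F z in at p. BE z \<noteq> 0" by (simp add: eventually_cosparse_open_eq)
    moreover have "\<exists>\<^sub>F z in at p. z \<in> RP \<inter> cball 0 r" using p by (simp add: islimpt_conv_frequently_at)
    ultimately have "\<exists>\<^sub>F z in at p. z \<in> RP \<inter> cball 0 r \<and> BE z \<noteq> 0" by (intro frequently_eventually_frequently)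
    then obtain z where "z \<in> RP" "BE z \<noteq> 0" by (blast dest: frequently_ex)
    then show False using resonance_iff_BE[of z] by (auto simp: resonance_poles_def)
  qed
qed

end

text \<open>Existence of resonances carries the proviso that \<open>F0\<close> is not identically
  zero, since otherwise \<open>F1\<close> vanishes and (iv), (v) give no information on the roots.
  The expansion can be asserted for every ordering by modulus because the terms are absolutely
  summable.\<close>

theorem theorem3p9:
  fixes f g :: "real \<Rightarrow> real" and K \<delta> D \<beta> :: real and f1 :: complex
    and q :: "real \<Rightarrow> complex" and gs qs :: "complex \<Rightarrow> complex"
    and S :: "real \<Rightarrow> (real \<Rightarrow> complex) \<Rightarrow> real \<Rightarrow> complex"
    and Z :: "real \<Rightarrow> complex"
  assumes f: "coupling_function f" and f1: "f1 = fourier_coeff f 1"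
    and g: "prob_density g"
    and q: "q \<in> L2 g"
    and S: "generates g (mult_dom g) (T1 g K f1) S"
    and Z: "\<And>t. Z t = L2_inner g (S t q) P0"
    and i: "Im f1 < 0" "0 < K" "ereal K < critical_coupling g f1"
    and ii: "real_analytic g" "meromorphic_continuation_upper (\<lambda>x. complex_of_real (g x)) gs"
    and iii: "real_analytic q" "analytic_continuation_upper q qs"
    and iv: "0 < \<delta>"
      "(F1 g gs K f1 q qs \<longlongrightarrow> 0) (inf at_infinity (principal (vertical_sectors \<delta>)))"
    and v: "0 < D" "0 < \<beta>"
      "exp_bounded_off_poles (F1 g gs K f1 q qs) (left_sector \<delta>) D \<beta>"
  shows "((\<exists>z. 0 < Re z \<and> F0 g K f1 q z \<noteq> 0) \<longrightarrow> resonance_poles g gs K f1 \<noteq> {}) \<and>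
    (\<exists>\<alpha>. enumerates_by_norm \<alpha> (resonance_poles g gs K f1)) \<and>
    (\<forall>\<alpha>. enumerates_by_norm \<alpha> (resonance_poles g gs K f1) \<longrightarrow>
       (\<exists>t0>0. \<exists>p :: nat \<Rightarrow> complex poly. \<forall>t>t0.
          (\<lambda>n. if n \<in> enum_index (resonance_poles g gs K f1)
               then poly (p n) (of_real t) * exp (\<alpha> n * of_real t) else 0) sums Z t)) \<and>
    (\<exists>C>0. \<exists>\<gamma>>0. \<forall>t\<ge>0. norm (Z t) \<le> C * exp (- \<gamma> * t))"
proof -
  interpret k: kuramoto g gs K f1 q qs
    by unfold_locales (use g ii i q iii in auto)
  interpret s: L2_semigroup g S
    by unfold_locales (use S in \<open>simp add: generates_def\<close>)
  have Zs: "Z = s.Z q" by (rule ext) (simp add: Z s.Z_def)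
  obtain M a
    where Ma: "1 \<le> M" "0 < a" "\<And>t u. 0 \<le> t \<Longrightarrow> u \<in> L2 g \<Longrightarrow> norm (s.Z u t) \<le> M * exp (a * t) * L2_norm g u"
    using s.Z_growth by blast
  have lap: "(LINT t:{0..}|lborel. exp (- (z * of_real t)) * Z t) = F1 g gs K f1 q qs z" if z: "a < Re z"
    for z
  proof -
    have z0: "0 < Re z" using z Ma(2) by simp
    have nz: "1 - \<i> * of_real K * f1 * k.D0 z \<noteq> 0"
      using k.BE_nonzero_right[of z] z0 by (simp add: k.BE_def cauchy_ext_def)
    obtain u where u: "u \<in> mult_dom g" "\<And>\<omega>. z * u \<omega> - k.rank_one_op (\<i> * of_real K * f1) u \<omega> = q \<omega>"
      "L2_inner g u P0 = cauchy_transform (k.wt_fun q) z / (1 - \<i> * of_real K * f1 * k.D0 z)"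
      using k.resolvent_equation_solvable[of z q "\<i> * of_real K * f1"] z0 q nz by (metis less_irrefl)
    have uL: "u \<in> L2 g" using u(1) by (simp add: mult_dom_def)
    have wL: "k.rank_one_op (\<i> * of_real K * f1) u \<in> L2 g" by (rule k.rank_one_op_L2[OF u(1)])
    \<comment> \<open>This is where the generator enters: membership of u in the domain becomes
      convergence of the difference quotients at 0 to the image of u.\<close>
    have lim: "((\<lambda>h. L2_norm g (\<lambda>\<omega>. (S h u \<omega> - u \<omega>) / of_real h - k.rank_one_op (\<i> * of_real K * f1) u \<omega>)) \<longlongrightarrow> 0) (at_right 0)"
      using S uL wL u(1) unfolding generates_def k.T1_eq_rank_one_op by blast
    have "(LINT t:{0..}|lborel. exp (- (z * of_real t)) * s.Z q t) = L2_inner g u P0"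
      by (rule s.laplace_Z(2)[OF q uL wL lim u(2) Ma(3) z])
    also have "\<dots> = k.QE z" using u(3) z0 by (simp add: k.QE_def k.BE_def cauchy_ext_def)
    also have "\<dots> = F1 g gs K f1 q qs z" using k.F0_eq_QE[OF z0] z0 by (simp add: F1_def)
    finally show ?thesis by (simp add: Zs)
  qed
  interpret r: resonance_expansion "F1 g gs K f1 q qs" \<delta> Z a "M * L2_norm g q" D \<beta> "resonance_poles g gs K f1"
  proof unfold_locales
    show "continuous_on {0..} Z" unfolding Zs by (rule s.Z_continuous[OF q])
    show "norm (Z t) \<le> M * L2_norm g q * exp (a * t)" if "0 \<le> t" for t
      using Ma(3)[OF that q] by (simp add: Zs mult_ac)
  qed (use iv v Ma(2) lap k.F1_mero k.F1_analytic_right k.resonance_poles_left k.poles_subset_resonances k.finite_resonances in auto)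
  \<comment> \<open>Without resonances the expansion is an empty sum. So \<open>Z\<close> vanishes
    for t > 0, then its Laplace transform vanishes for Re w > a, and finally \<open>QE\<close>
    vanishes on the right half plane by the identity theorem.\<close>
  have 1: "resonance_poles g gs K f1 \<noteq> {}" if "0 < Re z" "F0 g K f1 q z \<noteq> 0" for z
  proof
    assume "resonance_poles g gs K f1 = {}"
    then have Z0: "Z t = 0" if "0 < t" for t using that by (rule r.Z_zero_if_no_resonances)
    have zero: "k.QE w = 0" if w: "a < Re w" for w
    proof -
      have "(LINT t:{0..}|lborel. exp (- (w * of_real t)) * Z t) = 0"
        unfolding set_lebesgue_integral_def
      proof (rule integral_eq_zero_AE)
        \<comment> \<open>The value at t = 0 is not among those known to vanish, but a single point
          is a null set.\<close>
        show "AE t in lborel. indicator {0..} t *\<^sub>R (exp (- (w * of_real t)) * Z t) = 0"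
          using AE_lborel_singleton[of "0::real"] by eventually_elim (use Z0 in \<open>auto simp: indicator_def\<close>)
      qed
      then have "F1 g gs K f1 q qs w = 0" using lap[OF w] by simp
      then show ?thesis using k.F0_eq_QE[of w] w Ma(2) by (simp add: F1_def)
    qed
    have "k.QE analytic_on {z. 0 < Re z}"
      using k.QE_analytic_right by (subst analytic_on_analytic_at) auto
    then have hol: "k.QE holomorphic_on {z. 0 < Re z}" by (rule analytic_imp_holomorphic)
    have "k.QE z = 0"
    proof (rule analytic_continuation_open[where s = "{z. a < Re z}" and s' = "{z. 0 < Re z}" and f = "k.QE" and g = "\<lambda>_. 0"])
      show "{z. a < Re z} \<noteq> {}" by (auto intro!: exI[of _ "of_real (a + 1)"])
      show "connected {z. 0 < Re z}" by (intro convex_connected convex_halfspace_Re_gt)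
    qed (use hol zero that Ma(2) in \<open>auto simp: open_halfspace_Re_gt\<close>)
    then show False using that k.F0_eq_QE by simp
  qed
  have 2: "\<exists>t0>0. \<exists>p :: nat \<Rightarrow> complex poly. \<forall>t>t0.
          (\<lambda>n. if n \<in> enum_index (resonance_poles g gs K f1)
               then poly (p n) (of_real t) * exp (\<alpha> n * of_real t) else 0) sums Z t"
    if \<alpha>: "enumerates_by_norm \<alpha> (resonance_poles g gs K f1)" for \<alpha>
  proof -
    obtain p where p: "\<And>\<alpha> t. r.term_at \<alpha> t = poly (p \<alpha>) (of_real t) * exp (\<alpha> * of_real t)"
      using r.term_at_polynomial by metis
    have "(\<lambda>n. if n \<in> enum_index (resonance_poles g gs K f1) then poly (p (\<alpha> n)) (of_real t) * exp (\<alpha> n * of_real t) else 0) sums Z t"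
      if "r.t0 < t" for t
      unfolding p[symmetric]
      by (rule has_sum_enumeration[OF _ r.Z_expansion[OF less_imp_le[OF that]]]) (use \<alpha> in \<open>simp add: enumerates_by_norm_def\<close>)
    then show ?thesis using r.t0(1) by (intro exI[of _ r.t0] conjI exI[of _ "\<lambda>n. p (\<alpha> n)"]) auto
  qed
  show ?thesis
    by (intro conjI allI impI 2 enumerates_by_norm_exists[OF k.finite_resonances] r.Z_exponential_decay) (use 1 in blast)
qed

end
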